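(* Let $A$ be a separable $C^*$-algebra, $n\ge1$, and $a\in CB^\infty(\mathbb{R}^{2n},A)$. There exists $p\in CB^\infty(\mathbb{R}^{2n},A)$ such that $$\langle \mathcal{O}(a)\varphi,\psi\rangle=\langle\varphi,\mathcal{O}(p)\psi\rangle\qquad\text{for all }\varphi,\psi\in S^A(\mathbb{R}^n).$$
   Context: $A$ is a separable $C^*$-algebra. $S^A(\mathbb{R}^n)$ is the space of Schwartz functions $\mathbb{R}^n\to A$, with $A$-valued inner product $\langle f,g\rangle=\int f(x)^*g(x)\,dx$ and norm $\|f\|_2=\|\langle f,f\rangle\|_A^{1/2}$. $E$ is its completion, a (right) Hilbert $A$-module, and $\langle\cdot,\cdot\rangle$ is extended to $E$. $CB^\infty(\mathbb{R}^m,A)$ is the set of $C^\infty$ functions $\mathbb{R}^m\to A$ bounded together with all their derivatives. For $a\in CB^\infty(\mathbb{R}^{2n},A)$, $\mathcal{O}(a)=a(x,D)$ is the pseudodifferential operator with symbol $a$, given on $\varphi\in S^A(\mathbb{R}^n)$ by $$a(x,D)\varphi(x)=(2\pi)^{-n}\int\!\!\int e^{i(x-y)\cdot\xi}a(x,\xi)\varphi(y)\,dy\,d\xi=(2\pi)^{-n/2}\int e^{ix\cdot\xi}a(x,\xi)\hat\varphi(\xi)\,d\xi,$$ with $\hat\varphi(\xi)=(2\pi)^{-n/2}\int e^{-i\xi\cdot y}\varphi(y)\,dy$. For $\varphi\in S^A(\mathbb{R}^n)$, $a(x,D)\varphi$ is a square-integrable function ($\int\|a(x,D)\varphi(x)\|^2dx<\infty$),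 regarded as an element of $E$. *)

theory Defs
  imports "HOL-Analysis.Analysis"
begin

section \<open>Separable C*-algebras\<close>

text \<open>The algebras are complex and not assumed to be unital.\<close>

class complex_normed_vector = real_normed_vector +
  fixes scaleC :: "complex \<Rightarrow> 'a \<Rightarrow> 'a" (infixr "*\<^sub>C" 75)
  assumes scaleC_add_right: "c *\<^sub>C (x + y) = c *\<^sub>C x + c *\<^sub>C y"
    and scaleC_add_left: "(c + d) *\<^sub>C x = c *\<^sub>C x + d *\<^sub>C x"
    and scaleC_scaleC: "c *\<^sub>C (d *\<^sub>C x) = (c * d) *\<^sub>C x"
    and scaleR_scaleC: "r *\<^sub>R x = complex_of_real r *\<^sub>C x"
    and norm_scaleC: "norm (c *\<^sub>C x) = cmod c * norm x"

class cstar_algebra = complex_normed_vector + real_normed_algebra + banach +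
  fixes cstar :: "'a \<Rightarrow> 'a"
  assumes mult_scaleC_left: "(c *\<^sub>C x) * y = c *\<^sub>C (x * y)"
    and mult_scaleC_right: "x * (c *\<^sub>C y) = c *\<^sub>C (x * y)"
    and cstar_add: "cstar (x + y) = cstar x + cstar y"
    and cstar_scaleC: "cstar (c *\<^sub>C x) = cnj c *\<^sub>C cstar x"
    and cstar_mult: "cstar (x * y) = cstar y * cstar x"
    and cstar_cstar: "cstar (cstar x) = x"
    and cstar_identity: "norm (cstar x * x) = (norm x)\<^sup>2"

class separable_cstar_algebra = cstar_algebra +
  assumes separable: "\<exists>D. countable D \<and> (\<forall>x. \<forall>e>0. \<exists>d\<in>D. dist d x < e)"

text \<open>The Bochner integral is defined for functions with values in a second countable Banach
  space.\<close>

instance separable_cstar_algebra \<subseteq> second_countable_topology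
proof
  obtain D :: "'a set" where D: "countable D" "\<And>x e. e > 0 \<Longrightarrow> \<exists>d\<in>D. dist d x < e"
    using separable by blast
  define B where "B = (\<lambda>(d, k). ball d (inverse (real (Suc k)))) ` (D \<times> (UNIV :: nat set))"
  have "countable B"
    using D(1) by (simp add: B_def)
  moreover have "topological_basis B"
  proof (rule topological_basisI)
    fix b assume "b \<in> B"
    then show "open b" by (auto simp: B_def)
  next
    fix U :: "'a set" and x
    assume "open U" "x \<in> U"
    then obtain e where e: "e > 0" "ball x e \<subseteq> U"
      using open_contains_ball by blast
    obtain k where k: "inverse (real (Suc k)) < e / 2"
      using reals_Archimedean[of "e / 2"] e(1) by auto
    obtain d where d: "d \<in> D" "dist d x < inverse (real (Suc k))"
      using D(2)[of "inverse (real (Suc k))" x] by auto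
    have "ball d (inverse (real (Suc k))) \<subseteq> ball x e"
    proof
      fix y assume "y \<in> ball d (inverse (real (Suc k)))"
      then have "dist d y < inverse (real (Suc k))" by simp
      moreover have "dist x y \<le> dist d x + dist d y"
        by (metis dist_commute dist_triangle)
      ultimately show "y \<in> ball x e" using d(2) k by simp
    qed
    moreover have "ball d (inverse (real (Suc k))) \<in> B"
      using d(1) by (force simp: B_def)
    ultimately show "\<exists>b\<in>B. x \<in> b \<and> b \<subseteq> U"
      using d(2) e(2) by (meson mem_ball subset_trans)
  qed
  ultimately show "\<exists>B :: 'a set set. countable B \<and> open = generate_topology B"
    using topological_basis_imp_subbasis by blast
qed


section \<open>Smooth functions\<close>

text \<open>Mixed partial derivatives are indexed by lists of coordinate directions rather than by
  multi-indices.\<close>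

primrec partial_derivs ::
    "'e::euclidean_space list \<Rightarrow> ('e \<Rightarrow> 'b::real_normed_vector) \<Rightarrow> 'e \<Rightarrow> 'b" where
  "partial_derivs [] f = f"
| "partial_derivs (b # bs) f = (\<lambda>x. frechet_derivative (partial_derivs bs f) (at x) b)"

text \<open>Differentiability of all partial derivatives makes all of them continuous, so this is
  the class of infinitely often continuously differentiable functions.\<close>

definition smooth :: "('e::euclidean_space \<Rightarrow> 'b::real_normed_vector) \<Rightarrow> bool" where
  "smooth f \<longleftrightarrow> (\<forall>bs. set bs \<subseteq> Basis \<longrightarrow> partial_derivs bs f differentiable_on UNIV)"

definition CB_infinity :: "('e::euclidean_space \<Rightarrow> 'b::real_normed_vector) set" where
  "CB_infinity = {f. smooth f \<and> (\<forall>bs. set bs \<subseteq> Basis \<longrightarrow> bounded (range (partial_derivs bs f)))}"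

definition schwartz :: "('e::euclidean_space \<Rightarrow> 'b::real_normed_vector) set" where
  "schwartz = {f. smooth f \<and> (\<forall>bs k. set bs \<subseteq> Basis \<longrightarrow>
     bounded (range (\<lambda>x. norm x ^ k *\<^sub>R partial_derivs bs f x)))}"


section \<open>Hilbert modules and the completion of the Schwartz space\<close>

locale hilbert_module =
  fixes act :: "'v::{complex_normed_vector, banach} \<Rightarrow> 'a::cstar_algebra \<Rightarrow> 'v"
    and ip :: "'v \<Rightarrow> 'v \<Rightarrow> 'a"
  assumes act_add_left: "act (u + v) c = act u c + act v c"
    and act_add_right: "act u (c + d) = act u c + act u d"
    and act_mult: "act u (c * d) = act (act u c) d"
    and act_scaleC_left: "act (z *\<^sub>C u) c = z *\<^sub>C act u c"
    and act_scaleC_right: "act u (z *\<^sub>C c) = z *\<^sub>C act u c"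
    and ip_add_right: "ip u (v + w) = ip u v + ip u w"
    and ip_scaleC_right: "ip u (z *\<^sub>C v) = z *\<^sub>C ip u v"
    and ip_act_right: "ip u (act v c) = ip u v * c"
    and ip_cstar: "cstar (ip u v) = ip v u"
    and ip_positive: "\<exists>c. ip u u = cstar c * c"
    and norm_eq_sqrt_ip: "norm u = sqrt (norm (ip u u))"

definition schwartz_ip ::
    "(real^'n \<Rightarrow> 'a::separable_cstar_algebra) \<Rightarrow> (real^'n \<Rightarrow> 'a) \<Rightarrow> 'a" where
  "schwartz_ip f g = (\<integral>x. cstar (f x) * g x \<partial>lborel)"

text \<open>A completion of the pre-Hilbert module of Schwartz functions, which is unique up to
  unitary isomorphism, consists of a Hilbert module \<open>'v\<close> and a map \<open>emb\<close> whose restriction to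
  \<^const>\<open>schwartz\<close> is a module map, preserves the inner product and has dense range.  The
  values of \<open>emb\<close> on other functions are irrelevant.\<close>

locale schwartz_completion = hilbert_module act ip
  for act :: "'v::{complex_normed_vector, banach} \<Rightarrow> 'a::separable_cstar_algebra \<Rightarrow> 'v"
    and ip :: "'v \<Rightarrow> 'v \<Rightarrow> 'a" +
  fixes emb :: "(real^'n \<Rightarrow> 'a) \<Rightarrow> 'v"
  assumes emb_add:
      "\<lbrakk>f \<in> schwartz; g \<in> schwartz\<rbrakk> \<Longrightarrow> emb (\<lambda>x. f x + g x) = emb f + emb g"
    and emb_scaleC: "f \<in> schwartz \<Longrightarrow> emb (\<lambda>x. z *\<^sub>C f x) = z *\<^sub>C emb f"
    and emb_act: "f \<in> schwartz \<Longrightarrow> emb (\<lambda>x. f x * c) = act (emb f) c"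
    and ip_emb: "\<lbrakk>f \<in> schwartz; g \<in> schwartz\<rbrakk> \<Longrightarrow> ip (emb f) (emb g) = schwartz_ip f g"
    and dense_emb: "closure (emb ` schwartz) = UNIV"

text \<open>A square-integrable function \<open>f\<close>, regarded as an element of the completion: the limit of
  any sequence of Schwartz functions \<open>F k\<close> with \<open>\<integral>\<parallel>F k - f\<parallel>\<^sup>2 \<longlonglongrightarrow> 0\<close>.  The limit exists and does not
  depend on the sequence, because the module norm is dominated by the norm
  \<open>f \<mapsto> (\<integral>\<parallel>f\<parallel>\<^sup>2)\<^bsup>1/2\<^esup>\<close>, in which Schwartz functions are dense.\<close>

definition L2_embed ::
    "((real^'n \<Rightarrow> 'a::separable_cstar_algebra) \<Rightarrow> 'v::real_normed_vector) \<Rightarrow> (real^'n \<Rightarrow> 'a) \<Rightarrow> 'v"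
  where
  "L2_embed emb f = (THE u. \<exists>F :: nat \<Rightarrow> real^'n \<Rightarrow> 'a.
     (\<forall>k. F k \<in> schwartz) \<and>
     (\<lambda>k. \<integral>\<^sup>+x. ennreal ((norm (F k x - f x))\<^sup>2) \<partial>lborel) \<longlonglongrightarrow> 0 \<and>
     (\<lambda>k. emb (F k)) \<longlonglongrightarrow> u)"


section \<open>Pseudodifferential operators\<close>

definition fourier :: "(real^'n \<Rightarrow> 'a::separable_cstar_algebra) \<Rightarrow> real^'n \<Rightarrow> 'a" where
  "fourier \<phi> \<xi> = (2 * pi) powr (- real CARD('n) / 2) *\<^sub>R
     (\<integral>y. cis (- (\<xi> \<bullet> y)) *\<^sub>C \<phi> y \<partial>lborel)"

text \<open>The double integral \<open>\<integral>\<integral> e\<^bsup>i(x-y)\<xi>\<^esup> a(x,\<xi>) \<phi>(y) dy d\<xi>\<close> is an iterated integral and in general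
  not absolutely convergent; carrying out the integration in \<open>y\<close> gives the formula below.\<close>

definition pdo ::
    "((real^'n) \<times> (real^'n) \<Rightarrow> 'a::separable_cstar_algebra) \<Rightarrow> (real^'n \<Rightarrow> 'a) \<Rightarrow> real^'n \<Rightarrow> 'a"
  where
  "pdo a \<phi> x = (2 * pi) powr (- real CARD('n) / 2) *\<^sub>R
     (\<integral>\<xi>. cis (x \<bullet> \<xi>) *\<^sub>C (a (x, \<xi>) * fourier \<phi> \<xi>) \<partial>lborel)"

end

theory Submission
  imports Defs "HOL-Probability.Characteristic_Functions" "HOL-Probability.Sinc_Integral"
begin

text \<open>
  The adjoint of \<open>a(x,D)\<close> should have the symbol
  \<open>p(x,\<xi>) = (2\<pi>)\<^sup>-\<^sup>n \<integral>\<integral> e\<^bsup>-iy\<eta>\<^esup> a(x-y,\<xi>-\<eta>)\<^sup>* dy d\<eta>\<close>, an oscillatory integral.  It can be replaced by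
  absolutely convergent ones.  The function \<open>\<gamma>(t) = t e\<^sup>-\<^sup>t\<close> for \<open>t > 0\<close>, extended by zero, is the
  fundamental solution of \<open>(1 + d/dt)\<^sup>2\<close>.  Let \<open>g\<close> be the product of its values in all \<open>2n\<close> coordinates.
  Then \<open>a\<^sup>* = g * b\<close>, where \<open>b\<close> is obtained from \<open>a\<^sup>*\<close> by applying the operators \<open>(1 + \<partial>\<^sub>j)\<^sup>2\<close> for all
  coordinates (lemma \<open>gamma_kernel_convolution_representation\<close>).  The passage from \<open>a\<^sup>*\<close> to \<open>p\<close> commutes with
  translations of phase space, so \<open>p = q * b\<close>, where \<open>q\<close> is the scalar function that belongs to \<open>g\<close>.
  It is given, up to the factor \<open>(2\<pi>)\<^sup>-\<^sup>n\<close>, by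
  \<open>q(v,\<eta>) = \<integral> \<gamma>(t+v) \<gamma>^(t) e\<^bsup>it\<eta>\<^esup> dt\<close>, with \<open>\<gamma>\<close> taken coordinatewise and the Fourier transform
  \<open>\<gamma>^(t) = \<Prod>\<^sub>j (1 + it\<^sub>j)\<^bsup>-2\<^esup>\<close>.  Two integrations by parts in each coordinate show that \<open>q\<close> is integrable
  (lemma \<open>integrable_adjoint_kernel\<close>), and convolution with an integrable function preserves the space of symbols
  that are bounded with all derivatives (lemma \<open>convolution_CB_infinity\<close>).  So \<open>p\<close> is a symbol of the required kind.

  Both sides of the adjoint relation are integrals over phase space of a symbol between two factors that are
  built from \<open>\<phi>\<close> and \<open>\<psi>\<close>.  By Fubini's theorem (lemma \<open>integral_sandwich_convolution\<close>) the relation for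
  \<open>g * b\<close> and \<open>q * b\<close> follows from the relation for the single translates of \<open>g\<close> and \<open>q\<close> (lemma
  \<open>adjoint_kernel_identity\<close>), which needs only Fubini's theorem again and Fourier inversion for \<open>\<psi>\<close>.

  It remains to interpret \<open>a(x,D)\<phi>\<close> as an element of the completion.  The functions
  \<open>x \<mapsto> \<integral> e\<^bsup>isx\<xi>\<^esup> a(x,\<xi>) h(\<xi>) d\<xi>\<close> with a symbol \<open>a\<close> and a Schwartz function \<open>h\<close> are bounded, and their linear
  span is closed under partial derivatives and under multiplication by coordinates.  Hence they are
  Schwartz functions (lemma \<open>osc_integral_schwartz\<close>).  In particular \<open>\<phi>^\<close> and \<open>a(x,D)\<phi>\<close> are
  Schwartz functions, and \<open>a(x,D)\<phi>\<close> is embedded in the completion as such (lemma \<open>L2_embed_schwartz\<close>).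
\<close>

section \<open>Complex normed spaces and C*-algebras\<close>

lemma norm_cstar [simp]: "norm (cstar x) = norm (x :: 'a::cstar_algebra)"
proof -
  have le: "norm x \<le> norm (cstar x)" for x :: 'a
  proof (cases "x = 0")
    case False
    have "norm x * norm x \<le> norm (cstar x) * norm x"
      using cstar_identity[of x] norm_mult_ineq[of "cstar x" x] by (simp add: power2_eq_square)
    then show ?thesis using False by simp
  qed simp
  show ?thesis using le[of x] le[of "cstar x"] by (simp add: cstar_cstar)
qed

lemma bounded_linear_cstar: "bounded_linear (cstar :: 'a::cstar_algebra \<Rightarrow> 'a)"
  by (rule bounded_linear_intro[where K = 1])
     (simp_all add: cstar_add scaleR_scaleC cstar_scaleC)

lemma bounded_bilinear_scaleC:
  "bounded_bilinear (\<lambda>c (x :: 'a::complex_normed_vector). c *\<^sub>C x)"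
proof
  show "\<exists>K. \<forall>c (x::'a). norm (c *\<^sub>C x) \<le> norm c * norm x * K"
    by (rule exI[of _ 1]) (simp add: norm_scaleC)
qed (simp_all add: scaleC_add_left scaleC_add_right scaleR_scaleC scaleC_scaleC
       scaleR_conv_of_real mult.commute)

lemmas continuous_on_scaleC [continuous_intros] =
  bounded_bilinear.continuous_on[OF bounded_bilinear_scaleC]
lemmas continuous_on_cstar [continuous_intros] =
  bounded_linear.continuous_on[OF bounded_linear_cstar]
lemmas bounded_linear_scaleC_right = bounded_bilinear.bounded_linear_right[OF bounded_bilinear_scaleC]
lemmas bounded_linear_scaleC_left = bounded_bilinear.bounded_linear_left[OF bounded_bilinear_scaleC]

lemma scaleC_one [simp]: "1 *\<^sub>C (x :: 'a::complex_normed_vector) = x"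
  using scaleR_scaleC[of 1 x] by simp

lemma borel_measurable_scaleC [measurable (raw)]:
  fixes g :: "'m \<Rightarrow> 'a::{complex_normed_vector, second_countable_topology}"
  assumes "f \<in> borel_measurable M" "g \<in> borel_measurable M"
  shows "(\<lambda>x. f x *\<^sub>C g x) \<in> borel_measurable M"
  using assms by (rule borel_measurable_continuous_Pair) (intro continuous_intros)

lemma cstar_scaleR: "cstar (r *\<^sub>R x) = r *\<^sub>R cstar (x :: 'a::cstar_algebra)"
  by (simp add: scaleR_scaleC cstar_scaleC)

lemma integral_scaleC_right:
  fixes f :: "'m \<Rightarrow> 'a::{complex_normed_vector, banach, second_countable_topology}"
  shows "(\<integral>x. c *\<^sub>C f x \<partial>M) = c *\<^sub>C (\<integral>x. f x \<partial>M)"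
proof (cases "c = 0")
  case True
  then show ?thesis by (simp add: bounded_bilinear.zero_left[OF bounded_bilinear_scaleC])
next
  case False
  then show ?thesis
    by (intro integral_bounded_linear'[OF bounded_linear_scaleC_right bounded_linear_scaleC_right[of "1 / c"]])
       (simp add: scaleC_scaleC)
qed

lemma integral_scaleC_left:
  fixes y :: "'a::{complex_normed_vector, banach, second_countable_topology}"
  assumes "integrable M f"
  shows "(\<integral>x. f x *\<^sub>C y \<partial>M) = (\<integral>x. f x \<partial>M) *\<^sub>C y"
  by (rule integral_bounded_linear[OF bounded_linear_scaleC_left assms])

section \<open>Classes of functions closed under partial differentiation\<close>

text \<open>The linear span of a set of functions.  Smoothness is proved below by exhibiting a class of functions that
  contains its own partial derivatives; by the product rule such a class usually consists of sums of simpler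
  functions.\<close>

inductive_set fspan :: "('e \<Rightarrow> 'b::real_vector) set \<Rightarrow> ('e \<Rightarrow> 'b) set" for G where
  fspan_base: "g \<in> G \<Longrightarrow> g \<in> fspan G"
| fspan_add: "\<lbrakk>f \<in> fspan G; g \<in> fspan G\<rbrakk> \<Longrightarrow> (\<lambda>x. f x + g x) \<in> fspan G"
| fspan_scaleR: "f \<in> fspan G \<Longrightarrow> (\<lambda>x. r *\<^sub>R f x) \<in> fspan G"

definition partials_in ::
    "('e::euclidean_space \<Rightarrow> 'b::real_normed_vector) set \<Rightarrow> ('e \<Rightarrow> 'b) \<Rightarrow> bool" where
  "partials_in C f \<longleftrightarrow>
     (\<exists>f'. (\<forall>x. (f has_derivative f' x) (at x)) \<and> (\<forall>b\<in>Basis. (\<lambda>x. f' x b) \<in> C))"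

lemma partials_inE:
  assumes "partials_in C f"
  obtains f' where "\<And>x. (f has_derivative f' x) (at x)" "\<And>b. b \<in> Basis \<Longrightarrow> (\<lambda>x. f' x b) \<in> C"
  using assms unfolding partials_in_def by blast

lemma partials_inI:
  assumes "\<And>x. (f has_derivative f' x) (at x)" "\<And>b. b \<in> Basis \<Longrightarrow> (\<lambda>x. f' x b) \<in> C"
  shows "partials_in C f"
  using assms unfolding partials_in_def by blast

lemma partials_in_bounded_linear:
  assumes L: "bounded_linear L" and g: "partials_in C g"
  shows "partials_in {\<lambda>x. L (g x) | g. g \<in> C} (\<lambda>x. L (g x))"
proof -
  obtain g' where "\<And>x. (g has_derivative g' x) (at x)" "\<And>b. b \<in> Basis \<Longrightarrow> (\<lambda>x. g' x b) \<in> C"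
    by (rule partials_inE[OF g]) blast
  then show ?thesis by (intro partials_inI[OF bounded_linear.has_derivative[OF L]]) auto
qed

lemma partials_in_fspan:
  assumes "\<And>g. g \<in> G \<Longrightarrow> partials_in (fspan G) g" and "f \<in> fspan G"
  shows "partials_in (fspan G) f"
  using assms(2)
proof induction
  case (fspan_add f g)
  obtain f' where f': "\<And>x. (f has_derivative f' x) (at x)" "\<And>b. b \<in> Basis \<Longrightarrow> (\<lambda>x. f' x b) \<in> fspan G"
    by (rule partials_inE[OF fspan_add(3)]) blast
  obtain g' where g': "\<And>x. (g has_derivative g' x) (at x)" "\<And>b. b \<in> Basis \<Longrightarrow> (\<lambda>x. g' x b) \<in> fspan G"
    by (rule partials_inE[OF fspan_add(4)]) blast
  show ?case
    by (rule partials_inI[OF has_derivative_add[OF f'(1) g'(1)]]) (intro fspan.fspan_add f' g')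
next
  case (fspan_scaleR f r)
  obtain f' where f': "\<And>x. (f has_derivative f' x) (at x)" "\<And>b. b \<in> Basis \<Longrightarrow> (\<lambda>x. f' x b) \<in> fspan G"
    by (rule partials_inE[OF fspan_scaleR(2)]) blast
  show ?case
    by (rule partials_inI[OF has_derivative_scaleR_right[OF f'(1)]]) (intro fspan.fspan_scaleR f')
qed (use assms in auto)

text \<open>The principle behind all smoothness proofs: a class that contains the first partial derivatives of its members
  contains all iterated ones, so that no formula for higher derivatives is needed.\<close>

lemma partial_derivs_closed:
  assumes "\<And>f. f \<in> C \<Longrightarrow> partials_in C f" "f \<in> C" "set bs \<subseteq> Basis"
  shows "partial_derivs bs f \<in> C"
  using assms(3)
proof (induction bs)
  case (Cons b bs)
  then have "partials_in C (partial_derivs bs f)" using assms by auto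
  then obtain g' where g': "\<And>x. (partial_derivs bs f has_derivative g' x) (at x)" "(\<lambda>x. g' x b) \<in> C"
    using Cons.prems by (auto simp: partials_in_def)
  moreover have "g' x = frechet_derivative (partial_derivs bs f) (at x)" for x
    using g'(1) by (rule frechet_derivative_at)
  ultimately show ?case by simp
qed (use assms in simp)

lemma smooth_if_partials_in:
  assumes "\<And>f. f \<in> C \<Longrightarrow> partials_in C f" "f \<in> C"
  shows "smooth f"
  unfolding smooth_def
proof (intro allI impI)
  fix bs :: "'a list" assume "set bs \<subseteq> Basis"
  then have "partials_in C (partial_derivs bs f)" using assms partial_derivs_closed by blast
  then show "partial_derivs bs f differentiable_on UNIV"
    unfolding partials_in_def differentiable_on_def differentiable_def by auto
qed

lemma CB_infinity_coinduct:
  assumes "\<And>f. f \<in> C \<Longrightarrow> partials_in C f" "\<And>f. f \<in> C \<Longrightarrow> bounded (range f)" "f \<in> C"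
  shows "f \<in> CB_infinity"
  using smooth_if_partials_in[of C f] partial_derivs_closed[of C f] assms
  by (auto simp: CB_infinity_def)

lemma schwartz_coinduct:
  assumes "\<And>f. f \<in> C \<Longrightarrow> partials_in C f"
    and "\<And>f k. f \<in> C \<Longrightarrow> bounded (range (\<lambda>x. norm x ^ k *\<^sub>R f x))" "f \<in> C"
  shows "f \<in> schwartz"
  using smooth_if_partials_in[of C f] partial_derivs_closed[of C f] assms
  by (auto simp: schwartz_def)

lemma partial_derivs_append: "partial_derivs bs (partial_derivs cs f) = partial_derivs (bs @ cs) f"
  by (induction bs) auto

lemma smooth_has_derivative:
  assumes "smooth f"
  shows "(f has_derivative frechet_derivative f (at x)) (at x)"
proof -
  have "partial_derivs [] f differentiable_on UNIV" using assms unfolding smooth_def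
    by (elim allE[of _ "[]"]) simp
  then show ?thesis by (simp add: differentiable_on_def frechet_derivative_works)
qed

lemma partials_in_CB_infinity: "f \<in> CB_infinity \<Longrightarrow> partials_in CB_infinity f"
proof -
  assume f: "f \<in> CB_infinity"
  have "(\<lambda>x. frechet_derivative f (at x) b) \<in> CB_infinity" if "b \<in> Basis" for b
    using f that partial_derivs_append[of _ "[b]" f]
    by (auto simp: CB_infinity_def smooth_def)
  moreover have "smooth f" using f by (simp add: CB_infinity_def)
  ultimately show ?thesis by (intro partials_inI[OF smooth_has_derivative])
qed

lemma partials_in_schwartz: "f \<in> schwartz \<Longrightarrow> partials_in schwartz f"
proof -
  assume f: "f \<in> schwartz"
  have "(\<lambda>x. frechet_derivative f (at x) b) \<in> schwartz" if "b \<in> Basis" for b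
    using f that partial_derivs_append[of _ "[b]" f]
    by (auto simp: schwartz_def smooth_def)
  moreover have "smooth f" using f by (simp add: schwartz_def)
  ultimately show ?thesis by (intro partials_inI[OF smooth_has_derivative])
qed

lemma CB_infinity_boundedE:
  assumes "f \<in> CB_infinity" obtains B where "B \<ge> 0" "\<And>x. norm (f x) \<le> B"
proof -
  have "bounded (range (partial_derivs [] f))"
    using assms unfolding CB_infinity_def mem_Collect_eq by (elim conjE allE[of _ "[]"]) simp
  then obtain B where "\<And>x. norm (f x) \<le> B" by (auto simp: bounded_iff)
  then show ?thesis using that[of B] norm_ge_zero[of "f undefined"] order_trans by blast
qed

lemma schwartz_bounded: "f \<in> schwartz \<Longrightarrow> bounded (range (\<lambda>x. norm x ^ k *\<^sub>R f x))"
  unfolding schwartz_def mem_Collect_eq by (elim conjE allE[of _ "[]"]) simp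

lemma schwartz_boundedE:
  assumes "f \<in> schwartz" obtains B where "B \<ge> 0" "\<And>x. norm x ^ k * norm (f x) \<le> B"
proof -
  obtain B where "\<And>x. norm x ^ k * norm (f x) \<le> B"
    using schwartz_bounded[OF assms, of k] by (auto simp: bounded_iff)
  moreover have "0 \<le> norm undefined ^ k * norm (f undefined)" by simp
  ultimately show ?thesis using that[of B] order_trans by blast
qed

lemma CB_infinity_continuous: "f \<in> CB_infinity \<Longrightarrow> continuous_on A f"
  unfolding CB_infinity_def mem_Collect_eq
  by (intro continuous_at_imp_continuous_on ballI has_derivative_continuous[OF smooth_has_derivative]) simp

lemma schwartz_continuous: "f \<in> schwartz \<Longrightarrow> continuous_on A f"
  unfolding schwartz_def mem_Collect_eq
  by (intro continuous_at_imp_continuous_on ballI has_derivative_continuous[OF smooth_has_derivative]) simp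

lemma continuous_on_schwartz:
  "f \<in> schwartz \<Longrightarrow> continuous_on A g \<Longrightarrow> continuous_on A (\<lambda>x. f (g x))"
  by (rule continuous_on_compose2[OF schwartz_continuous[of f UNIV]]) auto

lemma fspan_bounded:
  assumes "\<And>g. g \<in> G \<Longrightarrow> bounded (range (\<lambda>x. (w x :: real) *\<^sub>R g x :: 'b::real_normed_vector))" "f \<in> fspan G"
  shows "bounded (range (\<lambda>x. w x *\<^sub>R f x))"
  using assms(2)
proof induction
  case (fspan_add f g)
  show ?case using bounded_plus_comp[OF fspan_add(3,4)] by (simp add: scaleR_add_right)
next
  case (fspan_scaleR f r)
  show ?case using bounded_scaleR_comp[OF fspan_scaleR(2), of r] by (simp add: mult.commute)
qed (use assms in auto)

lemma fspan_CB_infinity: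
  assumes "\<And>g. g \<in> G \<Longrightarrow> partials_in (fspan G) g" "\<And>g. g \<in> G \<Longrightarrow> bounded (range g)" "f \<in> fspan G"
  shows "f \<in> CB_infinity"
  using CB_infinity_coinduct[of "fspan G" f] partials_in_fspan[of G] fspan_bounded[of G "\<lambda>_. 1"] assms
  by simp

lemma fspan_schwartz:
  assumes "\<And>g. g \<in> G \<Longrightarrow> partials_in (fspan G) g"
    and "\<And>g k. g \<in> G \<Longrightarrow> bounded (range (\<lambda>x. norm x ^ k *\<^sub>R g x))" "f \<in> fspan G"
  shows "f \<in> schwartz"
proof (rule schwartz_coinduct)
  show "partials_in (fspan G) f" if "f \<in> fspan G" for f using partials_in_fspan assms(1) that by blast
  show "bounded (range (\<lambda>x. norm x ^ k *\<^sub>R f x))" if "f \<in> fspan G" for f k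
    using fspan_bounded[of G "\<lambda>x. norm x ^ k"] assms(2) that by blast
qed fact

text \<open>Boundedness of the generators is enough if the span is closed under multiplication by coordinates, since
  \<open>\<bar>x\<bar> \<le> \<Sum>\<^sub>b \<bar>x\<^sub>b\<bar>\<close> trades each power of \<open>\<bar>x\<bar>\<close> for coordinate factors.\<close>

lemma fspan_schwartz_coordinates:
  fixes G :: "('e::euclidean_space \<Rightarrow> 'b::real_normed_vector) set"
  assumes part: "\<And>g. g \<in> G \<Longrightarrow> partials_in (fspan G) g"
    and bd: "\<And>g. g \<in> G \<Longrightarrow> bounded (range g)"
    and coord: "\<And>g b. \<lbrakk>g \<in> G; b \<in> Basis\<rbrakk> \<Longrightarrow> (\<lambda>x. (x \<bullet> b) *\<^sub>R g x) \<in> fspan G"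
    and f: "f \<in> fspan G"
  shows "f \<in> schwartz"
proof (rule fspan_schwartz[OF part _ f])
  have coord': "(\<lambda>x. (x \<bullet> b) *\<^sub>R f x) \<in> fspan G" if "f \<in> fspan G" "b \<in> Basis" for f b
    using that(1)
  proof induction
    case (fspan_add f g)
    then show ?case using fspan.fspan_add[OF fspan_add(3,4)] by (simp add: scaleR_add_right)
  next
    case (fspan_scaleR f r)
    then show ?case using fspan.fspan_scaleR[OF fspan_scaleR(2), of r] by (simp add: mult.commute)
  qed (use coord that in auto)
  have all: "bounded (range (\<lambda>x. norm x ^ k *\<^sub>R f x))" if "f \<in> fspan G" for f k
    using that
  proof (induction k arbitrary: f)
    case 0
    then show ?case using fspan_bounded[of G "\<lambda>_. 1" f] bd by simp
  next
    case (Suc k)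
    have "\<forall>b\<in>Basis. \<exists>B. \<forall>x. norm (norm x ^ k *\<^sub>R (x \<bullet> b) *\<^sub>R f x) \<le> B"
    proof
      fix b :: 'e assume "b \<in> Basis"
      then have "bounded (range (\<lambda>x. norm x ^ k *\<^sub>R (x \<bullet> b) *\<^sub>R f x))"
        using Suc.IH[OF coord'[OF Suc.prems]] by blast
      then show "\<exists>B. \<forall>x. norm (norm x ^ k *\<^sub>R (x \<bullet> b) *\<^sub>R f x) \<le> B"
        unfolding bounded_iff by blast
    qed
    then obtain B where B: "\<And>b x. b \<in> Basis \<Longrightarrow> norm (norm x ^ k *\<^sub>R (x \<bullet> b) *\<^sub>R f x) \<le> B b"
      by metis
    have "norm (norm x ^ Suc k *\<^sub>R f x) \<le> (\<Sum>b\<in>Basis. B b)" for x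
    proof -
      have "norm (norm x ^ Suc k *\<^sub>R f x) = norm x * (norm x ^ k * norm (f x))" by simp
      also have "\<dots> \<le> (\<Sum>b\<in>Basis. \<bar>x \<bullet> b\<bar>) * (norm x ^ k * norm (f x))"
        by (intro mult_right_mono norm_le_l1) auto
      also have "\<dots> = (\<Sum>b\<in>Basis. norm (norm x ^ k *\<^sub>R (x \<bullet> b) *\<^sub>R f x))"
        by (simp add: sum_distrib_left sum_distrib_right abs_mult mult_ac)
      also have "\<dots> \<le> (\<Sum>b\<in>Basis. B b)" by (intro sum_mono B)
      finally show ?thesis .
    qed
    then show ?case by (auto simp: bounded_iff)
  qed
  show "bounded (range (\<lambda>x. norm x ^ k *\<^sub>R g x))" if "g \<in> G" for g k
    using all fspan_base that by blast
qed

lemma fspan_schwartz_closed: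
  assumes "f \<in> fspan schwartz" shows "f \<in> schwartz"
proof (rule fspan_schwartz[of schwartz])
  show "partials_in (fspan schwartz) g" if "g \<in> schwartz" for g :: "'a \<Rightarrow> 'b"
    by (rule partials_inE[OF partials_in_schwartz[OF that]], rule partials_inI[of g], assumption,
      rule fspan_base)
  show "bounded (range (\<lambda>x. norm x ^ k *\<^sub>R g x))" if "g \<in> schwartz" for g :: "'a \<Rightarrow> 'b" and k
    using that by (rule schwartz_bounded)
qed fact

lemma schwartz_add:
  assumes "f \<in> schwartz" "g \<in> schwartz" shows "(\<lambda>x. f x + g x) \<in> schwartz"
  by (rule fspan_schwartz_closed, rule fspan_add; rule fspan_base; fact)

lemma CB_infinity_add:
  assumes "f \<in> CB_infinity" "g \<in> CB_infinity" shows "(\<lambda>x. f x + g x) \<in> CB_infinity"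
proof (rule fspan_CB_infinity[of CB_infinity])
  show "partials_in (fspan CB_infinity) g" if "g \<in> CB_infinity" for g :: "'a \<Rightarrow> 'b"
    by (rule partials_inE[OF partials_in_CB_infinity[OF that]], rule partials_inI[of g], assumption,
      rule fspan_base)
  show "bounded (range g)" if "g \<in> CB_infinity" for g :: "'a \<Rightarrow> 'b"
    by (rule CB_infinity_boundedE[OF that]) (auto simp: bounded_iff)
  show "(\<lambda>x. f x + g x) \<in> fspan CB_infinity" by (rule fspan_add; rule fspan_base; fact)
qed

lemma CB_infinity_bounded_linear:
  assumes "bounded_linear L" "f \<in> CB_infinity" shows "(\<lambda>x. L (f x)) \<in> CB_infinity"
proof (rule CB_infinity_coinduct[of "{\<lambda>x. L (g x) | g. g \<in> CB_infinity}"])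
  fix h assume "h \<in> {\<lambda>x. L (g x) | g. g \<in> (CB_infinity :: ('c \<Rightarrow> 'a) set)}"
  then obtain g where h: "h = (\<lambda>x. L (g x))" and g: "g \<in> CB_infinity" by blast
  show "partials_in {\<lambda>x. L (g x) | g. g \<in> CB_infinity} h"
    unfolding h by (rule partials_in_bounded_linear[OF assms(1) partials_in_CB_infinity[OF g]])
  obtain B where "\<And>x. norm (g x) \<le> B" using CB_infinity_boundedE[OF g] by metis
  then have "bounded (range g)" by (auto simp: bounded_iff)
  then show "bounded (range h)"
    unfolding h using bounded_linear_image[OF _ assms(1), of "range g"] by (simp add: image_image)
qed (use assms in auto)

lemma CB_infinity_const: "((\<lambda>_. c) :: 'e::euclidean_space \<Rightarrow> 'b::real_normed_vector) \<in> CB_infinity"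
proof (rule CB_infinity_coinduct[of "range (\<lambda>c _. c)"])
  show "partials_in (range (\<lambda>c _. c)) f" if "f \<in> range (\<lambda>c _. c)" for f :: "'e \<Rightarrow> 'b"
    using that unfolding partials_in_def by (intro exI[of _ "\<lambda>_ _. 0"]) (auto intro!: derivative_intros)
qed auto

lemma schwartz_bounded_linear:
  assumes "bounded_linear L" "f \<in> schwartz" shows "(\<lambda>x. L (f x)) \<in> schwartz"
proof (rule schwartz_coinduct[of "{\<lambda>x. L (g x) | g. g \<in> schwartz}"])
  interpret L: bounded_linear L by fact
  fix h assume "h \<in> {\<lambda>x. L (g x) | g. g \<in> (schwartz :: ('c \<Rightarrow> 'a) set)}"
  then obtain g where h: "h = (\<lambda>x. L (g x))" and g: "g \<in> schwartz" by blast
  show "partials_in {\<lambda>x. L (g x) | g. g \<in> schwartz} h"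
    unfolding h by (rule partials_in_bounded_linear[OF assms(1) partials_in_schwartz[OF g]])
  fix k
  show "bounded (range (\<lambda>x. norm x ^ k *\<^sub>R h x))"
    unfolding h using bounded_linear_image[OF schwartz_bounded[OF g, of k] assms(1)]
    by (simp add: image_image L.scaleR)
qed (use assms in auto)

lemma schwartz_coordinate:
  fixes f :: "'e::euclidean_space \<Rightarrow> 'b::real_normed_vector"
  assumes "f \<in> schwartz" "c \<in> Basis" shows "(\<lambda>x. (c \<bullet> x) *\<^sub>R f x) \<in> schwartz"
proof -
  \<comment> \<open>By the product rule a partial derivative of \<open>x\<^sub>c f\<close> is a combination of a coordinate multiple of a Schwartz
    function and \<open>f\<close> itself, so the span of both kinds of functions is closed.\<close>
  define G where "G = schwartz \<union> {\<lambda>x. (c \<bullet> x) *\<^sub>R g x | g. g \<in> (schwartz :: ('e \<Rightarrow> 'b) set)}"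
  have G1: "g \<in> schwartz \<Longrightarrow> g \<in> fspan G" for g :: "'e \<Rightarrow> 'b"
    by (rule fspan_base) (simp add: G_def)
  have G2: "g \<in> schwartz \<Longrightarrow> (\<lambda>x. (c \<bullet> x) *\<^sub>R g x) \<in> fspan G" for g :: "'e \<Rightarrow> 'b"
    by (rule fspan_base) (unfold G_def, blast)
  have cases: "h \<in> schwartz \<or> (\<exists>g\<in>schwartz. h = (\<lambda>x. (c \<bullet> x) *\<^sub>R g x))" if "h \<in> G" for h :: "'e \<Rightarrow> 'b"
    using that unfolding G_def by blast
  have part: "partials_in (fspan G) h" if "h \<in> G" for h
    using cases[OF that]
  proof (elim disjE bexE)
    assume h: "h \<in> schwartz"
    obtain h' where "\<And>x. (h has_derivative h' x) (at x)" "\<And>b. b \<in> Basis \<Longrightarrow> (\<lambda>x. h' x b) \<in> schwartz"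
      by (rule partials_inE[OF partials_in_schwartz[OF h]]) blast
    then show ?thesis by (intro partials_inI[of h h'] G1)
  next
    fix g assume h: "h = (\<lambda>x. (c \<bullet> x) *\<^sub>R g x)" and g: "g \<in> (schwartz :: ('e \<Rightarrow> 'b) set)"
    obtain g' where g': "\<And>x. (g has_derivative g' x) (at x)" "\<And>b. b \<in> Basis \<Longrightarrow> (\<lambda>x. g' x b) \<in> schwartz"
      by (rule partials_inE[OF partials_in_schwartz[OF g]]) blast
    have "(h has_derivative (\<lambda>v. (c \<bullet> x) *\<^sub>R g' x v + (c \<bullet> v) *\<^sub>R g x)) (at x)" for x
      unfolding h by (rule derivative_eq_intros g'(1) refl)+ simp
    then show ?thesis by (rule partials_inI) (intro fspan_add fspan_scaleR G1 G2 g'(2) g)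
  qed
  have bd: "bounded (range (\<lambda>x. norm x ^ k *\<^sub>R h x))" if "h \<in> G" for h k
    using cases[OF that]
  proof (elim disjE bexE)
    fix g assume h: "h = (\<lambda>x. (c \<bullet> x) *\<^sub>R g x)" and g: "g \<in> (schwartz :: ('e \<Rightarrow> 'b) set)"
    obtain B where B: "\<And>x. norm x ^ Suc k * norm (g x) \<le> B" using schwartz_boundedE[OF g, of "Suc k"] by blast
    have "norm (norm x ^ k *\<^sub>R h x) \<le> B" for x
    proof -
      have "norm (norm x ^ k *\<^sub>R h x) = norm x ^ k * (\<bar>c \<bullet> x\<bar> * norm (g x))" by (simp add: h abs_mult)
      also have "\<dots> \<le> norm x ^ k * (norm x * norm (g x))"
        using Cauchy_Schwarz_ineq2[of c x] assms(2) by (intro mult_left_mono mult_right_mono) auto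
      also have "\<dots> \<le> B" using B[of x] by (simp add: mult_ac)
      finally show ?thesis .
    qed
    then show ?thesis by (auto simp: bounded_iff)
  qed (rule schwartz_bounded)
  show ?thesis using fspan_schwartz[OF part bd G2[OF assms(1)]] .
qed

section \<open>Integration on Euclidean spaces\<close>

text \<open>Differentiation under the integral sign.  The mean value theorem bounds the difference quotients by the same
  function \<open>w\<close> as the derivative, so that dominated convergence applies.\<close>

lemma has_derivative_integral:
  fixes f :: "'x::real_normed_vector \<Rightarrow> 'm::euclidean_space \<Rightarrow> 'b::{banach, second_countable_topology}"
  assumes int: "\<And>x. integrable M (f x)"
    and meas [measurable]: "\<And>x h. f' x h \<in> borel_measurable M"
    and der: "\<And>x y. ((\<lambda>x. f x y) has_derivative (\<lambda>h. f' x h y)) (at x)"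
    and bd: "\<And>x h y. norm (f' x h y) \<le> w y * norm h"
    and w: "integrable M w"
  shows "((\<lambda>x. \<integral>y. f x y \<partial>M) has_derivative (\<lambda>h. \<integral>y. f' x h y \<partial>M)) (at x)"
proof -
  have bd': "norm (f' x h y) \<le> \<bar>w y\<bar> * norm h" for x h y
    by (rule order_trans[OF bd]) (simp add: mult_right_mono)
  have intf': "integrable M (f' x h)" for x h
    by (rule Bochner_Integration.integrable_bound[of M "\<lambda>y. \<bar>w y\<bar> * norm h"])
       (use w bd' in \<open>auto intro!: AE_I2 integrable_mult_left\<close>)
  have lin: "bounded_linear (\<lambda>h. f' x h y)" for x y
    using der by (rule has_derivative_bounded_linear)
  have "bounded_linear (\<lambda>h. \<integral>y. f' x h y \<partial>M)"
  proof (rule bounded_linear_intro[where K = "\<integral>y. \<bar>w y\<bar> \<partial>M"])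
    fix h k r
    have "f' x (h + k) = (\<lambda>y. f' x h y + f' x k y)"
      using linear_add[OF bounded_linear.linear[OF lin]] by auto
    then show "(\<integral>y. f' x (h + k) y \<partial>M) = (\<integral>y. f' x h y \<partial>M) + (\<integral>y. f' x k y \<partial>M)"
      by (simp add: intf')
    have "f' x (r *\<^sub>R h) = (\<lambda>y. r *\<^sub>R f' x h y)"
      using linear_scale[OF bounded_linear.linear[OF lin]] by auto
    then show "(\<integral>y. f' x (r *\<^sub>R h) y \<partial>M) = r *\<^sub>R (\<integral>y. f' x h y \<partial>M)"
      by (simp add: intf')
    have "norm (\<integral>y. f' x h y \<partial>M) \<le> (\<integral>y. \<bar>w y\<bar> * norm h \<partial>M)"
      using w intf' bd' by (intro Bochner_Integration.integral_norm_bound_integral) auto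
    also have "\<dots> = norm h * (\<integral>y. \<bar>w y\<bar> \<partial>M)" using w by (simp add: mult.commute)
    finally show "norm (\<integral>y. f' x h y \<partial>M) \<le> norm h * (\<integral>y. \<bar>w y\<bar> \<partial>M)" .
  qed
  moreover have lip: "norm (f z y - f x y) \<le> \<bar>w y\<bar> * norm (z - x)" for x z y
    by (rule differentiable_bound[of UNIV "\<lambda>x. f x y" "\<lambda>x h. f' x h y"])
       (use der bd' in \<open>auto intro!: onorm_bound\<close>)
  have "((\<lambda>z. norm ((\<integral>y. f z y \<partial>M) - (\<integral>y. f x y \<partial>M) - (\<integral>y. f' x (z - x) y \<partial>M)) / norm (z - x)) \<longlongrightarrow> 0) (at x)"
    unfolding tendsto_at_iff_sequentially o_def
  proof (intro allI impI)
    fix X :: "nat \<Rightarrow> 'x" assume X: "\<forall>i. X i \<in> UNIV - {x}" "X \<longlonglongrightarrow> x"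
    define R where "R i y = (1 / norm (X i - x)) *\<^sub>R (f (X i) y - f x y - f' x (X i - x) y)" for i y
    have "(\<lambda>i. \<integral>y. R i y \<partial>M) \<longlonglongrightarrow> (\<integral>y. 0 \<partial>M)"
    proof (rule integral_dominated_convergence[where w = "\<lambda>y. 2 * \<bar>w y\<bar>"])
      show "R i \<in> borel_measurable M" for i
        using borel_measurable_integrable[OF int] unfolding R_def by measurable
      show "integrable M (\<lambda>y. 2 * \<bar>w y\<bar>)" using w by auto
      show "AE y in M. (\<lambda>i. R i y) \<longlonglongrightarrow> 0"
      proof (rule AE_I2)
        fix y
        have "((\<lambda>z. norm (f z y - f x y - f' x (z - x) y) / norm (z - x)) \<longlongrightarrow> 0) (at x)"
          using der[where x=x and y=y] unfolding has_derivative_iff_norm by blast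
        then have "(\<lambda>i. norm (f (X i) y - f x y - f' x (X i - x) y) / norm (X i - x)) \<longlonglongrightarrow> 0"
          using X unfolding tendsto_at_iff_sequentially o_def by blast
        then show "(\<lambda>i. R i y) \<longlonglongrightarrow> 0"
          by (subst tendsto_norm_zero_iff[symmetric]) (simp add: R_def divide_inverse mult.commute)
      qed
      show "AE y in M. norm (R i y) \<le> 2 * \<bar>w y\<bar>" for i
      proof (rule AE_I2)
        fix y
        have pos: "norm (X i - x) > 0" using X by auto
        have "norm (f (X i) y - f x y - f' x (X i - x) y) \<le> 2 * \<bar>w y\<bar> * norm (X i - x)"
          using norm_triangle_ineq4[of "f (X i) y - f x y" "f' x (X i - x) y"] lip[of "X i" y x] bd'[of x "X i - x" y]
          by simp
        then show "norm (R i y) \<le> 2 * \<bar>w y\<bar>" using pos by (simp add: R_def divide_simps)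
      qed
    qed simp
    then have "(\<lambda>i. norm (\<integral>y. R i y \<partial>M)) \<longlonglongrightarrow> 0" using tendsto_norm by force
    moreover have "(\<integral>y. R i y \<partial>M) = (1 / norm (X i - x)) *\<^sub>R
        ((\<integral>y. f (X i) y \<partial>M) - (\<integral>y. f x y \<partial>M) - (\<integral>y. f' x (X i - x) y \<partial>M))" for i
      unfolding R_def by (simp add: int intf')
    ultimately show "(\<lambda>i. norm ((\<integral>y. f (X i) y \<partial>M) - (\<integral>y. f x y \<partial>M) - (\<integral>y. f' x (X i - x) y \<partial>M)) / norm (X i - x)) \<longlonglongrightarrow> 0"
      by (simp add: divide_inverse mult.commute)
  qed
  ultimately show ?thesis unfolding has_derivative_iff_norm by blast
qed

lemma lborel_integral_translate:
  fixes f :: "'e::euclidean_space \<Rightarrow> 'b::{banach, second_countable_topology}"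
  assumes "f \<in> borel_measurable borel"
  shows "(\<integral>x. f (x + a) \<partial>lborel) = (\<integral>x. f x \<partial>lborel)"
proof -
  have "(\<integral>x. f x \<partial>lborel) = (\<integral>x. f x \<partial>distr lborel borel ((+) a))" by (simp add: lborel_distr_plus)
  also have "\<dots> = (\<integral>x. f (a + x) \<partial>lborel)" using assms by (intro integral_distr) auto
  finally show ?thesis by (simp add: add.commute)
qed

lemma lborel_integrable_translate:
  fixes f :: "'e::euclidean_space \<Rightarrow> 'b::{banach, second_countable_topology}"
  assumes "integrable lborel f"
  shows "integrable lborel (\<lambda>x. f (x + a))"
proof -
  have "integrable (distr lborel borel ((+) a)) f" using assms by (simp add: lborel_distr_plus)
  then have "integrable lborel (\<lambda>x. f (a + x))" using assms by (subst (asm) integrable_distr_eq) auto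
  then show ?thesis by (simp add: add.commute)
qed

interpretation lborel_product: product_sigma_finite "\<lambda>_. lborel :: real measure" ..

lemma
  fixes f :: "'e::euclidean_space \<Rightarrow> real \<Rightarrow> 'b::{real_normed_field, banach, second_countable_topology}"
  assumes f: "\<And>b. b \<in> Basis \<Longrightarrow> integrable lborel (f b)"
  shows lborel_integrable_prod: "integrable lborel (\<lambda>x. \<Prod>b\<in>Basis. f b (x \<bullet> b))"
    and lborel_integral_prod: "(\<integral>x. (\<Prod>b\<in>Basis. f b (x \<bullet> b)) \<partial>lborel) = (\<Prod>b\<in>Basis. \<integral>t. f b t \<partial>lborel)"
proof -
  let ?T = "\<lambda>g. \<Sum>b\<in>Basis. g b *\<^sub>R b :: 'e"
  have [measurable]: "f b \<in> borel_measurable borel" if "b \<in> Basis" for b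
    using f[OF that] by auto
  have eq: "(\<lambda>g. \<Prod>b\<in>Basis. f b (?T g \<bullet> b)) = (\<lambda>g. \<Prod>b\<in>Basis. f b (g b))"
    by (intro ext prod.cong) (simp_all add: inner_sum_left inner_Basis if_distrib if_distribR cong: if_cong)
  show "integrable lborel (\<lambda>x. \<Prod>b\<in>Basis. f b (x \<bullet> b))"
    by (subst lborel_eq, subst integrable_distr_eq)
       (auto simp: eq intro!: lborel_product.product_integrable_prod f)
  show "(\<integral>x. (\<Prod>b\<in>Basis. f b (x \<bullet> b)) \<partial>lborel) = (\<Prod>b\<in>Basis. \<integral>t. f b t \<partial>lborel)"
    by (subst lborel_eq, subst integral_distr)
       (auto simp: eq intro!: lborel_product.product_integral_prod f)
qed

lemma integrable_pair_mult:
  fixes f :: "'e::euclidean_space \<Rightarrow> real" and g :: "'f::euclidean_space \<Rightarrow> real"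
  assumes "integrable lborel f" "integrable lborel g"
  shows "integrable lborel (\<lambda>w. f (fst w) * g (snd w))"
proof -
  have "integrable (lborel \<Otimes>\<^sub>M lborel) (\<lambda>w. f (fst w) * g (snd w))"
  proof (rule lborel_pair.Fubini_integrable)
    show "(\<lambda>w. f (fst w) * g (snd w)) \<in> borel_measurable (lborel \<Otimes>\<^sub>M lborel)"
      using borel_measurable_integrable[OF assms(1)] borel_measurable_integrable[OF assms(2)] by measurable
    show "integrable lborel (\<lambda>x. \<integral>y. norm (f (fst (x, y)) * g (snd (x, y))) \<partial>lborel)"
      using assms by (simp add: abs_mult)
  qed (use assms in auto)
  then show ?thesis by (simp add: lborel_prod)
qed

lemma
  fixes h :: "'x::euclidean_space \<times> 'y::euclidean_space \<Rightarrow> 'b::{banach, second_countable_topology}"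
  assumes h: "integrable lborel h"
  shows lborel_integral_fst: "(\<integral>p. h p \<partial>lborel) = (\<integral>x. \<integral>y. h (x, y) \<partial>lborel \<partial>lborel)"
    and lborel_integral_swap: "(\<integral>x. \<integral>y. h (x, y) \<partial>lborel \<partial>lborel) = (\<integral>y. \<integral>x. h (x, y) \<partial>lborel \<partial>lborel)"
proof -
  have h': "integrable (lborel \<Otimes>\<^sub>M lborel) h" using h by (simp add: lborel_prod)
  show "(\<integral>p. h p \<partial>lborel) = (\<integral>x. \<integral>y. h (x, y) \<partial>lborel \<partial>lborel)"
    using lborel_pair.integral_fst'[OF h'] by (simp add: lborel_prod)
  show "(\<integral>x. \<integral>y. h (x, y) \<partial>lborel \<partial>lborel) = (\<integral>y. \<integral>x. h (x, y) \<partial>lborel \<partial>lborel)"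
    using lborel_pair.Fubini_integral[of "\<lambda>x y. h (x, y)"] h' by simp
qed

lemma lborel_integrable_pair_bound:
  fixes h :: "'x::euclidean_space \<times> 'y::euclidean_space \<Rightarrow> 'b::{banach, second_countable_topology}"
  assumes "h \<in> borel_measurable borel" "integrable lborel N" "integrable lborel M"
    and bd: "\<And>x y. norm (h (x, y)) \<le> N x * M y"
  shows "integrable lborel h"
proof (rule Bochner_Integration.integrable_bound[OF integrable_pair_mult[OF assms(2,3)]])
  show "AE p in lborel. norm (h p) \<le> norm (N (fst p) * M (snd p))"
    using order_trans[OF bd abs_ge_self] by (intro AE_I2) auto
qed (use assms in simp)

lemma lborel_integral_affine:
  fixes f :: "'e::euclidean_space \<Rightarrow> 'b::{banach, second_countable_topology}"
  assumes [measurable]: "f \<in> borel_measurable borel" and c: "c \<noteq> 0"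
  shows "(\<integral>x. f x \<partial>lborel) = \<bar>c\<bar> ^ DIM('e) *\<^sub>R (\<integral>x. f (t + c *\<^sub>R x) \<partial>lborel)"
proof -
  have "(\<integral>x. f x \<partial>lborel) = (\<integral>x. f x \<partial>density (distr lborel borel (\<lambda>x. t + c *\<^sub>R x)) (\<lambda>_. ennreal (\<bar>c\<bar> ^ DIM('e))))"
    using lborel_affine[OF c, of t] by simp
  also have "\<dots> = \<bar>c\<bar> ^ DIM('e) *\<^sub>R (\<integral>x. f (t + c *\<^sub>R x) \<partial>lborel)"
    by (subst integral_density) (auto simp: integral_distr)
  finally show ?thesis .
qed

lemma lborel_integral_reflect:
  fixes f :: "'e::euclidean_space \<Rightarrow> 'b::{banach, second_countable_topology}"
  assumes "f \<in> borel_measurable borel"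
  shows "(\<integral>x. f (t - x) \<partial>lborel) = (\<integral>x. f x \<partial>lborel)"
  using lborel_integral_affine[OF assms, of "-1" t] by simp

lemma lborel_integrable_reflect:
  fixes f :: "'e::euclidean_space \<Rightarrow> 'b::{banach, second_countable_topology}"
  assumes "integrable lborel f"
  shows "integrable lborel (\<lambda>x. f (t - x))"
proof -
  have eq: "lborel = distr lborel borel (\<lambda>x::'e. t - x)"
    using lborel_affine[of "-1" t] by (simp add: density_1)
  have "integrable (distr lborel borel (\<lambda>x::'e. t - x)) f" using assms by (simp add: eq[symmetric])
  then show ?thesis using assms by (subst (asm) integrable_distr_eq) auto
qed

text \<open>An integrable weight that dominates Schwartz functions and changes only by a constant factor under translations
  of length at most one.  The exponent \<open>2 DIM('e)\<close> makes it at most the product of the functions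
  \<open>1 / (1 + x\<^sub>b\<^sup>2)\<close>.\<close>

definition schwartz_weight :: "'e::euclidean_space \<Rightarrow> real" where
  "schwartz_weight x = inverse ((1 + norm x) ^ (2 * DIM('e)))"

lemma schwartz_weight_pos [simp]: "0 < schwartz_weight x"
  by (auto simp: schwartz_weight_def add_pos_nonneg)

lemma continuous_schwartz_weight: "continuous_on A schwartz_weight"
proof -
  have "(1 + norm x) ^ k \<noteq> 0" for x :: 'a and k
    using norm_ge_zero[of x] by (smt (verit) zero_less_power)
  then show ?thesis unfolding schwartz_weight_def[abs_def] by (intro continuous_intros) auto
qed

lemma integrable_inverse_square: "integrable lborel (\<lambda>t::real. inverse (1 + t\<^sup>2))"
  using integrable_inverse_1_plus_square by (simp add: set_integrable_def)

lemma integrable_schwartz_weight: "integrable lborel (schwartz_weight :: 'e::euclidean_space \<Rightarrow> real)"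
proof (rule Bochner_Integration.integrable_bound)
  show "integrable lborel (\<lambda>x::'e. \<Prod>b\<in>Basis. inverse (1 + (x \<bullet> b)\<^sup>2))"
    using integrable_inverse_square by (rule lborel_integrable_prod)
  show "schwartz_weight \<in> borel_measurable lborel"
    using borel_measurable_continuous_onI[OF continuous_schwartz_weight] by simp
  show "AE x::'e in lborel. norm (schwartz_weight x) \<le> norm (\<Prod>b\<in>Basis. inverse (1 + (x \<bullet> b)\<^sup>2))"
  proof (rule AE_I2)
    fix x :: 'e
    have "(\<Prod>b\<in>(Basis::'e set). 1 + (x \<bullet> b)\<^sup>2) \<le> (\<Prod>b\<in>(Basis::'e set). (1 + norm x)\<^sup>2)"
    proof (rule prod_mono, safe)
      fix b :: 'e assume "b \<in> Basis"
      then have "(x \<bullet> b)\<^sup>2 \<le> (norm x)\<^sup>2"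
        using Basis_le_norm[of b x] abs_le_square_iff[of "x \<bullet> b" "norm x"] by simp
      then show "1 + (x \<bullet> b)\<^sup>2 \<le> (1 + norm x)\<^sup>2" by (simp add: power2_sum add_increasing2)
    qed simp
    then have "(\<Prod>b\<in>(Basis::'e set). 1 + (x \<bullet> b)\<^sup>2) \<le> (1 + norm x) ^ (2 * DIM('e))"
      by (simp add: power_mult)
    moreover have "0 < (\<Prod>b\<in>(Basis::'e set). 1 + (x \<bullet> b)\<^sup>2)"
      by (intro prod_pos) (simp add: add_pos_nonneg)
    ultimately have "schwartz_weight x \<le> inverse (\<Prod>b\<in>(Basis::'e set). 1 + (x \<bullet> b)\<^sup>2)"
      unfolding schwartz_weight_def by (rule le_imp_inverse_le)
    also have "\<dots> = (\<Prod>b\<in>(Basis::'e set). inverse (1 + (x \<bullet> b)\<^sup>2))"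
      using prod_inversef[of "\<lambda>b. 1 + (x \<bullet> b)\<^sup>2" "Basis :: 'e set"] by (simp add: o_def)
    finally show "norm (schwartz_weight x) \<le> norm (\<Prod>b\<in>Basis. inverse (1 + (x \<bullet> b)\<^sup>2))"
      using schwartz_weight_pos[of x] by (simp del: schwartz_weight_pos)
  qed
qed

lemma schwartz_weight_shift:
  fixes x v :: "'e::euclidean_space"
  assumes "norm v \<le> 1"
  shows "schwartz_weight (x + v) \<le> 2 ^ (2 * DIM('e)) * schwartz_weight x"
proof -
  have "norm x \<le> norm (x + v) + 1" using norm_triangle_ineq4[of "x + v" v] assms by simp
  then have "1 + norm x \<le> 2 * (1 + norm (x + v))" using norm_ge_zero[of "x + v"] by argo
  then have "(1 + norm x) ^ (2 * DIM('e)) \<le> 2 ^ (2 * DIM('e)) * (1 + norm (x + v)) ^ (2 * DIM('e))"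
    using power_mono[of "1 + norm x" "2 * (1 + norm (x + v))" "2 * DIM('e)"] by (simp only: power_mult_distrib) simp
  moreover have "0 < (1 + norm x) ^ (2 * DIM('e))" "0 < (1 + norm (x + v)) ^ (2 * DIM('e))"
    by (simp_all add: add_pos_nonneg)
  ultimately show ?thesis unfolding schwartz_weight_def by (simp add: field_simps)
qed

text \<open>The integrals of the difference quotients \<open>(G (x + t v) - G x) / t\<close> vanish by translation invariance.  They
  converge to the integral of the directional derivative, because the weight at \<open>x + t v\<close> is comparable with the
  weight at \<open>x\<close>.  This is the form in which integration by parts is used.\<close>

lemma integral_directional_derivative:
  fixes G :: "'e::euclidean_space \<Rightarrow> 'b::{banach, second_countable_topology}"
  assumes der: "\<And>x. (G has_derivative G' x) (at x)"
    and G: "integrable lborel G"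
    and bd: "\<And>x. norm (G' x v) \<le> C * schwartz_weight x" and v: "norm v \<le> 1"
  shows "(\<integral>x. G' x v \<partial>lborel) = 0"
proof -
  define t where "t i = inverse (real (Suc i))" for i
  have t: "0 < t i" "t i \<le> 1" for i by (auto simp: t_def field_simps)
  have t0: "t \<longlonglongrightarrow> 0" unfolding t_def by (rule LIMSEQ_inverse_real_of_nat)
  define D where "D i x = (1 / t i) *\<^sub>R (G (x + t i *\<^sub>R v) - G x)" for i x
  have cont: "continuous_on UNIV G"
    using der has_derivative_continuous by (metis continuous_at_imp_continuous_on)
  then have [measurable]: "G \<in> borel_measurable borel" by (rule borel_measurable_continuous_onI)
  have line: "((\<lambda>s. G (x + s *\<^sub>R v)) has_derivative (\<lambda>h. h *\<^sub>R G' (x + s *\<^sub>R v) v)) (at s within A)" for x s A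
  proof -
    have "((\<lambda>s. x + s *\<^sub>R v) has_derivative (\<lambda>h. h *\<^sub>R v)) (at s within A)"
      by (auto intro!: derivative_eq_intros)
    from has_derivative_compose[OF this der[of "x + s *\<^sub>R v"]]
    have "((\<lambda>s. G (x + s *\<^sub>R v)) has_derivative (\<lambda>h. G' (x + s *\<^sub>R v) (h *\<^sub>R v))) (at s within A)" .
    moreover have "G' (x + s *\<^sub>R v) (h *\<^sub>R v) = h *\<^sub>R G' (x + s *\<^sub>R v) v" for h
      using linear_scale[OF bounded_linear.linear[OF has_derivative_bounded_linear[OF der]]] by auto
    ultimately show ?thesis by simp
  qed
  have D0: "(\<integral>x. D i x \<partial>lborel) = 0" for i
    unfolding D_def
    using G lborel_integrable_translate[OF G, of "t i *\<^sub>R v"] lborel_integral_translate[of G "t i *\<^sub>R v"]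
    by simp
  have lim: "(\<lambda>i. D i x) \<longlonglongrightarrow> G' x v" for x
  proof -
    have "((\<lambda>s. norm (G (x + s *\<^sub>R v) - G x - s *\<^sub>R G' x v) / norm s) \<longlongrightarrow> 0) (at 0)"
      using line[of x 0 UNIV] by (simp add: has_derivative_iff_norm)
    moreover have "\<forall>i. t i \<in> UNIV - {0}" using t(1) by (auto simp: less_le)
    ultimately have "(\<lambda>i. norm (G (x + t i *\<^sub>R v) - G x - t i *\<^sub>R G' x v) / norm (t i)) \<longlonglongrightarrow> 0"
      using t0 unfolding tendsto_at_iff_sequentially o_def by blast
    moreover have "norm (G (x + t i *\<^sub>R v) - G x - t i *\<^sub>R G' x v) / norm (t i) = norm (D i x - G' x v)" for i
    proof -
      have "D i x - G' x v = (1 / t i) *\<^sub>R (G (x + t i *\<^sub>R v) - G x - t i *\<^sub>R G' x v)"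
        using t(1)[of i] by (simp add: D_def scaleR_diff_right)
      then show ?thesis using t(1)[of i] by simp
    qed
    ultimately show ?thesis by (simp add: tendsto_norm_zero_iff LIM_zero_iff)
  qed
  have Dbd: "norm (D i x) \<le> C * 2 ^ (2 * DIM('e)) * schwartz_weight x" for i x
  proof -
    have C0: "0 \<le> C"
      using order_trans[OF norm_ge_zero bd[of 0]] schwartz_weight_pos[of "0::'e"] by (simp add: zero_le_mult_iff)
    have "norm (G (x + t i *\<^sub>R v) - G (x + 0 *\<^sub>R v)) \<le> C * 2 ^ (2 * DIM('e)) * schwartz_weight x * norm (t i - 0)"
    proof (rule differentiable_bound[of "{0..t i}" "\<lambda>s. G (x + s *\<^sub>R v)" "\<lambda>s h. h *\<^sub>R G' (x + s *\<^sub>R v) v"])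
      fix s assume s: "s \<in> {0..t i}"
      show "((\<lambda>s. G (x + s *\<^sub>R v)) has_derivative (\<lambda>h. h *\<^sub>R G' (x + s *\<^sub>R v) v)) (at s within {0..t i})"
        by (rule line)
      have "norm (s *\<^sub>R v) \<le> 1" using s v t(2)[of i] mult_mono[of "\<bar>s\<bar>" 1 "norm v" 1] by simp
      then have "C * schwartz_weight (x + s *\<^sub>R v) \<le> C * (2 ^ (2 * DIM('e)) * schwartz_weight x)"
        using C0 by (intro mult_left_mono schwartz_weight_shift) auto
      then have K: "norm (G' (x + s *\<^sub>R v) v) \<le> C * 2 ^ (2 * DIM('e)) * schwartz_weight x"
        using bd[of "x + s *\<^sub>R v"] by simp
      show "onorm (\<lambda>h. h *\<^sub>R G' (x + s *\<^sub>R v) v) \<le> C * 2 ^ (2 * DIM('e)) * schwartz_weight x"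
        using C0 mult_left_mono[OF K abs_ge_zero] by (intro onorm_bound) (auto simp: mult.commute less_imp_le)
    qed (use t(1)[of i] in auto)
    then show ?thesis using t(1)[of i] by (simp add: D_def divide_simps)
  qed
  have [measurable]: "D i \<in> borel_measurable borel" for i unfolding D_def by measurable
  have "(\<lambda>x. G' x v) \<in> borel_measurable borel"
    by (rule borel_measurable_LIMSEQ_metric[where f = D]) (use lim in auto)
  then have "(\<lambda>i. \<integral>x. D i x \<partial>lborel) \<longlonglongrightarrow> (\<integral>x. G' x v \<partial>lborel)"
    by (intro integral_dominated_convergence[where w = "\<lambda>x. C * 2 ^ (2 * DIM('e)) * schwartz_weight x"])
       (use integrable_schwartz_weight lim Dbd in auto)
  then show ?thesis using D0 by (simp add: LIMSEQ_const_iff)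
qed

lemma schwartz_decay:
  fixes f :: "'e::euclidean_space \<Rightarrow> 'b::real_normed_vector"
  assumes "f \<in> schwartz"
  obtains C where "C \<ge> 0" "\<And>x. norm x ^ k * norm (f x) \<le> C * schwartz_weight x"
proof -
  let ?m = "2 * DIM('e)"
  obtain A where A: "A \<ge> 0" "\<And>x. norm x ^ k * norm (f x) \<le> A" using schwartz_boundedE[OF assms, of k] by blast
  obtain B where B: "B \<ge> 0" "\<And>x. norm x ^ (?m + k) * norm (f x) \<le> B"
    using schwartz_boundedE[OF assms, of "?m + k"] by blast
  have "norm x ^ k * norm (f x) \<le> 2 ^ ?m * (A + B) * schwartz_weight x" for x
  proof -
    have "(1 + norm x) ^ ?m \<le> 2 ^ ?m * (1 + norm x ^ ?m)"
    proof (cases "norm x \<le> 1")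
      case True
      then have "(1 + norm x) ^ ?m \<le> 2 ^ ?m" by (intro power_mono) auto
      also have "\<dots> \<le> 2 ^ ?m * (1 + norm x ^ ?m)" by simp
      finally show ?thesis .
    next
      case False
      then have "(1 + norm x) ^ ?m \<le> (2 * norm x) ^ ?m" by (intro power_mono) auto
      also have "\<dots> \<le> 2 ^ ?m * (1 + norm x ^ ?m)" by (simp add: power_mult_distrib)
      finally show ?thesis .
    qed
    then have "(1 + norm x) ^ ?m * (norm x ^ k * norm (f x)) \<le> 2 ^ ?m * (1 + norm x ^ ?m) * (norm x ^ k * norm (f x))"
      by (intro mult_right_mono) auto
    also have "\<dots> = 2 ^ ?m * (norm x ^ k * norm (f x) + norm x ^ (?m + k) * norm (f x))"
      by (simp add: power_add algebra_simps)
    also have "\<dots> \<le> 2 ^ ?m * (A + B)" using A(2)[of x] B(2)[of x] by (intro mult_left_mono add_mono) auto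
    finally have "(1 + norm x) ^ ?m * (norm x ^ k * norm (f x)) \<le> 2 ^ ?m * (A + B)" .
    moreover have "0 < (1 + norm x) ^ ?m" by (simp add: add_pos_nonneg)
    ultimately show ?thesis unfolding schwartz_weight_def by (simp add: field_simps)
  qed
  then show ?thesis using that[of "2 ^ ?m * (A + B)"] A(1) B(1) by auto
qed

lemma integrable_schwartz_moment:
  fixes f :: "'e::euclidean_space \<Rightarrow> 'b::{banach, second_countable_topology}"
  assumes "f \<in> schwartz"
  shows "integrable lborel (\<lambda>x. norm x ^ k * norm (f x))"
proof -
  obtain C where C: "C \<ge> 0" "\<And>x. norm x ^ k * norm (f x) \<le> C * schwartz_weight x"
    using schwartz_decay[OF assms] by blast
  show ?thesis
  proof (rule Bochner_Integration.integrable_bound[of _ "\<lambda>x. C * schwartz_weight x"])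
    show "integrable lborel (\<lambda>x::'e. C * schwartz_weight x)"
      by (intro integrable_mult_right integrable_schwartz_weight)
    have "continuous_on UNIV (\<lambda>x. norm x ^ k * norm (f x))"
      by (intro continuous_intros schwartz_continuous assms)
    then show "(\<lambda>x. norm x ^ k * norm (f x)) \<in> borel_measurable lborel"
      by (simp add: borel_measurable_continuous_onI)
    show "AE x in lborel. norm (norm x ^ k * norm (f x)) \<le> norm (C * schwartz_weight x)"
      using C by (intro AE_I2) (simp add: abs_mult order_trans[OF C(2)] less_imp_le)
  qed
qed

lemma borel_measurable_schwartz:
  "f \<in> schwartz \<Longrightarrow> (f :: 'e::euclidean_space \<Rightarrow> 'b::{banach, second_countable_topology}) \<in> borel_measurable borel"
  by (intro borel_measurable_continuous_onI schwartz_continuous)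

lemma borel_measurable_CB_infinity:
  "f \<in> CB_infinity \<Longrightarrow> (f :: 'e::euclidean_space \<Rightarrow> 'b::{banach, second_countable_topology}) \<in> borel_measurable borel"
  by (intro borel_measurable_continuous_onI CB_infinity_continuous)

lemma integrable_schwartz:
  fixes f :: "'e::euclidean_space \<Rightarrow> 'b::{banach, second_countable_topology}"
  assumes "f \<in> schwartz"
  shows "integrable lborel f"
  using integrable_schwartz_moment[OF assms, of 0] borel_measurable_schwartz[OF assms]
  by (simp add: integrable_norm_iff)

section \<open>Oscillatory integrals with Schwartz densities\<close>

lemma has_derivative_eq_sum_partials:
  fixes f :: "'e::euclidean_space \<Rightarrow> 'b::real_normed_vector"
  assumes "(f has_derivative f') (at x)"
  shows "f' v = (\<Sum>b\<in>Basis. (v \<bullet> b) *\<^sub>R f' b)"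
proof -
  have "f' v = f' (\<Sum>b\<in>Basis. (v \<bullet> b) *\<^sub>R b)" by (simp add: euclidean_representation)
  then show ?thesis
    using bounded_linear.linear[OF has_derivative_bounded_linear[OF assms]]
    by (simp add: linear_sum linear_scale)
qed

lemma CB_infinityE:
  fixes f :: "'e::euclidean_space \<Rightarrow> 'b::real_normed_vector"
  assumes "f \<in> CB_infinity"
  obtains f' C where "\<And>x. (f has_derivative f' x) (at x)"
    "\<And>b. b \<in> Basis \<Longrightarrow> (\<lambda>x. f' x b) \<in> CB_infinity"
    "C \<ge> 0" "\<And>x v. norm (f' x v) \<le> C * norm v"
proof -
  obtain f' where f': "\<And>x. (f has_derivative f' x) (at x)"
    "\<And>b. b \<in> Basis \<Longrightarrow> (\<lambda>x. f' x b) \<in> CB_infinity"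
    by (rule partials_inE[OF partials_in_CB_infinity[OF assms]]) blast
  have "\<forall>b\<in>Basis. \<exists>B\<ge>0. \<forall>x. norm (f' x b) \<le> B"
    using CB_infinity_boundedE[OF f'(2)] by blast
  then obtain B where B: "\<And>b. b \<in> Basis \<Longrightarrow> B b \<ge> 0" "\<And>b x. b \<in> Basis \<Longrightarrow> norm (f' x b) \<le> B b"
    by metis
  have "norm (f' x v) \<le> (\<Sum>b\<in>Basis. B b) * norm v" for x v
  proof -
    have "f' x v = (\<Sum>b\<in>Basis. (v \<bullet> b) *\<^sub>R f' x b)"
      by (rule has_derivative_eq_sum_partials[OF f'(1)])
    also have "norm \<dots> \<le> (\<Sum>b\<in>Basis. B b * norm v)"
    proof (rule sum_norm_le)
      fix b :: 'e assume b: "b \<in> Basis"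
      show "norm ((v \<bullet> b) *\<^sub>R f' x b) \<le> B b * norm v"
        using mult_mono[OF Basis_le_norm[OF b, of v] B(2)[OF b, of x]] by (simp add: mult.commute)
    qed
    finally show ?thesis by (simp add: sum_distrib_right)
  qed
  then show ?thesis using that[of f' "\<Sum>b\<in>Basis. B b"] f' B(1) by (simp add: sum_nonneg)
qed

lemma CB_infinity_continuous_derivative:
  fixes f :: "'e::euclidean_space \<Rightarrow> 'b::real_normed_vector"
  assumes f': "\<And>x. (f has_derivative f' x) (at x)" "\<And>b. b \<in> Basis \<Longrightarrow> (\<lambda>x. f' x b) \<in> CB_infinity"
  shows "continuous_on UNIV (\<lambda>x. f' x v)"
proof -
  have eq: "(\<lambda>x. f' x v) = (\<lambda>x. \<Sum>b\<in>Basis. (v \<bullet> b) *\<^sub>R f' x b)"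
    by (rule ext) (rule has_derivative_eq_sum_partials[OF f'(1)])
  show ?thesis
    by (subst eq) (intro continuous_on_sum continuous_on_scaleR continuous_on_const CB_infinity_continuous f'(2))
qed

text \<open>The bilinear map \<open>bil\<close> is a parameter because two instances are needed: the product of the algebra gives
  pseudodifferential operators, and scalar multiplication with the constant symbol \<open>1\<close> gives the Fourier
  transform, for which the algebra itself might have no unit.\<close>

definition osc_integral ::
    "('b \<Rightarrow> 'c \<Rightarrow> 'a::{complex_normed_vector, banach, second_countable_topology}) \<Rightarrow> real \<Rightarrow>
     ('e::euclidean_space \<times> 'e \<Rightarrow> 'b) \<Rightarrow> ('e \<Rightarrow> 'c) \<Rightarrow> 'e \<Rightarrow> 'a" where
  "osc_integral bil s a h x = (\<integral>\<xi>. cis (s * (x \<bullet> \<xi>)) *\<^sub>C bil (a (x, \<xi>)) (h \<xi>) \<partial>lborel)"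

context
  fixes bil :: "'b::{banach, second_countable_topology} \<Rightarrow> 'c::{banach, second_countable_topology} \<Rightarrow>
    'a::{complex_normed_vector, banach, second_countable_topology}"
  assumes bil: "bounded_bilinear bil"
begin

lemma osc_integrand_bound:
  assumes a: "a \<in> CB_infinity"
  obtains C where "C \<ge> 0" "\<And>w y. norm (bil (a w) y) \<le> C * norm y"
proof -
  obtain B where B: "B \<ge> 0" "\<And>w. norm (a w) \<le> B" using CB_infinity_boundedE[OF a] by blast
  obtain K where K: "K \<ge> 0" "\<And>u v. norm (bil u v) \<le> norm u * norm v * K"
    using bounded_bilinear.nonneg_bounded[OF bil] by blast
  have "norm (bil (a w) y) \<le> B * K * norm y" for w y
    using K(2)[of "a w" y] mult_right_mono[OF B(2)[of w], of "norm y * K"] K(1) by (simp add: mult_ac)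
  then show ?thesis using that[of "B * K"] B(1) K(1) by simp
qed

lemma osc_integrand_continuous:
  assumes a: "a \<in> CB_infinity" and h: "continuous_on UNIV h"
  shows "continuous_on UNIV (\<lambda>\<xi>. cis (s * (x \<bullet> \<xi>)) *\<^sub>C bil (a (x, \<xi>)) (h \<xi>))"
  by (intro continuous_intros bounded_bilinear.continuous_on[OF bil] h
      continuous_on_compose2[OF CB_infinity_continuous[OF a, of UNIV]]) auto

lemma osc_integrable:
  assumes a: "a \<in> CB_infinity" and h: "h \<in> schwartz"
  shows "integrable lborel (\<lambda>\<xi>. cis (s * (x \<bullet> \<xi>)) *\<^sub>C bil (a (x, \<xi>)) (h \<xi>))"
proof -
  obtain C where C: "C \<ge> 0" "\<And>w y. norm (bil (a w) y) \<le> C * norm y"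
    using osc_integrand_bound[OF a] by blast
  show ?thesis
  proof (rule Bochner_Integration.integrable_bound[of _ "\<lambda>\<xi>. C * norm (h \<xi>)"])
    show "integrable lborel (\<lambda>\<xi>. C * norm (h \<xi>))" using integrable_schwartz[OF h] by simp
    show "(\<lambda>\<xi>. cis (s * (x \<bullet> \<xi>)) *\<^sub>C bil (a (x, \<xi>)) (h \<xi>)) \<in> borel_measurable lborel"
      using borel_measurable_continuous_onI[OF osc_integrand_continuous[OF a schwartz_continuous[OF h]]] by simp
    show "AE \<xi> in lborel. norm (cis (s * (x \<bullet> \<xi>)) *\<^sub>C bil (a (x, \<xi>)) (h \<xi>)) \<le> norm (C * norm (h \<xi>))"
      using C by (intro AE_I2) (simp add: norm_scaleC)
  qed
qed

lemma osc_integral_bounded: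
  assumes a: "a \<in> CB_infinity" and h: "h \<in> schwartz"
  shows "bounded (range (osc_integral bil s a h))"
proof -
  obtain C where C: "C \<ge> 0" "\<And>w y. norm (bil (a w) y) \<le> C * norm y"
    using osc_integrand_bound[OF a] by blast
  have "norm (osc_integral bil s a h x) \<le> (\<integral>\<xi>. C * norm (h \<xi>) \<partial>lborel)" for x
    unfolding osc_integral_def
    by (intro Bochner_Integration.integral_norm_bound_integral osc_integrable assms)
       (use integrable_schwartz[OF h] C in \<open>auto simp: norm_scaleC\<close>)
  then show ?thesis by (auto simp: bounded_iff)
qed

lemma osc_integral_has_derivative:
  assumes a: "a \<in> CB_infinity" and h: "h \<in> schwartz"
    and a': "\<And>w. (a has_derivative a' w) (at w)" "\<And>w u. norm (a' w u) \<le> C' * norm u"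
    and a'_CB: "\<And>b. b \<in> Basis \<Longrightarrow> (\<lambda>w. a' w b) \<in> CB_infinity"
  shows "(osc_integral bil s a h has_derivative
      (\<lambda>v. \<integral>\<xi>. (s * (v \<bullet> \<xi>)) *\<^sub>R (\<i> * cis (s * (x \<bullet> \<xi>))) *\<^sub>C bil (a (x, \<xi>)) (h \<xi>)
         + cis (s * (x \<bullet> \<xi>)) *\<^sub>C bil (a' (x, \<xi>) (v, 0)) (h \<xi>) \<partial>lborel)) (at x)"
proof -
  obtain C where C: "C \<ge> 0" "\<And>w y. norm (bil (a w) y) \<le> C * norm y"
    using osc_integrand_bound[OF a] by blast
  obtain K where K: "K \<ge> 0" "\<And>u v. norm (bil u v) \<le> norm u * norm v * K"
    using bounded_bilinear.nonneg_bounded[OF bil] by blast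
  let ?f' = "\<lambda>x v \<xi>. (s * (v \<bullet> \<xi>)) *\<^sub>R (\<i> * cis (s * (x \<bullet> \<xi>))) *\<^sub>C bil (a (x, \<xi>)) (h \<xi>)
         + cis (s * (x \<bullet> \<xi>)) *\<^sub>C bil (a' (x, \<xi>) (v, 0)) (h \<xi>)"
  have cont_a': "continuous_on UNIV (\<lambda>w. a' w u)" for u
    using a'(1) a'_CB by (rule CB_infinity_continuous_derivative)
  show ?thesis
    unfolding osc_integral_def[abs_def]
  proof (rule has_derivative_integral[where f' = ?f'
        and w = "\<lambda>\<xi>. \<bar>s\<bar> * C * (norm \<xi> * norm (h \<xi>)) + C' * K * norm (h \<xi>)"])
    show "integrable lborel (\<lambda>\<xi>. cis (s * (x \<bullet> \<xi>)) *\<^sub>C bil (a (x, \<xi>)) (h \<xi>))" for x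
      by (rule osc_integrable[OF a h])
    have "continuous_on UNIV (?f' x v)" for x v
      by (intro continuous_intros bounded_bilinear.continuous_on[OF bil] schwartz_continuous[OF h]
        continuous_on_compose2[OF CB_infinity_continuous[OF a, of UNIV]] continuous_on_compose2[OF cont_a']) auto
    then show "?f' x v \<in> borel_measurable lborel" for x v
      by (simp add: borel_measurable_continuous_onI)
    show "integrable lborel (\<lambda>\<xi>. \<bar>s\<bar> * C * (norm \<xi> * norm (h \<xi>)) + C' * K * norm (h \<xi>))"
      using integrable_schwartz_moment[OF h, of 1] integrable_schwartz[OF h] by simp
    show "norm (?f' x v \<xi>) \<le> (\<bar>s\<bar> * C * (norm \<xi> * norm (h \<xi>)) + C' * K * norm (h \<xi>)) * norm v" for x v \<xi>
    proof -
      have "norm ((s * (v \<bullet> \<xi>)) *\<^sub>R (\<i> * cis (s * (x \<bullet> \<xi>))) *\<^sub>C bil (a (x, \<xi>)) (h \<xi>))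
          \<le> (\<bar>s\<bar> * (norm v * norm \<xi>)) * (C * norm (h \<xi>))"
      proof -
        have "norm ((s * (v \<bullet> \<xi>)) *\<^sub>R (\<i> * cis (s * (x \<bullet> \<xi>))) *\<^sub>C bil (a (x, \<xi>)) (h \<xi>))
          = (\<bar>s\<bar> * \<bar>v \<bullet> \<xi>\<bar>) * norm (bil (a (x, \<xi>)) (h \<xi>))"
          by (simp add: norm_scaleC norm_mult abs_mult)
        also have "\<dots> \<le> (\<bar>s\<bar> * (norm v * norm \<xi>)) * (C * norm (h \<xi>))"
          using C by (intro mult_mono) (auto simp: Cauchy_Schwarz_ineq2)
        finally show ?thesis .
      qed
      moreover have "norm (cis (s * (x \<bullet> \<xi>)) *\<^sub>C bil (a' (x, \<xi>) (v, 0)) (h \<xi>)) \<le> (C' * norm v) * norm (h \<xi>) * K"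
        using order_trans[OF K(2) mult_right_mono[OF mult_right_mono[OF a'(2)[of "(x, \<xi>)" "(v, 0)"]]]] K(1)
        by (simp add: norm_scaleC norm_Pair)
      ultimately show ?thesis by (intro norm_triangle_le) (simp add: algebra_simps)
    qed
    show "((\<lambda>x. cis (s * (x \<bullet> \<xi>)) *\<^sub>C bil (a (x, \<xi>)) (h \<xi>)) has_derivative (\<lambda>v. ?f' x v \<xi>)) (at x)" for x \<xi>
    proof -
      have "((\<lambda>x. (x, \<xi>)) has_derivative (\<lambda>v. (v, 0))) (at x)"
        by (auto intro!: derivative_eq_intros)
      from has_derivative_compose[OF this a'(1)[of "(x, \<xi>)"]]
      have 1: "((\<lambda>x. a (x, \<xi>)) has_derivative (\<lambda>v. a' (x, \<xi>) (v, 0))) (at x)" .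
      have 2: "((\<lambda>x. bil (a (x, \<xi>)) (h \<xi>)) has_derivative (\<lambda>v. bil (a' (x, \<xi>) (v, 0)) (h \<xi>))) (at x)"
        by (rule bounded_linear.has_derivative[OF bounded_bilinear.bounded_linear_left[OF bil] 1])
      have 3: "((\<lambda>x. cis (s * (x \<bullet> \<xi>))) has_derivative (\<lambda>v. (s * (v \<bullet> \<xi>)) *\<^sub>R (\<i> * cis (s * (x \<bullet> \<xi>))))) (at x)"
        by (auto intro!: derivative_eq_intros)
      have scale: "(r *\<^sub>R c) *\<^sub>C y = r *\<^sub>R c *\<^sub>C (y :: 'a)" for r c y
        by (simp add: scaleR_scaleC scaleC_scaleC scaleR_conv_of_real)
      show ?thesis
        using bounded_bilinear.FDERIV[OF bounded_bilinear_scaleC 3 2] by (simp add: scale add.commute)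
    qed
  qed
qed

text \<open>The scalar \<open>c\<close> absorbs the factors \<open>is\<close> and \<open>i/s\<close> that arise from differentiating the exponential and from
  integrating by parts.\<close>

definition osc_functions :: "real \<Rightarrow> ('e::euclidean_space \<Rightarrow> 'a) set" where
  "osc_functions s = {\<lambda>x. c *\<^sub>C osc_integral bil s a h x | c a h. a \<in> CB_infinity \<and> h \<in> schwartz}"

lemma osc_functionsI:
  "a \<in> CB_infinity \<Longrightarrow> h \<in> schwartz \<Longrightarrow> (\<lambda>x. c *\<^sub>C osc_integral bil s a h x) \<in> fspan (osc_functions s)"
  by (rule fspan_base) (auto simp: osc_functions_def)

text \<open>The derivative along \<open>b\<close> falls either on the exponential, which turns \<open>h\<close> into \<open>is \<xi>\<^sub>b h\<close>, or on the first
  variable of the symbol.\<close>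

lemma osc_functions_partials:
  assumes "g \<in> osc_functions s"
  shows "partials_in (fspan (osc_functions s)) g"
proof -
  obtain c a h where g: "g = (\<lambda>x. c *\<^sub>C osc_integral bil s a h x)" and a: "a \<in> CB_infinity" and h: "h \<in> schwartz"
    using assms unfolding osc_functions_def by blast
  obtain a' C' where a': "\<And>w. (a has_derivative a' w) (at w)" "\<And>b. b \<in> Basis \<Longrightarrow> (\<lambda>w. a' w b) \<in> CB_infinity"
    "\<And>w u. norm (a' w u) \<le> C' * norm u"
    using CB_infinityE[OF a] by metis
  show ?thesis
    unfolding g
  proof (rule partials_inI[OF bounded_linear.has_derivative[OF bounded_linear_scaleC_right
        osc_integral_has_derivative[OF a h a'(1,3,2)]]], assumption)
    fix b :: 'd assume b: "b \<in> Basis"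
    have bb: "(b, 0) \<in> Basis" using b by (simp add: Basis_prod_def)
    have hb: "(\<lambda>\<xi>. (b \<bullet> \<xi>) *\<^sub>R h \<xi>) \<in> schwartz" by (rule schwartz_coordinate[OF h b])
    have "c *\<^sub>C (\<integral>\<xi>. (s * (b \<bullet> \<xi>)) *\<^sub>R (\<i> * cis (s * (x \<bullet> \<xi>))) *\<^sub>C bil (a (x, \<xi>)) (h \<xi>)
         + cis (s * (x \<bullet> \<xi>)) *\<^sub>C bil (a' (x, \<xi>) (b, 0)) (h \<xi>) \<partial>lborel)
       = (c * (\<i> * of_real s)) *\<^sub>C osc_integral bil s a (\<lambda>\<xi>. (b \<bullet> \<xi>) *\<^sub>R h \<xi>) x
         + c *\<^sub>C osc_integral bil s (\<lambda>w. a' w (b, 0)) h x" (is "c *\<^sub>C ?I = _") for x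
    proof -
      have "?I = (\<integral>\<xi>. (\<i> * of_real s) *\<^sub>C (cis (s * (x \<bullet> \<xi>)) *\<^sub>C bil (a (x, \<xi>)) ((b \<bullet> \<xi>) *\<^sub>R h \<xi>))
         + cis (s * (x \<bullet> \<xi>)) *\<^sub>C bil (a' (x, \<xi>) (b, 0)) (h \<xi>) \<partial>lborel)"
        by (simp add: bounded_bilinear.scaleR_right[OF bil] scaleR_scaleC scaleC_scaleC mult_ac)
      also have "\<dots> = (\<i> * of_real s) *\<^sub>C osc_integral bil s a (\<lambda>\<xi>. (b \<bullet> \<xi>) *\<^sub>R h \<xi>) x
         + osc_integral bil s (\<lambda>w. a' w (b, 0)) h x"
        unfolding osc_integral_def
        by (subst Bochner_Integration.integral_add)
           (auto intro!: osc_integrable a a'(2) h hb bb integral_bounded_linear[OF bounded_linear_scaleC_right]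
              integrable_bounded_linear[OF bounded_linear_scaleC_right])
      finally show ?thesis by (simp add: scaleC_add_right scaleC_scaleC)
    qed
    then show "(\<lambda>x. c *\<^sub>C (\<integral>\<xi>. (s * (b \<bullet> \<xi>)) *\<^sub>R (\<i> * cis (s * (x \<bullet> \<xi>))) *\<^sub>C bil (a (x, \<xi>)) (h \<xi>)
         + cis (s * (x \<bullet> \<xi>)) *\<^sub>C bil (a' (x, \<xi>) (b, 0)) (h \<xi>) \<partial>lborel)) \<in> fspan (osc_functions s)"
      using fspan_add[OF osc_functionsI[OF a hb] osc_functionsI[OF a'(2)[OF bb] h]] by (simp only:)
  qed
qed

text \<open>The factor \<open>is x\<^sub>b\<close> is produced by the derivative of the exponential in the direction \<open>b\<close> of the integration
  variable; it is moved to the symbol and to the density.\<close>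

lemma osc_integral_by_parts:
  assumes a: "a \<in> CB_infinity" and h: "h \<in> schwartz" and b: "b \<in> Basis"
    and a': "\<And>w. (a has_derivative a' w) (at w)" "\<And>b. b \<in> Basis \<Longrightarrow> (\<lambda>w. a' w b) \<in> CB_infinity"
    and h': "\<And>\<xi>. (h has_derivative h' \<xi>) (at \<xi>)" "\<And>b. b \<in> Basis \<Longrightarrow> (\<lambda>\<xi>. h' \<xi> b) \<in> schwartz"
  shows "(\<i> * of_real (s * (x \<bullet> b))) *\<^sub>C osc_integral bil s a h x =
    - (osc_integral bil s (\<lambda>w. a' w (0, b)) h x + osc_integral bil s a (\<lambda>\<xi>. h' \<xi> b) x)"
proof -
  have bb: "(0, b) \<in> Basis" using b by (simp add: Basis_prod_def)
  let ?G = "\<lambda>\<xi>. cis (s * (x \<bullet> \<xi>)) *\<^sub>C bil (a (x, \<xi>)) (h \<xi>)"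
  let ?G' = "\<lambda>\<xi> v. (\<i> * of_real (s * (x \<bullet> v))) *\<^sub>C ?G \<xi> + (cis (s * (x \<bullet> \<xi>)) *\<^sub>C bil (a' (x, \<xi>) (0, v)) (h \<xi>)
     + cis (s * (x \<bullet> \<xi>)) *\<^sub>C bil (a (x, \<xi>)) (h' \<xi> v))"
  have der: "(?G has_derivative ?G' \<xi>) (at \<xi>)" for \<xi>
  proof -
    have "((\<lambda>\<xi>. (x, \<xi>)) has_derivative (\<lambda>v. (0, v))) (at \<xi>)"
      by (auto intro!: derivative_eq_intros)
    from has_derivative_compose[OF this a'(1)[of "(x, \<xi>)"]]
    have 1: "((\<lambda>\<xi>. a (x, \<xi>)) has_derivative (\<lambda>v. a' (x, \<xi>) (0, v))) (at \<xi>)" .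
    have 3: "((\<lambda>\<xi>. cis (s * (x \<bullet> \<xi>))) has_derivative (\<lambda>v. (s * (x \<bullet> v)) *\<^sub>R (\<i> * cis (s * (x \<bullet> \<xi>))))) (at \<xi>)"
      by (auto intro!: derivative_eq_intros)
    show ?thesis
      by (rule has_derivative_eq_rhs[OF bounded_bilinear.FDERIV[OF bounded_bilinear_scaleC 3 bounded_bilinear.FDERIV[OF bil 1 h'(1)]]])
         (auto simp: scaleC_add_right scaleC_scaleC scaleR_conv_of_real mult_ac)
  qed
  obtain C1 where C1: "C1 \<ge> 0" "\<And>w y. norm (bil (a w) y) \<le> C1 * norm y"
    using osc_integrand_bound[OF a] by blast
  obtain C2 where C2: "C2 \<ge> 0" "\<And>w y. norm (bil (a' w (0, b)) y) \<le> C2 * norm y"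
    using osc_integrand_bound[OF a'(2)[OF bb]] by blast
  obtain D1 where D1: "D1 \<ge> 0" "\<And>\<xi>. norm (h \<xi>) \<le> D1 * schwartz_weight \<xi>"
    using schwartz_decay[OF h, of 0] by auto
  obtain D2 where D2: "D2 \<ge> 0" "\<And>\<xi>. norm (h' \<xi> b) \<le> D2 * schwartz_weight \<xi>"
    using schwartz_decay[OF h'(2)[OF b], of 0] by auto
  have bd: "norm (?G' \<xi> b) \<le> (\<bar>s * (x \<bullet> b)\<bar> * (C1 * D1) + (C2 * D1 + C1 * D2)) * schwartz_weight \<xi>" for \<xi>
  proof -
    have "norm (bil (a (x, \<xi>)) (h \<xi>)) \<le> C1 * (D1 * schwartz_weight \<xi>)"
      by (rule order_trans[OF C1(2) mult_left_mono[OF D1(2) C1(1)]])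
    then have m1: "norm ((\<i> * of_real (s * (x \<bullet> b))) *\<^sub>C ?G \<xi>) \<le> \<bar>s * (x \<bullet> b)\<bar> * (C1 * (D1 * schwartz_weight \<xi>))"
      unfolding norm_scaleC norm_mult norm_ii norm_of_real norm_cis by (simp add: mult_left_mono)
    have m2: "norm (cis (s * (x \<bullet> \<xi>)) *\<^sub>C bil (a' (x, \<xi>) (0, b)) (h \<xi>)) \<le> C2 * (D1 * schwartz_weight \<xi>)"
      using order_trans[OF C2(2) mult_left_mono[OF D1(2) C2(1)]] by (simp add: norm_scaleC)
    have m3: "norm (cis (s * (x \<bullet> \<xi>)) *\<^sub>C bil (a (x, \<xi>)) (h' \<xi> b)) \<le> C1 * (D2 * schwartz_weight \<xi>)"
      using order_trans[OF C1(2) mult_left_mono[OF D2(2) C1(1)]] by (simp add: norm_scaleC)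
    show ?thesis
      using norm_triangle_mono[OF m1 norm_triangle_mono[OF m2 m3]] by (simp add: algebra_simps)
  qed
  have i1: "integrable lborel ?G" by (rule osc_integrable[OF a h])
  have i2: "integrable lborel (\<lambda>\<xi>. cis (s * (x \<bullet> \<xi>)) *\<^sub>C bil (a' (x, \<xi>) (0, b)) (h \<xi>))"
    by (rule osc_integrable[OF a'(2)[OF bb] h])
  have i3: "integrable lborel (\<lambda>\<xi>. cis (s * (x \<bullet> \<xi>)) *\<^sub>C bil (a (x, \<xi>)) (h' \<xi> b))"
    by (rule osc_integrable[OF a h'(2)[OF b]])
  have "0 = (\<integral>\<xi>. ?G' \<xi> b \<partial>lborel)"
    using integral_directional_derivative[where G = ?G and G' = ?G', OF der i1 bd] b by simp
  also have "\<dots> = (\<integral>\<xi>. (\<i> * of_real (s * (x \<bullet> b))) *\<^sub>C ?G \<xi> \<partial>lborel)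
      + (osc_integral bil s (\<lambda>w. a' w (0, b)) h x + osc_integral bil s a (\<lambda>\<xi>. h' \<xi> b) x)"
    unfolding osc_integral_def using i1 i2 i3
    by (simp add: integrable_bounded_linear[OF bounded_linear_scaleC_right])
  also have "(\<integral>\<xi>. (\<i> * of_real (s * (x \<bullet> b))) *\<^sub>C ?G \<xi> \<partial>lborel) = (\<i> * of_real (s * (x \<bullet> b))) *\<^sub>C osc_integral bil s a h x"
    unfolding osc_integral_def by (rule integral_bounded_linear[OF bounded_linear_scaleC_right i1])
  finally show ?thesis unfolding eq_neg_iff_add_eq_0 by (rule sym)
qed

lemma osc_functions_coordinate:
  assumes "g \<in> osc_functions s" "b \<in> Basis" "s \<noteq> 0"
  shows "(\<lambda>x. (x \<bullet> b) *\<^sub>R g x) \<in> fspan (osc_functions s)"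
proof -
  obtain c a h where g: "g = (\<lambda>x. c *\<^sub>C osc_integral bil s a h x)" and a: "a \<in> CB_infinity" and h: "h \<in> schwartz"
    using assms unfolding osc_functions_def by blast
  have bb: "(0, b) \<in> Basis" using assms by (simp add: Basis_prod_def)
  obtain a' where a': "\<And>w. (a has_derivative a' w) (at w)" "\<And>b. b \<in> Basis \<Longrightarrow> (\<lambda>w. a' w b) \<in> CB_infinity"
    by (rule partials_inE[OF partials_in_CB_infinity[OF a]]) blast
  obtain h' where h': "\<And>w. (h has_derivative h' w) (at w)" "\<And>b. b \<in> Basis \<Longrightarrow> (\<lambda>w. h' w b) \<in> schwartz"
    by (rule partials_inE[OF partials_in_schwartz[OF h]]) blast
  have "(x \<bullet> b) *\<^sub>R g x = (c * (\<i> / of_real s)) *\<^sub>C osc_integral bil s (\<lambda>w. a' w (0, b)) h x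
      + (c * (\<i> / of_real s)) *\<^sub>C osc_integral bil s a (\<lambda>\<xi>. h' \<xi> b) x" for x
  proof -
    have "(x \<bullet> b) *\<^sub>R g x = (c * (- \<i> / of_real s)) *\<^sub>C ((\<i> * of_real (s * (x \<bullet> b))) *\<^sub>C osc_integral bil s a h x)"
      using assms(3) by (simp add: g scaleR_scaleC scaleC_scaleC mult_ac)
    also have "\<dots> = (c * (- \<i> / of_real s)) *\<^sub>C (- (osc_integral bil s (\<lambda>w. a' w (0, b)) h x + osc_integral bil s a (\<lambda>\<xi>. h' \<xi> b) x))"
      by (subst osc_integral_by_parts[OF a h assms(2) a' h']) auto
    also have "\<dots> = (c * (\<i> / of_real s)) *\<^sub>C (osc_integral bil s (\<lambda>w. a' w (0, b)) h x + osc_integral bil s a (\<lambda>\<xi>. h' \<xi> b) x)"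
    proof -
      have "c * (- \<i> / of_real s) = - (c * (\<i> / of_real s))" by simp
      then show ?thesis
        by (simp only: bounded_bilinear.minus_left[OF bounded_bilinear_scaleC]
            bounded_bilinear.minus_right[OF bounded_bilinear_scaleC] minus_minus)
    qed
    finally show ?thesis by (simp add: scaleC_add_right)
  qed
  then show ?thesis
    using fspan_add[OF osc_functionsI[OF a'(2)[OF bb] h] osc_functionsI[OF a h'(2)[OF assms(2)]]] by (simp only:)
qed

lemma osc_integral_schwartz:
  fixes a :: "'e::euclidean_space \<times> 'e \<Rightarrow> 'b"
  assumes "a \<in> CB_infinity" "h \<in> schwartz" "s \<noteq> 0"
  shows "osc_integral bil s a h \<in> schwartz"
proof (rule fspan_schwartz_coordinates[OF osc_functions_partials])
  show "osc_integral bil s a h \<in> fspan (osc_functions s)"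
    using osc_functionsI[OF assms(1,2), of 1 s] by simp
  show "bounded (range g)" if g_in: "g \<in> osc_functions s" for g :: "'e \<Rightarrow> 'a"
  proof -
    obtain c a h where g: "g = (\<lambda>x. c *\<^sub>C osc_integral bil s a h x)" and ah: "a \<in> CB_infinity" "h \<in> schwartz"
      using g_in unfolding osc_functions_def by blast
    show ?thesis
      using bounded_linear_image[OF osc_integral_bounded[OF ah, of s] bounded_linear_scaleC_right[of c]]
      by (simp add: g image_image)
  qed
  show "(\<lambda>x. (x \<bullet> b) *\<^sub>R g x) \<in> fspan (osc_functions s)" if "g \<in> osc_functions s" "b \<in> Basis" for g :: "'e \<Rightarrow> 'a" and b
    using osc_functions_coordinate that assms(3) by blast
qed

end

lemma fourier_eq_osc_integral:
  "fourier \<phi> = (\<lambda>\<xi>. (2 * pi) powr (- real CARD('n) / 2) *\<^sub>R osc_integral (*\<^sub>R) (-1) (\<lambda>_. 1) \<phi> (\<xi> :: real^'n))"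
  by (rule ext) (simp add: fourier_def osc_integral_def)

lemma fourier_schwartz:
  assumes "\<phi> \<in> schwartz" shows "fourier \<phi> \<in> schwartz"
  unfolding fourier_eq_osc_integral
  by (intro schwartz_bounded_linear[OF bounded_linear_scaleR_right] osc_integral_schwartz bounded_bilinear_scaleR CB_infinity_const assms) simp

lemma pdo_eq_osc_integral:
  "pdo a \<phi> = (\<lambda>x. (2 * pi) powr (- real CARD('n) / 2) *\<^sub>R osc_integral (*) 1 a (fourier \<phi>) (x :: real^'n))"
  by (rule ext) (simp add: pdo_def osc_integral_def)

lemma pdo_schwartz:
  assumes "a \<in> CB_infinity" "\<phi> \<in> schwartz" shows "pdo a \<phi> \<in> schwartz"
  unfolding pdo_eq_osc_integral
  by (intro schwartz_bounded_linear[OF bounded_linear_scaleR_right] osc_integral_schwartz bounded_bilinear_mult fourier_schwartz assms) simp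

section \<open>Schwartz functions in the completion\<close>

text \<open>The module norm is dominated by the norm of \<open>L\<^sup>2\<close>: the norm of \<open>\<integral> d\<^sup>* d\<close> is at most \<open>\<integral> \<parallel>d\<parallel>\<^sup>2\<close>.\<close>

lemma (in schwartz_completion) norm_emb_diff_le:
  assumes f: "f \<in> schwartz" and g: "g \<in> schwartz"
  shows "ennreal ((norm (emb f - emb g))\<^sup>2) \<le> (\<integral>\<^sup>+x. ennreal ((norm (f x - g x))\<^sup>2) \<partial>lborel)"
proof -
  define d where "d = (\<lambda>x. f x + (-1) *\<^sub>C g x)"
  have neg: "(-1) *\<^sub>C y = - y" for y :: "'z::complex_normed_vector"
    using scaleR_scaleC[of "-1" y] by simp
  have g': "(\<lambda>x. (-1) *\<^sub>C g x) \<in> schwartz"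
    by (rule schwartz_bounded_linear[OF bounded_linear_scaleC_right g])
  have d: "d \<in> schwartz" unfolding d_def by (rule schwartz_add[OF f g'])
  have "emb d = emb f - emb g"
    unfolding d_def emb_add[OF f g'] emb_scaleC[OF g] by (simp add: neg)
  then have "(norm (emb f - emb g))\<^sup>2 = norm (schwartz_ip d d)"
    using norm_eq_sqrt_ip[of "emb d"] ip_emb[OF d d] by simp
  also have "ennreal \<dots> \<le> (\<integral>\<^sup>+x. ennreal (norm (cstar (d x) * d x)) \<partial>lborel)"
    unfolding schwartz_ip_def
    by (cases "integrable lborel (\<lambda>x. cstar (d x) * d x)")
       (auto intro: integral_norm_bound_ennreal simp: not_integrable_integral_eq)
  finally show ?thesis by (simp add: cstar_identity d_def neg)
qed

text \<open>For a Schwartz function the constant sequence is an admissible approximation, and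
  \<open>norm_emb_diff_le\<close> forces every other one to have the same limit.\<close>

lemma (in schwartz_completion) L2_embed_schwartz:
  assumes f: "f \<in> schwartz"
  shows "L2_embed emb f = emb f"
  unfolding L2_embed_def
proof (rule the_equality)
  show "\<exists>F. (\<forall>k. F k \<in> schwartz) \<and> (\<lambda>k. \<integral>\<^sup>+x. ennreal ((norm (F k x - f x))\<^sup>2) \<partial>lborel) \<longlonglongrightarrow> 0 \<and>
      (\<lambda>k. emb (F k)) \<longlonglongrightarrow> emb f"
    using f by (intro exI[of _ "\<lambda>_. f"]) simp
next
  fix u
  assume "\<exists>F. (\<forall>k. F k \<in> schwartz) \<and> (\<lambda>k. \<integral>\<^sup>+x. ennreal ((norm (F k x - f x))\<^sup>2) \<partial>lborel) \<longlonglongrightarrow> 0 \<and>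
      (\<lambda>k. emb (F k)) \<longlonglongrightarrow> u"
  then obtain F where F: "\<And>k. F k \<in> schwartz" "(\<lambda>k. \<integral>\<^sup>+x. ennreal ((norm (F k x - f x))\<^sup>2) \<partial>lborel) \<longlonglongrightarrow> 0"
    and u: "(\<lambda>k. emb (F k)) \<longlonglongrightarrow> u" by blast
  have "(\<lambda>k. ennreal ((norm (emb (F k) - emb f))\<^sup>2)) \<longlonglongrightarrow> 0"
    by (rule tendsto_sandwich[OF _ _ tendsto_const F(2)])
       (use norm_emb_diff_le[OF F(1) f] in \<open>auto intro!: always_eventually\<close>)
  then have "(\<lambda>k. (norm (emb (F k) - emb f))\<^sup>2) \<longlonglongrightarrow> 0"
    by (subst (asm) tendsto_ennreal_iff[of _ _ 0, simplified]) auto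
  then have "(\<lambda>k. sqrt ((norm (emb (F k) - emb f))\<^sup>2)) \<longlonglongrightarrow> sqrt 0" by (rule tendsto_real_sqrt)
  then have "(\<lambda>k. emb (F k)) \<longlonglongrightarrow> emb f" by (simp add: tendsto_norm_zero_iff LIM_zero_iff)
  then show "u = emb f" using u LIMSEQ_unique by blast
qed

section \<open>The gamma kernel and its adjoint symbol in one dimension\<close>

lemma integrable_power_exp:
  "integrable lborel (\<lambda>s::real. indicator {0..} s * (s ^ k * exp (- s)))"
proof (rule integrableI_nonneg)
  show "AE s in lborel. 0 \<le> indicator {0..} s * (s ^ k * exp (- s) :: real)"
    by (intro AE_I2) (simp add: indicator_def)
  have "(\<integral>\<^sup>+s. ennreal (indicator {0..} s * (s ^ k * exp (- s))) \<partial>lborel)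
      = (\<integral>\<^sup>+s. ennreal (s ^ k * exp (- s)) * indicator {0..} s \<partial>lborel)"
    by (intro nn_integral_cong) (simp add: indicator_def)
  also have "\<dots> < \<infinity>" unfolding nn_intergal_power_times_exp_Ici by simp
  finally show "(\<integral>\<^sup>+s. ennreal (indicator {0..} s * (s ^ k * exp (- s))) \<partial>lborel) < \<infinity>" .
qed simp

lemma integrable_exp_weight:
  "integrable lborel (\<lambda>s::real. indicator {0..} s * ((1 + s) * exp (- s)))"
  using Bochner_Integration.integrable_add[OF integrable_power_exp[of 0] integrable_power_exp[of 1]]
  by (simp add: algebra_simps)

text \<open>The fundamental theorem of calculus on a half-line, for functions with values in a Banach space.  The integral
  of the difference quotient of width \<open>h\<close> is minus the mean of \<open>G\<close> over \<open>[0, h]\<close>.  The majorant is decreasing,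
  so it also controls the difference quotients.\<close>

lemma integral_halfline_derivative:
  fixes G :: "real \<Rightarrow> 'b::{banach, second_countable_topology}"
  assumes der: "\<And>t. (G has_vector_derivative G' t) (at t)"
    and bdG: "\<And>t. t \<ge> 0 \<Longrightarrow> norm (G t) \<le> C * ((1 + t) * exp (- t))"
    and bd: "\<And>t. t \<ge> 0 \<Longrightarrow> norm (G' t) \<le> C * ((1 + t) * exp (- t))"
  shows "integrable lborel (\<lambda>t. indicator {0..} t *\<^sub>R G' t)"
    and "(\<integral>t. indicator {0..} t *\<^sub>R G' t \<partial>lborel) = - G 0"
proof -
  have C0: "C \<ge> 0" using order_trans[OF norm_ge_zero bdG[of 0]] by simp
  have antimono: "(1 + (t + s)) * exp (- (t + s)) \<le> (1 + t) * exp (- t)" if "t \<ge> 0" "s \<ge> 0" for t s :: real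
  proof -
    have "1 + (t + s) \<le> (1 + t) * (1 + s)" using that by (simp add: algebra_simps)
    also have "\<dots> \<le> (1 + t) * exp s" using that by (intro mult_left_mono exp_ge_add_one_self) auto
    finally have "(1 + (t + s)) * exp (- (t + s)) \<le> (1 + t) * exp s * exp (- (t + s))"
      by (rule mult_right_mono) simp
    also have "\<dots> = (1 + t) * exp (- t)" by (simp add: exp_add[symmetric] mult.assoc)
    finally show ?thesis .
  qed
  have cont: "continuous_on UNIV G"
    using der by (meson continuous_at_imp_continuous_on has_vector_derivative_continuous)
  then have Gm [measurable]: "G \<in> borel_measurable borel" by (rule borel_measurable_continuous_onI)
  define h where "h i = inverse (real (Suc i))" for i
  have h: "0 < h i" "h i \<le> 1" for i by (auto simp: h_def field_simps)
  have h0: "h \<longlonglongrightarrow> 0" unfolding h_def by (rule LIMSEQ_inverse_real_of_nat)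
  define D where "D i t = indicator {0..} t *\<^sub>R (1 / h i) *\<^sub>R (G (t + h i) - G t)" for i t
  have [measurable]: "D i \<in> borel_measurable borel" for i unfolding D_def by measurable
  have lim: "(\<lambda>i. D i t) \<longlonglongrightarrow> indicator {0..} t *\<^sub>R G' t" for t
  proof -
    have lim0: "((\<lambda>s. norm (G s - G t - (s - t) *\<^sub>R G' t) / norm (s - t)) \<longlongrightarrow> 0) (at t)"
      using der[of t] by (simp add: has_vector_derivative_def has_derivative_iff_norm)
    have ht: "(\<lambda>i. t + h i) \<longlonglongrightarrow> t" using tendsto_add[OF tendsto_const[of t] h0] by simp
    have "((\<lambda>s. norm (G s - G t - (s - t) *\<^sub>R G' t) / norm (s - t)) \<circ> (\<lambda>i. t + h i)) \<longlonglongrightarrow> 0"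
      by (rule tendsto_at_iff_sequentially[THEN iffD1, OF lim0, rule_format, OF _ ht])
         (use h(1) in \<open>auto simp: less_le\<close>)
    then have "(\<lambda>i. norm (G (t + h i) - G t - h i *\<^sub>R G' t) / norm (h i)) \<longlonglongrightarrow> 0"
      by (simp add: o_def)
    moreover have "norm (G (t + h i) - G t - h i *\<^sub>R G' t) / norm (h i)
        = norm ((1 / h i) *\<^sub>R (G (t + h i) - G t) - G' t)" for i
    proof -
      have "(1 / h i) *\<^sub>R (G (t + h i) - G t) - G' t = (1 / h i) *\<^sub>R (G (t + h i) - G t - h i *\<^sub>R G' t)"
        using h(1)[of i] by (simp add: scaleR_diff_right)
      then show ?thesis using h(1)[of i] by simp
    qed
    ultimately have "(\<lambda>i. (1 / h i) *\<^sub>R (G (t + h i) - G t)) \<longlonglongrightarrow> G' t"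
      by (simp add: tendsto_norm_zero_iff LIM_zero_iff)
    then show ?thesis unfolding D_def by (intro tendsto_intros)
  qed
  have Dbd: "norm (D i t) \<le> C * (indicator {0..} t * ((1 + t) * exp (- t)))" for i t
  proof (cases "t \<ge> 0")
    case t: True
    have "norm (G (t + h i) - G t) \<le> C * ((1 + t) * exp (- t)) * norm (t + h i - t)"
    proof (rule differentiable_bound[of "{t..t + h i}" G "\<lambda>s x. x *\<^sub>R G' s"])
      fix s assume s: "s \<in> {t..t + h i}"
      show "(G has_derivative (\<lambda>x. x *\<^sub>R G' s)) (at s within {t..t + h i})"
        using der[of s] has_derivative_at_withinI unfolding has_vector_derivative_def by blast
      have "norm (G' s) \<le> C * ((1 + s) * exp (- s))" using s t by (intro bd) auto
      also have "\<dots> \<le> C * ((1 + t) * exp (- t))"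
        using antimono[of t "s - t"] s t C0 by (intro mult_left_mono) auto
      finally have K: "norm (G' s) \<le> C * ((1 + t) * exp (- t))" .
      show "onorm (\<lambda>x. x *\<^sub>R G' s) \<le> C * ((1 + t) * exp (- t))"
        using C0 t mult_left_mono[OF K abs_ge_zero] by (intro onorm_bound) (auto simp: mult_ac)
    qed (use h(1)[of i] in auto)
    then show ?thesis using h(1)[of i] t by (simp add: D_def divide_simps mult_ac)
  qed (simp add: D_def)
  have wint: "integrable lborel (\<lambda>t. C * (indicator {0..} t * ((1 + t) * exp (- t))))"
    by (intro integrable_mult_right integrable_exp_weight)
  have [measurable]: "(\<lambda>t. indicator {0..} t *\<^sub>R G' t) \<in> borel_measurable borel"
    by (rule borel_measurable_LIMSEQ_metric[where f = D]) (use lim in auto)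
  have lim1: "(\<lambda>i. \<integral>t. D i t \<partial>lborel) \<longlonglongrightarrow> (\<integral>t. indicator {0..} t *\<^sub>R G' t \<partial>lborel)"
    by (rule integral_dominated_convergence[OF _ _ wint]) (use lim Dbd in auto)
  show "integrable lborel (\<lambda>t. indicator {0..} t *\<^sub>R G' t)"
    by (rule integrable_dominated_convergence[where s = D, OF _ _ wint]) (use lim Dbd in auto)
  have Gint: "integrable lborel (\<lambda>t. indicator {0..} t *\<^sub>R G t)"
    by (rule Bochner_Integration.integrable_bound[OF wint])
       (use bdG in \<open>auto simp: indicator_def intro!: AE_I2 order_trans[OF bdG]\<close>)
  have Gint': "integrable lborel (\<lambda>t. indicator {r..} t *\<^sub>R G t)" if "r \<ge> 0" for r
    by (rule Bochner_Integration.integrable_bound[OF Gint])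
       (use that in \<open>auto simp: indicator_def intro!: AE_I2\<close>)
  have Dint: "(\<integral>t. D i t \<partial>lborel) = - (\<integral>s. indicator {0..<1} s *\<^sub>R G (h i * s) \<partial>lborel)" for i
  proof -
    have "(\<lambda>t. indicator {h i..} (t + h i) *\<^sub>R G (t + h i)) = (\<lambda>t. indicator {0..} t *\<^sub>R G (t + h i))"
      by (auto simp: indicator_def)
    then have shift: "integrable lborel (\<lambda>t. indicator {0..} t *\<^sub>R G (t + h i))"
        "(\<integral>t. indicator {0..} t *\<^sub>R G (t + h i) \<partial>lborel) = (\<integral>t. indicator {h i..} t *\<^sub>R G t \<partial>lborel)"
      using lborel_integrable_translate[OF Gint'[of "h i"], of "h i"]
        lborel_integral_translate[of "\<lambda>t. indicator {h i..} t *\<^sub>R G t" "h i"] h(1)[of i] by auto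
    have "D i = (\<lambda>t. (1 / h i) *\<^sub>R (indicator {0..} t *\<^sub>R G (t + h i) - indicator {0..} t *\<^sub>R G t))"
      by (auto simp: D_def scaleR_diff_right mult.commute)
    then have "(\<integral>t. D i t \<partial>lborel) = (1 / h i) *\<^sub>R
        ((\<integral>t. indicator {h i..} t *\<^sub>R G t \<partial>lborel) - (\<integral>t. indicator {0..} t *\<^sub>R G t \<partial>lborel))"
      using shift Gint by simp
    also have "(\<integral>t. indicator {h i..} t *\<^sub>R G t \<partial>lborel) - (\<integral>t. indicator {0..} t *\<^sub>R G t \<partial>lborel)
        = (\<integral>t. indicator {h i..} t *\<^sub>R G t - indicator {0..} t *\<^sub>R G t \<partial>lborel)"
      using Gint Gint'[of "h i"] h(1)[of i] by simp
    also have "(\<lambda>t. indicator {h i..} t *\<^sub>R G t - indicator {0..} t *\<^sub>R G t) = (\<lambda>t. - (indicator {0..<h i} t *\<^sub>R G t))"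
      using h(1)[of i] by (auto simp: indicator_def)
    also have "(\<integral>t. - (indicator {0..<h i} t *\<^sub>R G t) \<partial>lborel) = - (\<integral>t. indicator {0..<h i} t *\<^sub>R G t \<partial>lborel)"
      by simp
    also have "(\<integral>t. indicator {0..<h i} t *\<^sub>R G t \<partial>lborel)
        = \<bar>h i\<bar> *\<^sub>R (\<integral>s. indicator {0..<h i} (0 + h i * s) *\<^sub>R G (0 + h i * s) \<partial>lborel)"
      using h(1)[of i] by (intro lborel_integral_real_affine) auto
    also have "(\<lambda>s. indicator {0..<h i} (0 + h i * s) *\<^sub>R G (0 + h i * s)) = (\<lambda>s. indicator {0..<1} s *\<^sub>R G (h i * s))"
      using h(1)[of i] by (auto simp: indicator_def zero_le_mult_iff)
    finally show ?thesis using h(1)[of i] by simp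
  qed
  have "(\<lambda>i. \<integral>s. indicator {0..<1} s *\<^sub>R G (h i * s) \<partial>lborel) \<longlonglongrightarrow> (\<integral>s. indicator {0..<1::real} s *\<^sub>R G 0 \<partial>lborel)"
  proof (rule integral_dominated_convergence[where w = "\<lambda>s. C * indicator {0..<1} s"])
    show "integrable lborel (\<lambda>s::real. C * indicator {0..<1} s)" by simp
    show "AE s in lborel. (\<lambda>i. indicator {0..<1} s *\<^sub>R G (h i * s)) \<longlonglongrightarrow> indicator {0..<1::real} s *\<^sub>R G 0"
    proof (intro AE_I2 tendsto_intros)
      fix s :: real
      have "(\<lambda>i. h i * s) \<longlonglongrightarrow> 0" using tendsto_mult_left_zero[OF h0] by simp
      moreover have "isCont G 0" using cont by (simp add: continuous_on_eq_continuous_at)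
      ultimately show "(\<lambda>i. G (h i * s)) \<longlonglongrightarrow> G 0" by (rule isCont_tendsto_compose[rotated])
    qed
    show "AE s in lborel. norm (indicator {0..<1} s *\<^sub>R G (h i * s)) \<le> C * indicator {0..<1} s" for i
    proof (rule AE_I2)
      fix s :: real
      have "norm (G (h i * s)) \<le> C" if s: "0 \<le> s" "s < 1"
      proof -
        have hs: "h i * s \<ge> 0" using s h(1)[of i] by simp
        have "norm (G (h i * s)) \<le> C * ((1 + h i * s) * exp (- (h i * s)))" by (rule bdG[OF hs])
        also have "\<dots> \<le> C * 1" using antimono[of 0 "h i * s"] hs C0 by (intro mult_left_mono) auto
        finally show ?thesis by simp
      qed
      then show "norm (indicator {0..<1} s *\<^sub>R G (h i * s)) \<le> C * indicator {0..<1} s"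
        by (simp add: indicator_def)
    qed
  qed auto
  then have "(\<lambda>i. \<integral>t. D i t \<partial>lborel) \<longlonglongrightarrow> - G 0"
    unfolding Dint by (intro tendsto_minus) simp
  then show "(\<integral>t. indicator {0..} t *\<^sub>R G' t \<partial>lborel) = - G 0"
    using lim1 LIMSEQ_unique by blast
qed

text \<open>The density of the gamma distribution with shape parameter \<open>2\<close>, which is the fundamental solution of
  \<open>(1 + d/dt)\<^sup>2\<close>.  The square makes \<open>gamma1\<close> continuous and its Fourier transform integrable.\<close>

definition gamma1 :: "real \<Rightarrow> real" where "gamma1 t = max 0 t * exp (- t)"

lemma gamma1_eq: "gamma1 t = indicator {0..} t * (t * exp (- t))"
  by (auto simp: gamma1_def indicator_def max_def)

lemma gamma1_nonneg [simp]: "0 \<le> gamma1 t" by (simp add: gamma1_def)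

lemma continuous_gamma1: "continuous_on A gamma1"
  unfolding gamma1_def[abs_def] by (intro continuous_intros)

lemma integrable_gamma1: "integrable lborel gamma1"
  using integrable_power_exp[of 1] by (simp add: gamma1_eq[abs_def])

definition gamma1_hat :: "real \<Rightarrow> complex" where "gamma1_hat x = inverse ((1 + \<i> * of_real x)\<^sup>2)"

lemma one_plus_ii_nonzero: "1 + \<i> * of_real x \<noteq> 0" "1 - \<i> * of_real x \<noteq> 0"
  by (auto simp: complex_eq_iff)

lemma norm_one_plus_ii: "(norm (1 + \<i> * of_real x))\<^sup>2 = 1 + x\<^sup>2" "(norm (1 - \<i> * of_real x))\<^sup>2 = 1 + x\<^sup>2"
  by (simp_all add: cmod_power2)

lemma norm_gamma1_hat: "norm (gamma1_hat x) = inverse (1 + x\<^sup>2)"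
  by (simp add: gamma1_hat_def norm_inverse norm_power norm_one_plus_ii)

lemma continuous_gamma1_hat: "continuous_on A gamma1_hat"
  unfolding gamma1_hat_def[abs_def] using one_plus_ii_nonzero by (intro continuous_intros) auto

text \<open>With \<open>A = 1 + ix\<close> the integrand \<open>t e\<^sup>-\<^sup>A\<^sup>t\<close> has the antiderivative \<open>- e\<^sup>-\<^sup>A\<^sup>t (At + 1) / A\<^sup>2\<close>.\<close>

lemma fourier_gamma1: "(\<integral>t. of_real (gamma1 t) * cis (- (x * t)) \<partial>lborel) = gamma1_hat x"
proof -
  define A where "A = 1 + \<i> * of_real x"
  have A: "A \<noteq> 0" unfolding A_def by (rule one_plus_ii_nonzero)
  define G where "G t = - exp (- A * of_real t) * (A * of_real t + 1) / A\<^sup>2" for t :: real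
  have nexp: "norm (exp (- A * of_real t)) = exp (- t)" for t :: real
    by (simp add: A_def norm_exp_eq_Re)
  have der: "(G has_vector_derivative (of_real t * exp (- A * of_real t))) (at t)" for t
  proof -
    have "((\<lambda>z. - exp (- A * z) * (A * z + 1) / A\<^sup>2) has_field_derivative (of_real t * exp (- A * of_real t))) (at (of_real t))"
      using A by (auto intro!: derivative_eq_intros simp: power2_eq_square field_simps)
    then show ?thesis unfolding G_def by (rule has_vector_derivative_real_field)
  qed
  have "(\<integral>t. indicator {0..} t *\<^sub>R (of_real t * exp (- A * of_real t)) \<partial>lborel) = - G 0"
  proof (rule integral_halfline_derivative(2)[OF der])
    fix t :: real assume t: "t \<ge> 0"
    let ?C = "max 1 ((norm A + 1) / norm (A\<^sup>2))"
    have "norm (A * of_real t + 1) \<le> (norm A + 1) * (1 + t)"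
      by (rule order_trans[OF norm_triangle_ineq]) (use t in \<open>simp add: norm_mult algebra_simps\<close>)
    then have "exp (- t) * norm (A * of_real t + 1) / norm (A\<^sup>2) \<le> exp (- t) * ((norm A + 1) * (1 + t)) / norm (A\<^sup>2)"
      by (intro divide_right_mono mult_left_mono) auto
    then have "norm (G t) \<le> (norm A + 1) / norm (A\<^sup>2) * ((1 + t) * exp (- t))"
      unfolding G_def norm_divide norm_mult norm_minus_cancel nexp by (simp add: mult_ac)
    also have "\<dots> \<le> ?C * ((1 + t) * exp (- t))" using t by (intro mult_right_mono) auto
    finally show "norm (G t) \<le> ?C * ((1 + t) * exp (- t))" .
    have "norm (of_real t * exp (- A * of_real t)) \<le> 1 * ((1 + t) * exp (- t))"
      unfolding norm_mult nexp norm_of_real using t by simp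
    also have "\<dots> \<le> ?C * ((1 + t) * exp (- t))" using t by (intro mult_right_mono) auto
    finally show "norm (of_real t * exp (- A * of_real t)) \<le> ?C * ((1 + t) * exp (- t))" .
  qed
  moreover have "indicator {0..} t *\<^sub>R (of_real t * exp (- A * of_real t)) = of_real (gamma1 t) * cis (- (x * t))" for t
  proof -
    have "- A * of_real t = of_real (- t) + \<i> * of_real (- (x * t))" by (simp add: A_def algebra_simps)
    then have "exp (- A * of_real t) = of_real (exp (- t)) * cis (- (x * t))"
      by (simp only: exp_add cis_conv_exp exp_of_real)
    then show ?thesis by (simp add: gamma1_eq indicator_def)
  qed
  ultimately show ?thesis by (simp add: G_def gamma1_hat_def A_def inverse_eq_divide)
qed

text \<open>Up to the factor \<open>1 / (2\<pi>)\<close>, this is the adjoint symbol of \<open>gamma1 x * gamma1 \<xi>\<close> in dimension one.\<close>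

definition adjoint_kernel1 :: "real \<Rightarrow> real \<Rightarrow> complex" where
  "adjoint_kernel1 v \<eta> = (\<integral>t. of_real (gamma1 (t + v)) * gamma1_hat t * cis (t * \<eta>) \<partial>lborel)"

text \<open>After the substitution \<open>s = t + v\<close> the integral becomes, up to a factor of modulus one,
  \<open>\<integral>\<^sub>0\<^sup>\<infinity> s k(s) e\<^sup>-\<^sup>A\<^sup>s ds\<close> with \<open>A = 1 - i\<eta>\<close> and \<open>k(s) = (1 + i(s - v))\<^bsup>-2\<^esup>\<close>.  Integration by parts, twice,
  yields the decay \<open>1 / \<bar>A\<bar>\<^sup>2 = 1 / (1 + \<eta>\<^sup>2)\<close>; the decay of \<open>k\<close> and its derivatives yields the
  factor \<open>1 / (1 + v\<^sup>2)\<close> by Peetre's inequality.\<close>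

lemma adjoint_kernel1_bound:
  obtains M where "\<And>v \<eta>. norm (adjoint_kernel1 v \<eta>) \<le> M * inverse (1 + v\<^sup>2) * inverse (1 + \<eta>\<^sup>2)"
proof -
  define N :: real where "N = (\<integral>s. indicator {0..} s * ((4 + 6 * s) * exp (- s) * (2 * (1 + s\<^sup>2))) \<partial>lborel)"
  have Nint: "integrable lborel (\<lambda>s::real. indicator {0..} s * ((4 + 6 * s) * exp (- s) * (2 * (1 + s\<^sup>2))))"
  proof -
    have "integrable lborel (\<lambda>s::real. 8 * (indicator {0..} s * (s ^ 0 * exp (- s))) + 12 * (indicator {0..} s * (s ^ 1 * exp (- s)))
       + 8 * (indicator {0..} s * (s ^ 2 * exp (- s))) + 12 * (indicator {0..} s * (s ^ 3 * exp (- s))))"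
      by (intro Bochner_Integration.integrable_add integrable_mult_right integrable_power_exp)
    then show ?thesis
      by (rule Bochner_Integration.integrable_cong[THEN iffD1, rotated 2])
         (auto simp: algebra_simps power2_eq_square power3_eq_cube)
  qed
  have "norm (adjoint_kernel1 v \<eta>) \<le> (1 + N) * inverse (1 + v\<^sup>2) * inverse (1 + \<eta>\<^sup>2)" for v \<eta>
  proof -
    define A where "A = 1 - \<i> * of_real \<eta>"
    have A: "A \<noteq> 0" unfolding A_def by (rule one_plus_ii_nonzero)
    have A2: "norm (A\<^sup>2) = 1 + \<eta>\<^sup>2" by (simp add: A_def norm_power norm_one_plus_ii)
    have nexp: "norm (exp (- A * of_real t)) = exp (- t)" for t :: real
      by (simp add: A_def norm_exp_eq_Re)
    define z where "z s = 1 + \<i> * (s - of_real v)" for s :: complex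
    have z_real: "z (of_real s) = 1 + \<i> * of_real (s - v)" for s by (simp add: z_def)
    have z0: "z (of_real s) \<noteq> 0" for s unfolding z_real by (rule one_plus_ii_nonzero)
    define w where "w s = norm (z (of_real s))" for s
    have w2: "(w s)\<^sup>2 = 1 + (s - v)\<^sup>2" for s unfolding w_def z_real by (rule norm_one_plus_ii)
    have w1: "1 \<le> w s" for s
    proof (rule power2_le_imp_le)
      show "1\<^sup>2 \<le> (w s)\<^sup>2" unfolding w2 by simp
    qed (simp add: w_def)
    \<comment> \<open>\<open>k1\<close> and \<open>k2\<close> are the first two derivatives of \<open>k\<close>.\<close>
    define k where "k s = inverse (z s ^ 2)" for s
    define k1 where "k1 s = - 2 * \<i> * inverse (z s ^ 3)" for s
    define k2 where "k2 s = - 6 * inverse (z s ^ 4)" for s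
    have dz: "(z has_field_derivative \<i>) (at s)" for s
      unfolding z_def by (auto intro!: derivative_eq_intros)
    have dk: "(k has_field_derivative k1 (of_real s)) (at (of_real s))" for s :: real
      unfolding k_def k1_def using z0[of s]
      by (auto intro!: derivative_eq_intros dz simp: field_simps eval_nat_numeral)
    have dk1: "(k1 has_field_derivative k2 (of_real s)) (at (of_real s))" for s :: real
      unfolding k1_def k2_def using z0[of s]
      by (auto intro!: derivative_eq_intros dz simp: field_simps eval_nat_numeral)
    have nk: "norm (k (of_real s)) = inverse ((w s)\<^sup>2)" "norm (k1 (of_real s)) \<le> 2 * inverse ((w s)\<^sup>2)"
      "norm (k2 (of_real s)) \<le> 6 * inverse ((w s)\<^sup>2)" for s
      unfolding k_def k1_def k2_def norm_mult norm_inverse norm_power norm_minus_cancel norm_ii norm_numeral w_def[symmetric]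
      using w1[of s] by (auto intro!: le_imp_inverse_le power_increasing)
    have nk1: "norm (k (of_real s)) \<le> 1" "norm (k1 (of_real s)) \<le> 2" "norm (k2 (of_real s)) \<le> 6" for s
    proof -
      have "inverse ((w s)\<^sup>2) \<le> 1" using w1[of s] by (simp add: inverse_le_1_iff)
      then show "norm (k (of_real s)) \<le> 1" "norm (k1 (of_real s)) \<le> 2" "norm (k2 (of_real s)) \<le> 6"
        using nk[of s] by linarith+
    qed
    \<comment> \<open>\<open>R\<close> is \<open>(s k)'' e\<^sup>-\<^sup>A\<^sup>s\<close>, the integrand left after two integrations by parts.  The boundary terms are collected
      in \<open>G\<close>, an antiderivative of \<open>A\<^sup>2 s k e\<^sup>-\<^sup>A\<^sup>s - R\<close>.\<close>
    define R where "R s = (2 * k1 s + s * k2 s) * exp (- A * s)" for s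
    define G where "G s = - exp (- A * s) * (A * s * k s + k s + s * k1 s)" for s
    define G' where "G' s = A\<^sup>2 * (s * k s * exp (- A * s)) - R s" for s
    have der: "((\<lambda>t. G (of_real t)) has_vector_derivative G' (of_real s)) (at s)" for s :: real
    proof -
      have "(G has_field_derivative G' (of_real s)) (at (of_real s))"
        unfolding G_def G'_def R_def
        by (auto intro!: derivative_eq_intros dk dk1 simp: power2_eq_square algebra_simps)
      then show ?thesis by (rule has_vector_derivative_real_field)
    qed
    have Rbd: "norm (R (of_real s)) \<le> (4 + 6 * s) * exp (- s) * inverse ((w s)\<^sup>2)" if s: "s \<ge> 0" for s
    proof -
      have "norm (2 * k1 (of_real s) + of_real s * k2 (of_real s)) \<le> 2 * (2 * inverse ((w s)\<^sup>2)) + s * (6 * inverse ((w s)\<^sup>2))"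
        by (rule order_trans[OF norm_triangle_ineq])
           (use s nk(2,3)[of s] in \<open>auto simp: norm_mult intro!: add_mono mult_left_mono\<close>)
      then have "norm (R (of_real s)) \<le> (2 * (2 * inverse ((w s)\<^sup>2)) + s * (6 * inverse ((w s)\<^sup>2))) * exp (- s)"
        unfolding R_def norm_mult nexp by (rule mult_right_mono) simp
      then show ?thesis by (simp add: algebra_simps)
    qed
    define C where "C = (norm A)\<^sup>2 + norm A + 10"
    have bdG: "norm (G (of_real s)) \<le> C * ((1 + s) * exp (- s))" if s: "s \<ge> 0" for s
    proof -
      have "norm (A * of_real s * k (of_real s) + k (of_real s) + of_real s * k1 (of_real s)) \<le> (norm A * s * 1 + 1) + s * 2"
        using s nk1(1,2)[of s] mult_left_mono[OF nk1(1)[of s], of "norm A * s"] mult_left_mono[OF nk1(2)[of s], of s]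
        by (intro norm_triangle_mono) (auto simp: norm_mult)
      also have "\<dots> \<le> C * (1 + s)"
        using s by (simp add: C_def algebra_simps add_increasing)
      finally have "exp (- s) * norm (A * of_real s * k (of_real s) + k (of_real s) + of_real s * k1 (of_real s)) \<le> exp (- s) * (C * (1 + s))"
        by (rule mult_left_mono) simp
      then show ?thesis unfolding G_def norm_mult norm_minus_cancel nexp by (simp add: mult_ac)
    qed
    have bdG': "norm (G' (of_real s)) \<le> C * ((1 + s) * exp (- s))" if s: "s \<ge> 0" for s
    proof -
      have iw: "inverse ((w s)\<^sup>2) \<le> 1" using w1[of s] by (simp add: inverse_le_1_iff)
      have "norm (G' (of_real s)) \<le> (norm A)\<^sup>2 * (s * 1 * exp (- s)) + (4 + 6 * s) * exp (- s) * 1"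
        unfolding G'_def
      proof (rule order_trans[OF norm_triangle_ineq4], rule add_mono)
        show "norm (A\<^sup>2 * (of_real s * k (of_real s) * exp (- A * of_real s))) \<le> (norm A)\<^sup>2 * (s * 1 * exp (- s))"
          unfolding norm_mult norm_power nexp using s mult_left_mono[OF nk1(1)[of s] s]
          by (intro mult_left_mono mult_right_mono) auto
        show "norm (R (of_real s)) \<le> (4 + 6 * s) * exp (- s) * 1"
          by (rule order_trans[OF Rbd[OF s] mult_left_mono[OF iw]]) (use s in auto)
      qed
      also have "\<dots> = ((norm A)\<^sup>2 * s + 4 + 6 * s) * exp (- s)" by (simp add: algebra_simps)
      also have "\<dots> \<le> (C * (1 + s)) * exp (- s)"
        using s by (intro mult_right_mono) (auto simp: C_def algebra_simps intro!: add_increasing)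
      finally show ?thesis by (simp add: mult_ac)
    qed
    have iG: "integrable lborel (\<lambda>s. indicator {0..} s *\<^sub>R G' (of_real s))"
      and eG: "(\<integral>s. indicator {0..} s *\<^sub>R G' (of_real s) \<partial>lborel) = - G 0"
      using integral_halfline_derivative[OF der bdG bdG'] by simp_all
    have Peetre: "inverse ((w s)\<^sup>2) \<le> 2 * (1 + s\<^sup>2) * inverse (1 + v\<^sup>2)" for s
    proof -
      have "1 + v\<^sup>2 \<le> 2 * (1 + s\<^sup>2) * (1 + (s - v)\<^sup>2)"
      proof -
        have "0 \<le> (2 * s - v)\<^sup>2 + 1 + 2 * (s * (s - v))\<^sup>2" by simp
        then show ?thesis by (simp add: power2_eq_square algebra_simps)
      qed
      moreover have "0 < 1 + v\<^sup>2" "0 < 1 + (s - v)\<^sup>2" by (simp_all add: add_pos_nonneg)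
      ultimately show ?thesis unfolding w2 by (simp add: field_simps)
    qed
    have contz: "continuous_on UNIV (\<lambda>s. z (of_real s))" unfolding z_def by (intro continuous_intros)
    have contR: "continuous_on UNIV (\<lambda>s. R (of_real s))"
      unfolding R_def k1_def k2_def using z0 by (intro continuous_intros contz) auto
    have Rint_bd: "norm (indicator {0..} s *\<^sub>R R (of_real s)) \<le> indicator {0..} s * ((4 + 6 * s) * exp (- s) * (2 * (1 + s\<^sup>2))) * inverse (1 + v\<^sup>2)" for s
    proof (cases "s \<ge> 0")
      case True
      have "norm (R (of_real s)) \<le> (4 + 6 * s) * exp (- s) * (2 * (1 + s\<^sup>2) * inverse (1 + v\<^sup>2))"
        by (rule order_trans[OF Rbd[OF True] mult_left_mono[OF Peetre]]) (use True in auto)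
      then show ?thesis using True by (simp add: mult_ac)
    qed simp
    have iR: "integrable lborel (\<lambda>s. indicator {0..} s *\<^sub>R R (of_real s))"
    proof (rule Bochner_Integration.integrable_bound[OF integrable_mult_left[OF Nint, of "inverse (1 + v\<^sup>2)"]])
      show "(\<lambda>s. indicator {0..} s *\<^sub>R R (of_real s)) \<in> borel_measurable lborel"
        using borel_measurable_continuous_onI[OF contR] by measurable
    qed (intro AE_I2, unfold real_norm_def, rule order_trans[OF Rint_bd abs_ge_self])
    have "adjoint_kernel1 v \<eta> = (\<integral>s. of_real (gamma1 (s - v + v)) * gamma1_hat (s - v) * cis ((s - v) * \<eta>) \<partial>lborel)"
      unfolding adjoint_kernel1_def
      using lborel_integral_translate[of "\<lambda>t. of_real (gamma1 (t + v)) * gamma1_hat t * cis (t * \<eta>)" "- v"]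
        borel_measurable_continuous_onI[OF continuous_gamma1] borel_measurable_continuous_onI[OF continuous_gamma1_hat]
      by (simp add: cis_conv_exp)
    also have "(\<lambda>s. of_real (gamma1 (s - v + v)) * gamma1_hat (s - v) * cis ((s - v) * \<eta>))
      = (\<lambda>s. (cis (- (v * \<eta>)) / A\<^sup>2) * (indicator {0..} s *\<^sub>R G' (of_real s) + indicator {0..} s *\<^sub>R R (of_real s)))"
    proof
      fix s :: real
      have "- (A * of_real s) = of_real (- s) + \<i> * of_real (s * \<eta>)" by (simp add: A_def algebra_simps)
      then have e: "exp (- (A * of_real s)) = of_real (exp (- s)) * cis (s * \<eta>)"
        by (simp only: exp_add cis_conv_exp exp_of_real)
      have "gamma1_hat (s - v) = k (of_real s)" by (simp add: gamma1_hat_def k_def z_def)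
      moreover have "cis ((s - v) * \<eta>) = cis (- (v * \<eta>)) * cis (s * \<eta>)" by (simp add: cis_mult algebra_simps)
      ultimately show "of_real (gamma1 (s - v + v)) * gamma1_hat (s - v) * cis ((s - v) * \<eta>)
        = (cis (- (v * \<eta>)) / A\<^sup>2) * (indicator {0..} s *\<^sub>R G' (of_real s) + indicator {0..} s *\<^sub>R R (of_real s))"
        using A by (simp add: gamma1_eq G'_def e indicator_def)
    qed
    also have "(\<integral>s. (cis (- (v * \<eta>)) / A\<^sup>2) * (indicator {0..} s *\<^sub>R G' (of_real s) + indicator {0..} s *\<^sub>R R (of_real s)) \<partial>lborel)
      = (cis (- (v * \<eta>)) / A\<^sup>2) * (- G 0 + (\<integral>s. indicator {0..} s *\<^sub>R R (of_real s) \<partial>lborel))"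
      using iG iR eG by simp
    finally have "norm (adjoint_kernel1 v \<eta>) = inverse (1 + \<eta>\<^sup>2) * norm (- G 0 + (\<integral>s. indicator {0..} s *\<^sub>R R (of_real s) \<partial>lborel))"
      by (simp add: norm_mult norm_divide A2 inverse_eq_divide del: norm_power)
    moreover have "norm (- G 0 + (\<integral>s. indicator {0..} s *\<^sub>R R (of_real s) \<partial>lborel)) \<le> inverse (1 + v\<^sup>2) + N * inverse (1 + v\<^sup>2)"
    proof (rule norm_triangle_mono)
      have "- G 0 = k (of_real 0)" by (simp add: G_def)
      then have "norm (- G 0) = inverse ((w 0)\<^sup>2)" using nk(1)[of 0] by (simp only:)
      then show "norm (- G 0) \<le> inverse (1 + v\<^sup>2)" by (simp add: w2)
      have "norm (\<integral>s. indicator {0..} s *\<^sub>R R (of_real s) \<partial>lborel)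
        \<le> (\<integral>s. indicator {0..} s * ((4 + 6 * s) * exp (- s) * (2 * (1 + s\<^sup>2))) * inverse (1 + v\<^sup>2) \<partial>lborel)"
        by (intro Bochner_Integration.integral_norm_bound_integral iR integrable_mult_left Nint Rint_bd)
      then show "norm (\<integral>s. indicator {0..} s *\<^sub>R R (of_real s) \<partial>lborel) \<le> N * inverse (1 + v\<^sup>2)"
        by (simp add: N_def)
    qed
    ultimately have "norm (adjoint_kernel1 v \<eta>) \<le> inverse (1 + \<eta>\<^sup>2) * (inverse (1 + v\<^sup>2) + N * inverse (1 + v\<^sup>2))"
      by (simp add: mult_left_mono)
    then show ?thesis by (simp add: algebra_simps)
  qed
  then show ?thesis using that by blast
qed

section \<open>The gamma kernel and its adjoint symbol in several dimensions\<close>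

definition gamma_kernel :: "'e::euclidean_space \<Rightarrow> real" where "gamma_kernel x = (\<Prod>b\<in>Basis. gamma1 (x \<bullet> b))"

definition gamma_kernel_hat :: "'e::euclidean_space \<Rightarrow> complex" where "gamma_kernel_hat x = (\<Prod>b\<in>Basis. gamma1_hat (x \<bullet> b))"

text \<open>Up to the factor \<open>(2\<pi>)\<^sup>-\<^sup>n\<close>, this is the adjoint symbol of \<open>gamma_kernel x * gamma_kernel \<xi>\<close>, the value of
  \<open>gamma_kernel\<close> at \<open>(x, \<xi>)\<close>.\<close>

definition adjoint_kernel :: "'e::euclidean_space \<times> 'e \<Rightarrow> complex" where
  "adjoint_kernel w = (\<integral>t. of_real (gamma_kernel (t + fst w)) * gamma_kernel_hat t * cis (t \<bullet> snd w) \<partial>lborel)"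

lemma gamma_kernel_nonneg [simp]: "0 \<le> gamma_kernel x" by (simp add: gamma_kernel_def prod_nonneg)

lemma continuous_gamma_kernel: "continuous_on A gamma_kernel"
  unfolding gamma_kernel_def[abs_def]
  by (intro continuous_on_prod continuous_on_compose2[OF continuous_gamma1[of UNIV]] continuous_intros) auto

lemma continuous_gamma_kernel_hat: "continuous_on A gamma_kernel_hat"
  unfolding gamma_kernel_hat_def[abs_def]
  by (intro continuous_on_prod continuous_on_compose2[OF continuous_gamma1_hat[of UNIV]] continuous_intros) auto

lemma borel_measurable_gamma_kernel [measurable]: "gamma_kernel \<in> borel_measurable borel"
  by (rule borel_measurable_continuous_onI[OF continuous_gamma_kernel])

lemma borel_measurable_gamma_kernel_hat [measurable]: "gamma_kernel_hat \<in> borel_measurable borel"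
  by (rule borel_measurable_continuous_onI[OF continuous_gamma_kernel_hat])

lemma integrable_gamma_kernel: "integrable lborel gamma_kernel"
  unfolding gamma_kernel_def[abs_def] by (intro lborel_integrable_prod integrable_gamma1)

lemma norm_gamma1_hat_le: "norm (gamma1_hat x) \<le> 1"
  by (simp add: norm_gamma1_hat inverse_le_1_iff add_increasing2)

lemma norm_gamma_kernel_hat_le: "norm (gamma_kernel_hat x) \<le> 1"
  unfolding gamma_kernel_hat_def prod_norm[symmetric] by (intro prod_le_1) (auto intro: norm_gamma1_hat_le)

lemma continuous_on_gamma_kernel: "continuous_on A g \<Longrightarrow> continuous_on A (\<lambda>p. gamma_kernel (g p))"
  by (rule continuous_on_compose2[OF continuous_gamma_kernel[of UNIV]]) auto

lemma continuous_on_gamma_kernel_hat: "continuous_on A g \<Longrightarrow> continuous_on A (\<lambda>p. gamma_kernel_hat (g p))"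
  by (rule continuous_on_compose2[OF continuous_gamma_kernel_hat[of UNIV]]) auto

lemma gamma_kernel_le_1: "gamma_kernel x \<le> 1"
proof -
  have "gamma1 t \<le> 1" for t
  proof (cases "t \<ge> 0")
    case True
    have "t \<le> exp t" using exp_ge_add_one_self[of t] by linarith
    then have "t * exp (- t) \<le> exp t * exp (- t)" by (rule mult_right_mono) simp
    then show ?thesis using True by (simp add: gamma1_def exp_minus)
  qed (simp add: gamma1_def)
  then show ?thesis unfolding gamma_kernel_def by (intro prod_le_1) auto
qed

lemma cis_sum: "finite A \<Longrightarrow> cis (\<Sum>b\<in>A. f b) = (\<Prod>b\<in>A. cis (f b))"
  by (induction rule: finite_induct) (auto simp: cis_mult[symmetric])

lemma gamma_kernel_Pair: "gamma_kernel (x, y) = gamma_kernel x * gamma_kernel (y :: 'e::euclidean_space)"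
  for x :: "'f::euclidean_space"
proof -
  have "gamma_kernel (x, y) = (\<Prod>b\<in>(\<lambda>u. (u, 0)) ` Basis. gamma1 ((x, y) \<bullet> b)) * (\<Prod>b\<in>(\<lambda>v. (0, v)) ` Basis. gamma1 ((x, y) \<bullet> b))"
    unfolding gamma_kernel_def Basis_prod_def by (rule prod.union_disjoint) (auto dest: nonzero_Basis)
  also have "\<dots> = gamma_kernel x * gamma_kernel y"
    by (subst (1 2) prod.reindex) (auto simp: inj_on_def gamma_kernel_def)
  finally show ?thesis .
qed

lemma fourier_gamma_kernel: "(\<integral>\<xi>. of_real (gamma_kernel \<xi>) * cis (- (x \<bullet> \<xi>)) \<partial>lborel) = gamma_kernel_hat x"
proof -
  have "of_real (gamma_kernel \<xi>) * cis (- (x \<bullet> \<xi>)) = (\<Prod>b\<in>Basis. of_real (gamma1 (\<xi> \<bullet> b)) * cis (- ((x \<bullet> b) * (\<xi> \<bullet> b))))" for \<xi>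
    by (simp add: gamma_kernel_def prod.distrib cis_sum[symmetric] euclidean_inner[of x \<xi>] sum_negf)
  then have "(\<integral>\<xi>. of_real (gamma_kernel \<xi>) * cis (- (x \<bullet> \<xi>)) \<partial>lborel)
      = (\<integral>\<xi>. (\<Prod>b\<in>Basis. of_real (gamma1 (\<xi> \<bullet> b)) * cis (- ((x \<bullet> b) * (\<xi> \<bullet> b)))) \<partial>lborel)"
    by simp
  also have "\<dots> = (\<Prod>b\<in>Basis. \<integral>t. of_real (gamma1 t) * cis (- ((x \<bullet> b) * t)) \<partial>lborel)"
  proof (rule lborel_integral_prod)
    show "integrable lborel (\<lambda>t. of_real (gamma1 t) * cis (- ((x \<bullet> b) * t)))" for b
      by (rule Bochner_Integration.integrable_bound[OF integrable_gamma1])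
         (auto simp: norm_mult intro!: borel_measurable_continuous_onI continuous_intros continuous_gamma1)
  qed
  finally show ?thesis by (simp add: fourier_gamma1 gamma_kernel_hat_def)
qed

lemma adjoint_kernel_eq_prod: "adjoint_kernel (v, \<eta>) = (\<Prod>b\<in>Basis. adjoint_kernel1 (v \<bullet> b) (\<eta> \<bullet> b))"
proof -
  have "of_real (gamma_kernel (t + v)) * gamma_kernel_hat t * cis (t \<bullet> \<eta>)
      = (\<Prod>b\<in>Basis. of_real (gamma1 (t \<bullet> b + v \<bullet> b)) * gamma1_hat (t \<bullet> b) * cis ((t \<bullet> b) * (\<eta> \<bullet> b)))" for t
    by (simp add: gamma_kernel_def gamma_kernel_hat_def prod.distrib cis_sum[symmetric] euclidean_inner[of t \<eta>] inner_add_left)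
  then have "adjoint_kernel (v, \<eta>) = (\<integral>t. (\<Prod>b\<in>Basis. of_real (gamma1 (t \<bullet> b + v \<bullet> b)) * gamma1_hat (t \<bullet> b) * cis ((t \<bullet> b) * (\<eta> \<bullet> b))) \<partial>lborel)"
    by (simp add: adjoint_kernel_def)
  also have "\<dots> = (\<Prod>b\<in>Basis. \<integral>t. of_real (gamma1 (t + v \<bullet> b)) * gamma1_hat t * cis (t * (\<eta> \<bullet> b)) \<partial>lborel)"
  proof (rule lborel_integral_prod)
    show "integrable lborel (\<lambda>t. of_real (gamma1 (t + v \<bullet> b)) * gamma1_hat t * cis (t * (\<eta> \<bullet> b)))" for b
    proof (rule Bochner_Integration.integrable_bound[OF lborel_integrable_translate[OF integrable_gamma1, of "v \<bullet> b"]])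
      have "norm (of_real (gamma1 (t + v \<bullet> b)) * gamma1_hat t * cis (t * (\<eta> \<bullet> b))) \<le> norm (gamma1 (t + v \<bullet> b))" for t
        using mult_left_mono[OF norm_gamma1_hat_le, of "gamma1 (t + v \<bullet> b)" t] by (simp add: norm_mult)
      then show "AE t in lborel. norm (of_real (gamma1 (t + v \<bullet> b)) * gamma1_hat t * cis (t * (\<eta> \<bullet> b))) \<le> norm (gamma1 (t + v \<bullet> b))"
        by simp
      have "continuous_on UNIV (\<lambda>t. of_real (gamma1 (t + v \<bullet> b)) * gamma1_hat t * cis (t * (\<eta> \<bullet> b)))"
        by (intro continuous_intros continuous_gamma1_hat continuous_on_compose2[OF continuous_gamma1[of UNIV]]) auto
      then show "(\<lambda>t. of_real (gamma1 (t + v \<bullet> b)) * gamma1_hat t * cis (t * (\<eta> \<bullet> b))) \<in> borel_measurable lborel"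
        by (simp add: borel_measurable_continuous_onI)
    qed
  qed
  finally show ?thesis by (simp add: adjoint_kernel1_def)
qed

lemma borel_measurable_adjoint_kernel [measurable]: "adjoint_kernel \<in> borel_measurable borel"
proof -
  have sets: "sets (borel \<Otimes>\<^sub>M lborel :: (('a \<times> 'a) \<times> 'a) measure) = sets borel"
    unfolding borel_prod[symmetric] by (intro sets_pair_measure_cong) auto
  have "continuous_on UNIV (\<lambda>p :: ('a \<times> 'a) \<times> 'a. of_real (gamma_kernel (snd p + fst (fst p))) * gamma_kernel_hat (snd p) * cis (snd p \<bullet> snd (fst p)))"
    by (intro continuous_intros continuous_on_compose2[OF continuous_gamma_kernel[of UNIV]] continuous_on_compose2[OF continuous_gamma_kernel_hat[of UNIV]]) auto
  then have "(\<lambda>p :: ('a \<times> 'a) \<times> 'a. of_real (gamma_kernel (snd p + fst (fst p))) * gamma_kernel_hat (snd p) * cis (snd p \<bullet> snd (fst p)))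
      \<in> borel_measurable (borel \<Otimes>\<^sub>M lborel)"
    using sets by (subst measurable_cong_sets[OF sets refl]) (rule borel_measurable_continuous_onI)
  then have "(\<lambda>(w :: 'a \<times> 'a, t). of_real (gamma_kernel (t + fst w)) * gamma_kernel_hat t * cis (t \<bullet> snd w)) \<in> borel_measurable (borel \<Otimes>\<^sub>M lborel)"
    by (simp add: case_prod_unfold)
  then show ?thesis
    unfolding adjoint_kernel_def[abs_def] by (rule lborel.borel_measurable_lebesgue_integral)
qed

lemma norm_adjoint_kernel_le: "norm (adjoint_kernel (w :: 'e::euclidean_space \<times> 'e)) \<le> (\<integral>t. gamma_kernel t \<partial>(lborel :: 'e measure))"
proof -
  have g: "integrable lborel (\<lambda>t. gamma_kernel (t + fst w))" by (rule lborel_integrable_translate[OF integrable_gamma_kernel])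
  have le: "norm (of_real (gamma_kernel (t + fst w)) * gamma_kernel_hat t * cis (t \<bullet> snd w)) \<le> gamma_kernel (t + fst w)" for t
    using mult_left_mono[OF norm_gamma_kernel_hat_le, of "gamma_kernel (t + fst w)" t] by (simp add: norm_mult)
  have "norm (adjoint_kernel w) \<le> (\<integral>t. gamma_kernel (t + fst w) \<partial>lborel)"
    unfolding adjoint_kernel_def
  proof (rule Bochner_Integration.integral_norm_bound_integral[OF _ g le])
    have "continuous_on UNIV (\<lambda>t. of_real (gamma_kernel (t + fst w)) * gamma_kernel_hat t * cis (t \<bullet> snd w))"
      by (intro continuous_intros continuous_gamma_kernel_hat continuous_on_compose2[OF continuous_gamma_kernel[of UNIV]]) auto
    then show "integrable lborel (\<lambda>t. of_real (gamma_kernel (t + fst w)) * gamma_kernel_hat t * cis (t \<bullet> snd w))"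
      using le by (intro Bochner_Integration.integrable_bound[OF g] AE_I2) (auto simp: borel_measurable_continuous_onI)
  qed
  then show ?thesis by (simp add: lborel_integral_translate)
qed

lemma integrable_adjoint_kernel: "integrable lborel (adjoint_kernel :: 'e::euclidean_space \<times> 'e \<Rightarrow> complex)"
proof -
  obtain M where M: "\<And>v \<eta>. norm (adjoint_kernel1 v \<eta>) \<le> M * inverse (1 + v\<^sup>2) * inverse (1 + \<eta>\<^sup>2)"
    using adjoint_kernel1_bound by blast
  let ?f = "\<lambda>v::'e. \<Prod>b\<in>Basis. M * inverse (1 + (v \<bullet> b)\<^sup>2)"
  let ?g = "\<lambda>\<eta>::'e. \<Prod>b\<in>Basis. inverse (1 + (\<eta> \<bullet> b)\<^sup>2)"
  have fg: "integrable lborel ?f" "integrable lborel ?g"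
    by (intro lborel_integrable_prod integrable_mult_right integrable_inverse_square)+
  show ?thesis
  proof (rule Bochner_Integration.integrable_bound[OF integrable_pair_mult[OF fg]])
    show "adjoint_kernel \<in> borel_measurable lborel" by simp
    show "AE w :: 'e \<times> 'e in lborel. norm (adjoint_kernel w) \<le> norm (?f (fst w) * ?g (snd w))"
    proof (rule AE_I2)
      fix w :: "'e \<times> 'e"
      have "norm (adjoint_kernel w) = (\<Prod>b\<in>Basis. norm (adjoint_kernel1 (fst w \<bullet> b) (snd w \<bullet> b)))"
        using adjoint_kernel_eq_prod[of "fst w" "snd w"] by (simp add: prod_norm)
      also have "\<dots> \<le> (\<Prod>b\<in>Basis. M * inverse (1 + (fst w \<bullet> b)\<^sup>2) * inverse (1 + (snd w \<bullet> b)\<^sup>2))"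
        by (intro prod_mono) (auto simp: M)
      also have "\<dots> = ?f (fst w) * ?g (snd w)" by (simp add: prod.distrib)
      also have "\<dots> \<le> norm \<dots>" by simp
      finally show "norm (adjoint_kernel w) \<le> norm (?f (fst w) * ?g (snd w))" .
    qed
  qed
qed

section \<open>Convolutions and representation of symbols\<close>

lemma convolution_integrable:
  fixes k :: "'e::euclidean_space \<Rightarrow> complex"
    and b :: "'e \<Rightarrow> 'a::{complex_normed_vector, banach, second_countable_topology}"
  assumes k: "integrable lborel k" and b: "b \<in> CB_infinity"
  shows "integrable lborel (\<lambda>u. k u *\<^sub>C b (w - u))"
proof -
  obtain B where B: "B \<ge> 0" "\<And>w. norm (b w) \<le> B" using CB_infinity_boundedE[OF b] by blast
  have [measurable]: "b \<in> borel_measurable borel" by (rule borel_measurable_CB_infinity[OF b])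
  show ?thesis
  proof (rule Bochner_Integration.integrable_bound[of _ "\<lambda>u. norm (k u) * B"])
    show "integrable lborel (\<lambda>u. norm (k u) * B)" using k by simp
    show "(\<lambda>u. k u *\<^sub>C b (w - u)) \<in> borel_measurable lborel"
      using borel_measurable_integrable[OF k] by measurable
    show "AE u in lborel. norm (k u *\<^sub>C b (w - u)) \<le> norm (norm (k u) * B)"
      using B by (intro AE_I2) (auto simp: norm_scaleC abs_mult intro!: mult_left_mono)
  qed
qed

lemma convolution_eq:
  fixes k :: "'e::euclidean_space \<Rightarrow> complex"
    and b :: "'e \<Rightarrow> 'a::{complex_normed_vector, banach, second_countable_topology}"
  assumes k: "integrable lborel k" and b: "b \<in> CB_infinity"
  shows "(\<integral>u. k u *\<^sub>C b (v - u) \<partial>lborel) = (\<integral>w. k (v - w) *\<^sub>C b w \<partial>lborel)"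
proof -
  have [measurable]: "b \<in> borel_measurable borel" by (rule borel_measurable_CB_infinity[OF b])
  have [measurable]: "k \<in> borel_measurable borel" using borel_measurable_integrable[OF k] by simp
  show ?thesis
    using lborel_integral_reflect[of "\<lambda>w. k (v - w) *\<^sub>C b w" v] by simp
qed

text \<open>All derivatives fall on the factor \<open>b\<close>, so the convolutions with the fixed kernel \<open>k\<close> form a class that is
  closed under partial derivatives.\<close>

lemma convolution_CB_infinity:
  fixes k :: "'e::euclidean_space \<Rightarrow> complex"
    and b :: "'e \<Rightarrow> 'a::{complex_normed_vector, banach, second_countable_topology}"
  assumes k: "integrable lborel k" and b: "b \<in> CB_infinity"
  shows "(\<lambda>w. \<integral>u. k u *\<^sub>C b (w - u) \<partial>lborel) \<in> CB_infinity"
proof (rule CB_infinity_coinduct)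
  let ?C = "{\<lambda>w. \<integral>u. k u *\<^sub>C b (w - u) \<partial>lborel | b. b \<in> (CB_infinity :: ('e \<Rightarrow> 'a) set)}"
  show "(\<lambda>w. \<integral>u. k u *\<^sub>C b (w - u) \<partial>lborel) \<in> ?C" using b by blast
  fix f assume "f \<in> ?C"
  then obtain b where f: "f = (\<lambda>w. \<integral>u. k u *\<^sub>C b (w - u) \<partial>lborel)" and b: "b \<in> CB_infinity" by blast
  obtain B where B: "B \<ge> 0" "\<And>w. norm (b w) \<le> B" using CB_infinity_boundedE[OF b] by blast
  have "norm (f w) \<le> (\<integral>u. norm (k u) * B \<partial>lborel)" for w
    unfolding f
    by (intro Bochner_Integration.integral_norm_bound_integral convolution_integrable k b)
       (use k B in \<open>auto simp: norm_scaleC intro!: mult_left_mono\<close>)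
  then show "bounded (range f)" by (auto simp: bounded_iff)
  obtain b' C where b': "\<And>w. (b has_derivative b' w) (at w)" "\<And>e. e \<in> Basis \<Longrightarrow> (\<lambda>w. b' w e) \<in> CB_infinity"
    and C: "C \<ge> 0" "\<And>w v. norm (b' w v) \<le> C * norm v"
    using CB_infinityE[OF b] by metis
  have [measurable]: "(\<lambda>w. b' w h) \<in> borel_measurable borel" for h
    by (rule borel_measurable_continuous_onI[OF CB_infinity_continuous_derivative[OF b']])
  have "(f has_derivative (\<lambda>h. \<integral>u. k u *\<^sub>C b' (w - u) h \<partial>lborel)) (at w)" for w
    unfolding f
  proof (rule has_derivative_integral[where w = "\<lambda>u. norm (k u) * C"])
    show "integrable lborel (\<lambda>u. k u *\<^sub>C b (w - u))" for w by (rule convolution_integrable[OF k b])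
    show "(\<lambda>u. k u *\<^sub>C b' (w - u) h) \<in> borel_measurable lborel" for w h
      using borel_measurable_integrable[OF k] by measurable
    show "integrable lborel (\<lambda>u. norm (k u) * C)" using k by simp
    show "norm (k u *\<^sub>C b' (w - u) h) \<le> norm (k u) * C * norm h" for w h u
      using mult_left_mono[OF C(2)[of "w - u" h], of "norm (k u)"] by (simp add: norm_scaleC mult.assoc)
    show "((\<lambda>w. k u *\<^sub>C b (w - u)) has_derivative (\<lambda>h. k u *\<^sub>C b' (w - u) h)) (at w)" for w u
    proof (rule bounded_linear.has_derivative[OF bounded_linear_scaleC_right])
      have "((\<lambda>w. w - u) has_derivative (\<lambda>h. h)) (at w)" by (auto intro!: derivative_eq_intros)
      from has_derivative_compose[OF this b'(1)]
      show "((\<lambda>w. b (w - u)) has_derivative b' (w - u)) (at w)" by simp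
    qed
  qed
  then show "partials_in ?C f"
  proof (rule partials_inI)
    show "(\<lambda>w. \<integral>u. k u *\<^sub>C b' (w - u) e \<partial>lborel) \<in> ?C" if "e \<in> Basis" for e
      by (intro CollectI exI[of _ "\<lambda>w. b' w e"] conjI refl b'(2) that)
  qed
qed

text \<open>With \<open>b = (1 + \<partial>\<^sub>e)\<^sup>2 a\<close>, \<open>b0 = (1 + \<partial>\<^sub>e) a\<close> and all functions evaluated at \<open>w - t e\<close>, the integrand
  \<open>t e\<^sup>-\<^sup>t b\<close> is the derivative of \<open>- e\<^sup>-\<^sup>t (t b0 + a)\<close> in \<open>t\<close>, whose value at \<open>t = 0\<close> is \<open>- a w\<close>.\<close>

lemma gamma1_convolution_representation:
  fixes a :: "'e::euclidean_space \<Rightarrow> 'a::{banach, second_countable_topology}"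
  assumes a: "a \<in> CB_infinity" and e: "e \<in> Basis"
  shows "\<exists>b\<in>CB_infinity. \<forall>w. a w = (\<integral>t. gamma1 t *\<^sub>R b (w - t *\<^sub>R e) \<partial>lborel)"
proof -
  obtain a' where a': "\<And>w. (a has_derivative a' w) (at w)" "\<And>e. e \<in> Basis \<Longrightarrow> (\<lambda>w. a' w e) \<in> CB_infinity"
    by (rule partials_inE[OF partials_in_CB_infinity[OF a]]) blast
  define b0 where "b0 = (\<lambda>w. a w + a' w e)"
  have b0: "b0 \<in> CB_infinity" unfolding b0_def by (rule CB_infinity_add[OF a a'(2)[OF e]])
  obtain b0' where b0': "\<And>w. (b0 has_derivative b0' w) (at w)" "\<And>e. e \<in> Basis \<Longrightarrow> (\<lambda>w. b0' w e) \<in> CB_infinity"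
    by (rule partials_inE[OF partials_in_CB_infinity[OF b0]]) blast
  define b where "b = (\<lambda>w. b0 w + b0' w e)"
  have b: "b \<in> CB_infinity" unfolding b_def by (rule CB_infinity_add[OF b0 b0'(2)[OF e]])
  obtain A where A: "A \<ge> 0" "\<And>w. norm (a w) \<le> A" using CB_infinity_boundedE[OF a] by blast
  obtain B0 where B0: "B0 \<ge> 0" "\<And>w. norm (b0 w) \<le> B0" using CB_infinity_boundedE[OF b0] by blast
  obtain B where B: "B \<ge> 0" "\<And>w. norm (b w) \<le> B" using CB_infinity_boundedE[OF b] by blast
  have line: "((\<lambda>t. f (w - t *\<^sub>R e)) has_vector_derivative - f' (w - t *\<^sub>R e) e) (at t)"
    if "\<And>w. (f has_derivative f' w) (at w)" for f :: "'e \<Rightarrow> 'a" and f' w t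
  proof -
    have "((\<lambda>t. w - t *\<^sub>R e) has_derivative (\<lambda>h. - (h *\<^sub>R e))) (at t)"
      by (auto intro!: derivative_eq_intros)
    from has_derivative_compose[OF this that]
    show ?thesis
      using bounded_linear.linear[OF has_derivative_bounded_linear[OF that]]
      by (simp add: has_vector_derivative_def linear_scale linear_neg)
  qed
  have "a w = (\<integral>t. gamma1 t *\<^sub>R b (w - t *\<^sub>R e) \<partial>lborel)" for w
  proof -
    let ?G = "\<lambda>t. - (exp (- t) *\<^sub>R (t *\<^sub>R b0 (w - t *\<^sub>R e) + a (w - t *\<^sub>R e)))"
    let ?G' = "\<lambda>t. (t * exp (- t)) *\<^sub>R b (w - t *\<^sub>R e)"
    have a'_eq: "a' x e = b0 x - a x" for x by (simp add: b0_def)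
    have der: "(?G has_vector_derivative ?G' t) (at t)" for t
    proof -
      have 1: "((\<lambda>t. t *\<^sub>R b0 (w - t *\<^sub>R e) + a (w - t *\<^sub>R e)) has_vector_derivative
          (t *\<^sub>R (- b0' (w - t *\<^sub>R e) e) + 1 *\<^sub>R b0 (w - t *\<^sub>R e) + (- a' (w - t *\<^sub>R e) e))) (at t)"
        by (intro has_vector_derivative_add has_vector_derivative_scaleR line a'(1) b0'(1) DERIV_ident)
      have 2: "((\<lambda>t. exp (- t)) has_field_derivative - exp (- t)) (at t)"
        by (auto intro!: derivative_eq_intros)
      show ?thesis
        by (rule has_vector_derivative_eq_rhs[OF has_vector_derivative_minus[OF has_vector_derivative_scaleR[OF 2 1]]])
           (simp add: b_def a'_eq scaleR_add_right scaleR_diff_right mult.commute)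
    qed
    let ?K = "A + B0 + B"
    have "(\<integral>t. indicator {0..} t *\<^sub>R ?G' t \<partial>lborel) = - ?G 0"
    proof (rule integral_halfline_derivative(2)[OF der])
      fix t :: real assume t: "t \<ge> 0"
      have "norm (t *\<^sub>R b0 (w - t *\<^sub>R e) + a (w - t *\<^sub>R e)) \<le> t * B0 + A"
        using t mult_left_mono[OF B0(2) t] by (intro norm_triangle_mono A) auto
      also have "\<dots> \<le> ?K * (1 + t)" using t A(1) B0(1) B(1) by (simp add: algebra_simps add_increasing)
      finally have "exp (- t) * norm (t *\<^sub>R b0 (w - t *\<^sub>R e) + a (w - t *\<^sub>R e)) \<le> exp (- t) * (?K * (1 + t))"
        by (rule mult_left_mono) simp
      then show "norm (?G t) \<le> ?K * ((1 + t) * exp (- t))" by (simp add: mult_ac)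
      have "norm (b (w - t *\<^sub>R e)) \<le> ?K" using B(2)[of "w - t *\<^sub>R e"] A(1) B0(1) by simp
      then have "t * norm (b (w - t *\<^sub>R e)) \<le> (1 + t) * ?K"
        using t by (intro mult_mono) auto
      then have "exp (- t) * (t * norm (b (w - t *\<^sub>R e))) \<le> exp (- t) * ((1 + t) * ?K)"
        by (rule mult_left_mono) simp
      then show "norm (?G' t) \<le> ?K * ((1 + t) * exp (- t))" using t by (simp add: mult_ac)
    qed
    then show ?thesis by (simp add: gamma1_eq)
  qed
  then show ?thesis by (intro bexI[OF _ b] allI)
qed

text \<open>Iterating the representation over a set of coordinate directions.  It is stated for the product measure over
  that set, because only for the whole basis does this become Lebesgue measure.\<close>

lemma gamma1_convolution_representation_finite:
  fixes I :: "'e::euclidean_space set"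
  assumes "finite I" "I \<subseteq> Basis"
  shows "\<forall>a::'e \<Rightarrow> 'a::{banach, second_countable_topology}. a \<in> CB_infinity \<longrightarrow> (\<exists>b\<in>CB_infinity. \<forall>w.
    a w = (\<integral>g. (\<Prod>e\<in>I. gamma1 (g e)) *\<^sub>R b (w - (\<Sum>e\<in>I. g e *\<^sub>R e)) \<partial>(\<Pi>\<^sub>M e\<in>I. lborel)))"
  using assms
proof (induction I rule: finite_induct)
  case empty
  interpret finite_measure "Pi\<^sub>M {} (\<lambda>_::'e. lborel :: real measure)"
    by rule (simp add: space_PiM)
  show ?case by (auto simp: space_PiM measure_def)
next
  case (insert i I)
  show ?case
  proof (intro allI impI)
    fix a :: "'e \<Rightarrow> 'a" assume a: "a \<in> CB_infinity"
    have "I \<subseteq> Basis" using insert.prems by simp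
    from insert.IH[OF this, THEN spec, THEN mp, OF a] obtain b1 where b1: "b1 \<in> CB_infinity"
      and a_eq: "\<And>w. a w = (\<integral>g. (\<Prod>e\<in>I. gamma1 (g e)) *\<^sub>R b1 (w - (\<Sum>e\<in>I. g e *\<^sub>R e)) \<partial>(\<Pi>\<^sub>M e\<in>I. lborel))"
      by blast
    obtain b where b: "b \<in> CB_infinity" and b1_eq: "\<And>w. b1 w = (\<integral>t. gamma1 t *\<^sub>R b (w - t *\<^sub>R i) \<partial>lborel)"
      using gamma1_convolution_representation[OF b1, of i] insert.prems by blast
    obtain B where B: "B \<ge> 0" "\<And>w. norm (b w) \<le> B" using CB_infinity_boundedE[OF b] by blast
    have [measurable]: "b \<in> borel_measurable borel" by (rule borel_measurable_CB_infinity[OF b])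
    have [measurable]: "gamma1 \<in> borel_measurable borel" by (rule borel_measurable_continuous_onI[OF continuous_gamma1])
    have "a w = (\<integral>g. (\<Prod>e\<in>insert i I. gamma1 (g e)) *\<^sub>R b (w - (\<Sum>e\<in>insert i I. g e *\<^sub>R e)) \<partial>(\<Pi>\<^sub>M e\<in>insert i I. lborel))" for w
    proof -
      let ?f = "\<lambda>g. (\<Prod>e\<in>insert i I. gamma1 (g e)) *\<^sub>R b (w - (\<Sum>e\<in>insert i I. g e *\<^sub>R e))"
      have "integrable (\<Pi>\<^sub>M e\<in>insert i I. lborel) ?f"
      proof (rule Bochner_Integration.integrable_bound)
        show "integrable (\<Pi>\<^sub>M e\<in>insert i I. lborel) (\<lambda>g. (\<Prod>e\<in>insert i I. gamma1 (g e)) * B)"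
          using insert.hyps by (intro integrable_mult_left lborel_product.product_integrable_prod integrable_gamma1) auto
        show "?f \<in> borel_measurable (\<Pi>\<^sub>M e\<in>insert i I. lborel)" by measurable
        show "AE g in \<Pi>\<^sub>M e\<in>insert i I. lborel. norm (?f g) \<le> norm ((\<Prod>e\<in>insert i I. gamma1 (g e)) * B)"
          using B by (intro AE_I2) (auto simp: abs_mult intro!: mult_left_mono)
      qed
      then have "(\<integral>g. ?f g \<partial>(\<Pi>\<^sub>M e\<in>insert i I. lborel)) = (\<integral>g. (\<integral>t. ?f (g(i := t)) \<partial>lborel) \<partial>(\<Pi>\<^sub>M e\<in>I. lborel))"
        by (rule lborel_product.product_integral_insert[OF insert.hyps])
      also have "\<dots> = a w"
        unfolding a_eq
      proof (rule Bochner_Integration.integral_cong[OF refl])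
        fix g
        have "?f (g(i := t)) = (\<Prod>e\<in>I. gamma1 (g e)) *\<^sub>R (gamma1 t *\<^sub>R b (w - (\<Sum>e\<in>I. g e *\<^sub>R e) - t *\<^sub>R i))" for t
        proof -
          have "(\<Prod>e\<in>I. gamma1 ((g(i := t)) e)) = (\<Prod>e\<in>I. gamma1 (g e))" "(\<Sum>e\<in>I. (g(i := t)) e *\<^sub>R e) = (\<Sum>e\<in>I. g e *\<^sub>R e)"
            using insert.hyps by (auto intro!: prod.cong sum.cong)
          then show ?thesis using insert.hyps by (simp add: algebra_simps)
        qed
        then show "(\<integral>t. ?f (g(i := t)) \<partial>lborel) = (\<Prod>e\<in>I. gamma1 (g e)) *\<^sub>R b1 (w - (\<Sum>e\<in>I. g e *\<^sub>R e))"
          unfolding b1_eq by (simp only: integral_scaleR_right)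
      qed
      finally show ?thesis by simp
    qed
    then show "\<exists>b\<in>CB_infinity. \<forall>w. a w = (\<integral>g. (\<Prod>e\<in>insert i I. gamma1 (g e)) *\<^sub>R b (w - (\<Sum>e\<in>insert i I. g e *\<^sub>R e)) \<partial>(\<Pi>\<^sub>M e\<in>insert i I. lborel))"
      by (intro bexI[OF _ b] allI)
  qed
qed

lemma gamma_kernel_convolution_representation:
  fixes a :: "'e::euclidean_space \<Rightarrow> 'a::{banach, second_countable_topology}"
  assumes a: "a \<in> CB_infinity"
  shows "\<exists>b\<in>CB_infinity. \<forall>w. a w = (\<integral>u. gamma_kernel u *\<^sub>R b (w - u) \<partial>lborel)"
proof -
  obtain b where b: "b \<in> CB_infinity" and eq: "\<And>w. a w =
      (\<integral>g. (\<Prod>e\<in>Basis. gamma1 (g e)) *\<^sub>R b (w - (\<Sum>e\<in>Basis. g e *\<^sub>R e)) \<partial>(\<Pi>\<^sub>M e\<in>(Basis :: 'e set). lborel))"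
    using gamma1_convolution_representation_finite[OF finite_Basis subset_refl, THEN spec, THEN mp, OF a] by blast
  have [measurable]: "b \<in> borel_measurable borel" by (rule borel_measurable_CB_infinity[OF b])
  have "a w = (\<integral>u. gamma_kernel u *\<^sub>R b (w - u) \<partial>lborel)" for w
  proof -
    let ?T = "\<lambda>g. \<Sum>e\<in>Basis. g e *\<^sub>R e :: 'e"
    have gT: "gamma_kernel (?T g) = (\<Prod>e\<in>Basis. gamma1 (g e))" for g
      unfolding gamma_kernel_def
      by (intro prod.cong) (simp_all add: inner_sum_left inner_Basis if_distrib if_distribR cong: if_cong)
    have "(\<integral>u. gamma_kernel u *\<^sub>R b (w - u) \<partial>lborel) = (\<integral>g. gamma_kernel (?T g) *\<^sub>R b (w - ?T g) \<partial>(\<Pi>\<^sub>M e\<in>(Basis :: 'e set). lborel))"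
      by (subst lborel_eq, subst integral_distr) auto
    then show ?thesis by (simp add: eq gT)
  qed
  then show ?thesis by (intro bexI[OF _ b] allI)
qed

section \<open>Fourier inversion\<close>

text \<open>Gaussians are used to regularise the inversion integral.  They are not normalised, so that they equal \<open>1\<close> at
  the origin.\<close>

definition gauss :: "'e::euclidean_space \<Rightarrow> real" where "gauss x = exp (- (norm x)\<^sup>2 / 2)"

lemma gauss_eq_prod: "gauss x = (\<Prod>b\<in>Basis. exp (- (x \<bullet> b)\<^sup>2 / 2))"
proof -
  have "(norm x)\<^sup>2 = (\<Sum>b\<in>Basis. (x \<bullet> b)\<^sup>2)"
    unfolding power2_norm_eq_inner by (subst euclidean_inner) (simp add: power2_eq_square)
  then have "- (norm x)\<^sup>2 / 2 = (\<Sum>b\<in>Basis. - (x \<bullet> b)\<^sup>2 / 2)"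
    by (simp only: sum_negf[symmetric] sum_divide_distrib)
  then show ?thesis by (simp add: gauss_def exp_sum)
qed

lemma continuous_gauss: "continuous_on A gauss"
  unfolding gauss_def[abs_def] by (intro continuous_intros) auto

lemma borel_measurable_gauss [measurable]: "gauss \<in> borel_measurable borel"
  by (rule borel_measurable_continuous_onI[OF continuous_gauss])

lemma
  shows integrable_gauss1: "integrable lborel (\<lambda>t::real. exp (- t\<^sup>2 / 2))"
    and integral_gauss1: "(\<integral>t. of_real (exp (- t\<^sup>2 / 2)) * cis (x * t) \<partial>lborel) = of_real (sqrt (2 * pi) * exp (- x\<^sup>2 / 2))"
proof -
  have eq: "exp (- t\<^sup>2 / 2) = sqrt (2 * pi) * std_normal_density t" for t
    by (simp add: std_normal_density_def)
  show "integrable lborel (\<lambda>t::real. exp (- t\<^sup>2 / 2))"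
    unfolding eq by (intro integrable_mult_right integrable_normal_density) simp
  have "of_real (exp (- x\<^sup>2 / 2)) = char std_normal_distribution x"
    by (simp add: char_std_normal_distribution)
  also have "\<dots> = (\<integral>t. std_normal_density t *\<^sub>R cis (x * t) \<partial>lborel)"
    unfolding char_def by (subst integral_density) (auto simp: cis_conv_exp normal_density_nonneg)
  finally have *: "of_real (exp (- x\<^sup>2 / 2)) = (\<integral>t. std_normal_density t *\<^sub>R cis (x * t) \<partial>lborel)" .
  have "(\<lambda>t. of_real (exp (- t\<^sup>2 / 2)) * cis (x * t)) = (\<lambda>t. sqrt (2 * pi) *\<^sub>R (std_normal_density t *\<^sub>R cis (x * t)))"
    by (rule ext) (simp only: eq scaleR_conv_of_real mult.assoc of_real_mult)
  then show "(\<integral>t. of_real (exp (- t\<^sup>2 / 2)) * cis (x * t) \<partial>lborel) = of_real (sqrt (2 * pi) * exp (- x\<^sup>2 / 2))"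
    by (simp only: integral_scaleR_right *[symmetric]) (simp add: scaleR_conv_of_real)
qed

lemma integrable_gauss: "integrable lborel gauss"
  unfolding gauss_eq_prod[abs_def] by (intro lborel_integrable_prod integrable_gauss1)

lemma fourier_gauss:
  fixes x :: "'e::euclidean_space"
  shows "(\<integral>\<xi>. of_real (gauss \<xi>) * cis (x \<bullet> \<xi>) \<partial>lborel) = of_real (sqrt (2 * pi) ^ DIM('e) * gauss x)"
proof -
  have "of_real (gauss \<xi>) * cis (x \<bullet> \<xi>) = (\<Prod>b\<in>Basis. of_real (exp (- (\<xi> \<bullet> b)\<^sup>2 / 2)) * cis ((x \<bullet> b) * (\<xi> \<bullet> b)))" for \<xi>
    by (simp add: gauss_eq_prod prod.distrib cis_sum[symmetric] euclidean_inner[of x \<xi>])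
  then have "(\<integral>\<xi>. of_real (gauss \<xi>) * cis (x \<bullet> \<xi>) \<partial>lborel)
      = (\<integral>\<xi>. (\<Prod>b\<in>Basis. of_real (exp (- (\<xi> \<bullet> b)\<^sup>2 / 2)) * cis ((x \<bullet> b) * (\<xi> \<bullet> b))) \<partial>lborel)"
    by simp
  also have "\<dots> = (\<Prod>b\<in>Basis. \<integral>t. of_real (exp (- t\<^sup>2 / 2)) * cis ((x \<bullet> b) * t) \<partial>lborel)"
  proof (rule lborel_integral_prod)
    show "integrable lborel (\<lambda>t. of_real (exp (- t\<^sup>2 / 2)) * cis ((x \<bullet> b) * t))" for b
      by (rule Bochner_Integration.integrable_bound[OF integrable_gauss1])
         (auto simp: norm_mult intro!: borel_measurable_continuous_onI continuous_intros)
  qed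
  also have "\<dots> = (\<Prod>b\<in>Basis. of_real (sqrt (2 * pi) * exp (- (x \<bullet> b)\<^sup>2 / 2)))"
    by (simp only: integral_gauss1)
  finally show ?thesis by (simp add: gauss_eq_prod prod.distrib)
qed

lemma gauss_le_1: "gauss x \<le> 1" by (simp add: gauss_def)

lemma gauss_pos [simp]: "0 < gauss x" by (simp add: gauss_def)

lemma integral_gauss: "(\<integral>\<xi>. gauss \<xi> \<partial>(lborel :: 'e::euclidean_space measure)) = sqrt (2 * pi) ^ DIM('e)"
proof -
  have "complex_of_real (\<integral>\<xi>. gauss \<xi> \<partial>(lborel :: 'e measure)) = of_real (sqrt (2 * pi) ^ DIM('e))"
    using fourier_gauss[of "0::'e"] by (simp add: gauss_def[of 0])
  then show ?thesis by (simp only: of_real_eq_iff)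
qed

text \<open>With the convergence factor \<open>gauss (\<epsilon> \<xi>)\<close> the order of integration may be exchanged.  The inner
  integral is then a rescaled Gaussian, and the substitution \<open>y = x + \<epsilon> u\<close> produces
  \<open>(2\<pi>)\<^bsup>n/2\<^esup> \<integral> gauss u f(x + \<epsilon> u) du\<close>, which converges to \<open>(2\<pi>)\<^sup>n f(x)\<close>.  Dominated convergence
  removes the factor on the other side.\<close>

lemma fourier_inversion_integral:
  fixes f :: "'e::euclidean_space \<Rightarrow> 'a::{complex_normed_vector, banach, second_countable_topology}"
  assumes f: "integrable lborel f" and cont: "continuous_on UNIV f" and bd: "\<And>y. norm (f y) \<le> B"
    and F: "integrable lborel (\<lambda>\<xi>. \<integral>y. cis (- (\<xi> \<bullet> y)) *\<^sub>C f y \<partial>lborel)" (is "integrable lborel ?F")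
  shows "(\<integral>\<xi>. cis (x \<bullet> \<xi>) *\<^sub>C ?F \<xi> \<partial>lborel) = (2 * pi) ^ DIM('e) *\<^sub>R f x"
proof -
  let ?n = "DIM('e)"
  have [measurable]: "f \<in> borel_measurable borel" by (rule borel_measurable_continuous_onI[OF cont])
  have [measurable]: "?F \<in> borel_measurable borel" using F by auto
  define s where "s i = inverse (real (Suc i))" for i
  have s: "0 < s i" for i by (auto simp: s_def)
  have s0: "s \<longlonglongrightarrow> 0" unfolding s_def by (rule LIMSEQ_inverse_real_of_nat)
  \<comment> \<open>the inversion integral with convergence factor, for \<open>\<epsilon> = s i\<close>\<close>
  define J where "J i = (\<integral>\<xi>. of_real (gauss (s i *\<^sub>R \<xi>)) *\<^sub>C (cis (x \<bullet> \<xi>) *\<^sub>C ?F \<xi>) \<partial>lborel)" for i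
  have gauss_tendsto: "(\<lambda>i. gauss (s i *\<^sub>R \<xi>)) \<longlonglongrightarrow> 1" for \<xi> :: 'e
  proof -
    have "(\<lambda>i. s i *\<^sub>R \<xi>) \<longlonglongrightarrow> 0" using tendsto_scaleR[OF s0 tendsto_const[of \<xi>]] by simp
    moreover have "isCont gauss (0::'e)" using continuous_gauss[of "UNIV :: 'e set"] by (simp add: continuous_on_eq_continuous_at)
    ultimately have "(\<lambda>i. gauss (s i *\<^sub>R \<xi>)) \<longlonglongrightarrow> gauss (0::'e)" by (rule isCont_tendsto_compose[rotated])
    then show ?thesis by (simp add: gauss_def)
  qed
  have [measurable]: "(\<lambda>\<xi>. cis (a \<bullet> \<xi>)) \<in> borel_measurable borel" for a :: 'e
    by (intro borel_measurable_continuous_onI continuous_intros)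
  have lim1: "J \<longlonglongrightarrow> (\<integral>\<xi>. cis (x \<bullet> \<xi>) *\<^sub>C ?F \<xi> \<partial>lborel)"
    unfolding J_def
  proof (rule integral_dominated_convergence[where w = "\<lambda>\<xi>. norm (?F \<xi>)"])
    show "integrable lborel (\<lambda>\<xi>. norm (?F \<xi>))" using F by simp
    show "AE \<xi> in lborel. (\<lambda>i. of_real (gauss (s i *\<^sub>R \<xi>)) *\<^sub>C (cis (x \<bullet> \<xi>) *\<^sub>C ?F \<xi>)) \<longlonglongrightarrow> cis (x \<bullet> \<xi>) *\<^sub>C ?F \<xi>"
    proof (rule AE_I2)
      fix \<xi> :: 'e
      show "(\<lambda>i. of_real (gauss (s i *\<^sub>R \<xi>)) *\<^sub>C (cis (x \<bullet> \<xi>) *\<^sub>C ?F \<xi>)) \<longlonglongrightarrow> cis (x \<bullet> \<xi>) *\<^sub>C ?F \<xi>"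
        using tendsto_scaleR[OF gauss_tendsto[of \<xi>] tendsto_const[of "cis (x \<bullet> \<xi>) *\<^sub>C ?F \<xi>"]]
        by (simp add: scaleR_scaleC)
    qed
    show "AE \<xi> in lborel. norm (of_real (gauss (s i *\<^sub>R \<xi>)) *\<^sub>C (cis (x \<bullet> \<xi>) *\<^sub>C ?F \<xi>)) \<le> norm (?F \<xi>)" for i
      using mult_right_mono[OF gauss_le_1 norm_ge_zero] by (intro AE_I2) (simp add: norm_scaleC less_imp_le)
  qed measurable
  have J_eq: "J i = sqrt (2 * pi) ^ ?n *\<^sub>R (\<integral>u. gauss u *\<^sub>R f (x + s i *\<^sub>R u) \<partial>lborel)" for i
  proof -
    let ?h = "\<lambda>p. (of_real (gauss (s i *\<^sub>R fst p)) * cis ((x - snd p) \<bullet> fst p)) *\<^sub>C f (snd p)"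
    have gint: "integrable lborel (\<lambda>\<xi>::'e. gauss (s i *\<^sub>R \<xi>))"
    proof -
      have "integrable lborel (\<lambda>\<xi>::'e. \<Prod>b\<in>Basis. exp (- (0 + s i * (\<xi> \<bullet> b))\<^sup>2 / 2))"
        using s[of i] by (intro lborel_integrable_prod lborel_integrable_real_affine[where f = "\<lambda>t. exp (- t\<^sup>2 / 2)"] integrable_gauss1) simp
      then show ?thesis by (simp add: gauss_eq_prod)
    qed
    have hint: "integrable lborel ?h"
    proof (rule lborel_integrable_pair_bound[OF _ gint integrable_norm[OF f]])
      have "continuous_on UNIV ?h"
        by (intro continuous_intros continuous_on_compose2[OF continuous_gauss[of UNIV]] continuous_on_compose2[OF cont]) auto
      then show "?h \<in> borel_measurable borel" by (rule borel_measurable_continuous_onI)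
      show "norm (?h (\<xi>, y)) \<le> gauss (s i *\<^sub>R \<xi>) * norm (f y)" for \<xi> y
        by (simp add: norm_scaleC norm_mult less_imp_le)
    qed
    have "J i = (\<integral>\<xi>. \<integral>y. ?h (\<xi>, y) \<partial>lborel \<partial>lborel)"
      unfolding J_def
    proof (rule Bochner_Integration.integral_cong[OF refl])
      fix \<xi> :: 'e
      have "cis (x \<bullet> \<xi>) * cis (- (\<xi> \<bullet> y)) = cis ((x - y) \<bullet> \<xi>)" for y
        by (simp add: cis_mult inner_diff_left inner_commute[of \<xi> y])
      then show "of_real (gauss (s i *\<^sub>R \<xi>)) *\<^sub>C (cis (x \<bullet> \<xi>) *\<^sub>C ?F \<xi>) = (\<integral>y. ?h (\<xi>, y) \<partial>lborel)"
        unfolding integral_scaleC_right[symmetric] by (simp add: scaleC_scaleC mult.assoc)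
    qed
    also have "\<dots> = (\<integral>y. \<integral>\<xi>. ?h (\<xi>, y) \<partial>lborel \<partial>lborel)"
      by (rule lborel_integral_swap[OF hint])
    also have "\<dots> = (\<integral>y. (sqrt (2 * pi) ^ ?n * (1 / s i) ^ ?n * gauss ((1 / s i) *\<^sub>R (x - y))) *\<^sub>R f y \<partial>lborel)"
    proof (rule Bochner_Integration.integral_cong[OF refl])
      fix y :: 'e
      let ?g = "\<lambda>\<xi>. of_real (gauss (s i *\<^sub>R \<xi>)) * cis ((x - y) \<bullet> \<xi>)"
      have "integrable lborel ?g"
        by (rule Bochner_Integration.integrable_bound[OF gint]) (auto simp: norm_mult)
      then have "(\<integral>\<xi>. ?h (\<xi>, y) \<partial>lborel) = (\<integral>\<xi>. ?g \<xi> \<partial>lborel) *\<^sub>C f y"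
        by (simp add: integral_scaleC_left)
      also have "(\<integral>\<xi>. ?g \<xi> \<partial>lborel) = \<bar>1 / s i\<bar> ^ ?n *\<^sub>R (\<integral>\<xi>. ?g (0 + (1 / s i) *\<^sub>R \<xi>) \<partial>lborel)"
        using s[of i] by (intro lborel_integral_affine) auto
      also have "(\<lambda>\<xi>. ?g (0 + (1 / s i) *\<^sub>R \<xi>)) = (\<lambda>\<xi>. of_real (gauss \<xi>) * cis (((1 / s i) *\<^sub>R (x - y)) \<bullet> \<xi>))"
        using s[of i] by simp
      also have "(\<integral>\<xi>. of_real (gauss \<xi>) * cis (((1 / s i) *\<^sub>R (x - y)) \<bullet> \<xi>) \<partial>lborel)
          = of_real (sqrt (2 * pi) ^ ?n * gauss ((1 / s i) *\<^sub>R (x - y)))"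
        by (rule fourier_gauss)
      also have "(\<bar>1 / s i\<bar> ^ ?n *\<^sub>R complex_of_real (sqrt (2 * pi) ^ ?n * gauss ((1 / s i) *\<^sub>R (x - y)))) *\<^sub>C f y
          = (sqrt (2 * pi) ^ ?n * (1 / s i) ^ ?n * gauss ((1 / s i) *\<^sub>R (x - y))) *\<^sub>R f y"
        using s[of i] by (simp only: scaleR_scaleC scaleR_conv_of_real of_real_mult[symmetric] abs_of_pos divide_pos_pos zero_less_one)
          (simp only: mult_ac)
      finally show "(\<integral>\<xi>. ?h (\<xi>, y) \<partial>lborel) = (sqrt (2 * pi) ^ ?n * (1 / s i) ^ ?n * gauss ((1 / s i) *\<^sub>R (x - y))) *\<^sub>R f y" .
    qed
    also have "\<dots> = \<bar>s i\<bar> ^ ?n *\<^sub>R (\<integral>u. (sqrt (2 * pi) ^ ?n * (1 / s i) ^ ?n * gauss ((1 / s i) *\<^sub>R (x - (x + s i *\<^sub>R u)))) *\<^sub>R f (x + s i *\<^sub>R u) \<partial>lborel)"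
      using s[of i] by (intro lborel_integral_affine) auto
    also have "\<dots> = \<bar>s i\<bar> ^ ?n *\<^sub>R (\<integral>u. (sqrt (2 * pi) ^ ?n * (1 / s i) ^ ?n) *\<^sub>R (gauss u *\<^sub>R f (x + s i *\<^sub>R u)) \<partial>lborel)"
      using s[of i] by (simp add: gauss_def)
    also have "\<dots> = sqrt (2 * pi) ^ ?n *\<^sub>R (\<integral>u. gauss u *\<^sub>R f (x + s i *\<^sub>R u) \<partial>lborel)"
      unfolding integral_scaleR_right using s[of i] by (simp add: power_one_over)
    finally show ?thesis .
  qed
  have "(\<lambda>i. \<integral>u. gauss u *\<^sub>R f (x + s i *\<^sub>R u) \<partial>lborel) \<longlonglongrightarrow> (\<integral>u. gauss u *\<^sub>R f x \<partial>(lborel :: 'e measure))"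
  proof (rule integral_dominated_convergence[where w = "\<lambda>u. gauss u * B"])
    show "integrable lborel (\<lambda>u. gauss u * B)" by (intro integrable_mult_left integrable_gauss)
    show "AE u in lborel. (\<lambda>i. gauss u *\<^sub>R f (x + s i *\<^sub>R u)) \<longlonglongrightarrow> gauss u *\<^sub>R f x"
    proof (intro AE_I2 tendsto_scaleR tendsto_const)
      fix u :: 'e
      have "(\<lambda>i. x + s i *\<^sub>R u) \<longlonglongrightarrow> x + 0 *\<^sub>R u" by (intro tendsto_intros s0)
      moreover have "isCont f (x + 0 *\<^sub>R u)" using cont by (simp add: continuous_on_eq_continuous_at)
      ultimately show "(\<lambda>i. f (x + s i *\<^sub>R u)) \<longlonglongrightarrow> f x" using isCont_tendsto_compose by fastforce
    qed
    show "AE u in lborel. norm (gauss u *\<^sub>R f (x + s i *\<^sub>R u)) \<le> gauss u * B" for i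
      using bd by (intro AE_I2) (auto intro!: mult_left_mono simp: less_imp_le)
  qed measurable
  then have "J \<longlonglongrightarrow> sqrt (2 * pi) ^ ?n *\<^sub>R (\<integral>u. gauss u *\<^sub>R f x \<partial>(lborel :: 'e measure))"
    unfolding J_eq[abs_def] by (intro tendsto_intros)
  moreover have "(\<integral>u. gauss u *\<^sub>R f x \<partial>(lborel :: 'e measure)) = sqrt (2 * pi) ^ ?n *\<^sub>R f x"
    using integral_gauss integrable_gauss by (subst integral_scaleR_left) auto
  ultimately have "J \<longlonglongrightarrow> sqrt (2 * pi) ^ ?n *\<^sub>R sqrt (2 * pi) ^ ?n *\<^sub>R f x" by simp
  moreover have "sqrt (2 * pi) ^ ?n * sqrt (2 * pi) ^ ?n = (2 * pi) ^ ?n"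
    unfolding power_mult_distrib[symmetric] by simp
  ultimately have "J \<longlonglongrightarrow> (2 * pi) ^ ?n *\<^sub>R f x" by (simp only: scaleR_scaleR)
  then show ?thesis using lim1 LIMSEQ_unique by blast
qed

lemma fourier_inversion:
  fixes \<psi> :: "real^'n \<Rightarrow> 'a::separable_cstar_algebra"
  assumes "\<psi> \<in> schwartz"
  shows "(2 * pi) powr (- real CARD('n) / 2) *\<^sub>R (\<integral>\<xi>. cis (x \<bullet> \<xi>) *\<^sub>C fourier \<psi> \<xi> \<partial>lborel) = \<psi> x"
proof -
  let ?c = "(2 * pi) powr (- real CARD('n) / 2)"
  let ?F = "\<lambda>\<xi>. \<integral>y. cis (- (\<xi> \<bullet> y)) *\<^sub>C \<psi> y \<partial>lborel"
  have F: "fourier \<psi> = (\<lambda>\<xi>. ?c *\<^sub>R ?F \<xi>)" by (simp add: fourier_def fun_eq_iff)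
  have c: "?c > 0" by simp
  have "integrable lborel (\<lambda>\<xi>. (1 / ?c) *\<^sub>R fourier \<psi> \<xi>)"
    by (intro integrable_scaleR_right integrable_schwartz fourier_schwartz assms)
  then have Fint: "integrable lborel ?F" using c by (simp add: F)
  obtain B where B: "\<And>y. norm (\<psi> y) \<le> B" using schwartz_boundedE[OF assms, of 0] by auto
  have "(\<lambda>\<xi>. cis (x \<bullet> \<xi>) *\<^sub>C fourier \<psi> \<xi>) = (\<lambda>\<xi>. of_real ?c *\<^sub>C (cis (x \<bullet> \<xi>) *\<^sub>C ?F \<xi>))"
    by (simp only: F scaleR_scaleC scaleC_scaleC mult.commute)
  then have "(\<integral>\<xi>. cis (x \<bullet> \<xi>) *\<^sub>C fourier \<psi> \<xi> \<partial>lborel) = of_real ?c *\<^sub>C (\<integral>\<xi>. cis (x \<bullet> \<xi>) *\<^sub>C ?F \<xi> \<partial>lborel)"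
    by (simp only: integral_scaleC_right)
  also have "\<dots> = ?c *\<^sub>R ((2 * pi) ^ CARD('n) *\<^sub>R \<psi> x)"
    using fourier_inversion_integral[OF integrable_schwartz[OF assms] schwartz_continuous[OF assms] B Fint, of x]
    by (simp add: scaleR_scaleC)
  finally have "?c *\<^sub>R (\<integral>\<xi>. cis (x \<bullet> \<xi>) *\<^sub>C fourier \<psi> \<xi> \<partial>lborel) = (?c * ?c * (2 * pi) ^ CARD('n)) *\<^sub>R \<psi> x"
    by simp
  also have "?c * ?c * (2 * pi) ^ CARD('n) = 1"
  proof -
    have "(2 * pi) ^ CARD('n) = (2 * pi) powr real CARD('n)" by (rule powr_realpow[symmetric]) simp
    then have "?c * ?c * (2 * pi) ^ CARD('n) = (2 * pi) powr (- real CARD('n) / 2 + - real CARD('n) / 2 + real CARD('n))"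
      by (simp only: powr_add)
    then show ?thesis by simp
  qed
  finally show ?thesis by simp
qed

section \<open>The adjoint relation\<close>

lemma norm_mult3_le: "norm (u * v * w) \<le> norm u * norm v * norm (w :: 'a::real_normed_algebra)"
  by (rule order_trans[OF norm_mult_ineq mult_right_mono[OF norm_mult_ineq norm_ge_zero]])

lemma integrable_sandwich:
  fixes s L R :: "'e::euclidean_space \<Rightarrow> 'a::separable_cstar_algebra"
  assumes [measurable]: "L \<in> borel_measurable borel" "R \<in> borel_measurable borel"
    and s: "s \<in> CB_infinity"
    and N: "integrable lborel N" and LR: "\<And>v. norm (L v) * norm (R v) \<le> N v"
  shows "integrable lborel (\<lambda>v. L v * s v * R v)"
proof -
  obtain B where B: "B \<ge> 0" "\<And>w. norm (s w) \<le> B" using CB_infinity_boundedE[OF s] by blast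
  have [measurable]: "s \<in> borel_measurable borel" by (rule borel_measurable_CB_infinity[OF s])
  have N0: "0 \<le> N v" for v by (rule order_trans[OF _ LR[of v]]) simp
  show ?thesis
  proof (rule Bochner_Integration.integrable_bound[OF integrable_mult_left[OF N, of B]])
    have "norm (L v * s v * R v) \<le> N v * B" for v
      using mult_mono[OF LR[of v] B(2)[of v]] N0[of v] norm_mult3_le[of "L v" "s v" "R v"]
      by (simp add: mult_ac)
    then show "AE v in lborel. norm (L v * s v * R v) \<le> norm (N v * B)"
      using N0 B(1) by simp
  qed measurable
qed

text \<open>Writing \<open>k * b\<close> as an integral over the argument of \<open>b\<close> reduces an identity that is linear in the symbol
  \<open>k * b\<close> to the same identity for the translates of \<open>k\<close>, with a constant element of the algebra in
  place of \<open>b\<close>.\<close>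

lemma integral_sandwich_convolution:
  fixes k :: "'e::euclidean_space \<Rightarrow> complex" and b L R :: "'e \<Rightarrow> 'a::separable_cstar_algebra"
  assumes k: "integrable lborel k" and b: "b \<in> CB_infinity"
    and [measurable]: "L \<in> borel_measurable borel" "R \<in> borel_measurable borel"
    and N: "integrable lborel N" and LR: "\<And>v. norm (L v) * norm (R v) \<le> N v"
  shows "(\<integral>v. L v * (\<integral>u. k u *\<^sub>C b (v - u) \<partial>lborel) * R v \<partial>lborel)
    = (\<integral>w. \<integral>v. k (v - w) *\<^sub>C (L v * b w * R v) \<partial>lborel \<partial>lborel)"
proof -
  obtain B where B: "B \<ge> 0" "\<And>w. norm (b w) \<le> B" using CB_infinity_boundedE[OF b] by blast
  have [measurable]: "b \<in> borel_measurable borel" by (rule borel_measurable_CB_infinity[OF b])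
  have [measurable]: "k \<in> borel_measurable borel" using borel_measurable_integrable[OF k] by simp
  have [measurable]: "N \<in> borel_measurable borel" using borel_measurable_integrable[OF N] by simp
  let ?h = "\<lambda>p. k (fst p - snd p) *\<^sub>C (L (fst p) * b (snd p) * R (fst p))"
  have kint: "integrable lborel (\<lambda>w. k (v - w))" for v by (rule lborel_integrable_reflect[OF k])
  have bd: "norm (?h (v, w)) \<le> N v * B * norm (k (v - w))" for v w
  proof -
    have "norm (L v * b w * R v) \<le> norm (L v) * norm (b w) * norm (R v)" by (rule norm_mult3_le)
    also have "\<dots> = norm (L v) * norm (R v) * norm (b w)" by simp
    also have "\<dots> \<le> N v * B" using LR[of v] B by (intro mult_mono) (auto intro: order_trans[OF _ LR[of v]])
    finally have "norm (k (v - w)) * norm (L v * b w * R v) \<le> norm (k (v - w)) * (N v * B)"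
      by (rule mult_left_mono) simp
    then show ?thesis by (simp add: norm_scaleC mult.commute)
  qed
  have N0: "0 \<le> N v" for v by (rule order_trans[OF _ LR[of v]]) simp
  have slice: "integrable lborel (\<lambda>w. k (v - w) *\<^sub>C b w)" for v
    by (rule Bochner_Integration.integrable_bound[of _ "\<lambda>w. norm (k (v - w)) * B"])
       (use kint B in \<open>auto simp: norm_scaleC intro!: mult_left_mono AE_I2\<close>)
  have hint: "integrable lborel ?h"
  proof -
    have "integrable (lborel \<Otimes>\<^sub>M lborel) (\<lambda>p. N (fst p) * B * norm (k (fst p - snd p)))"
    proof (rule lborel_pair.Fubini_integrable)
      show "(\<lambda>p. N (fst p) * B * norm (k (fst p - snd p))) \<in> borel_measurable (lborel \<Otimes>\<^sub>M lborel)" by measurable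
      have "(\<integral>w. norm (N v * B * norm (k (v - w))) \<partial>lborel) = N v * B * (\<integral>u. norm (k u) \<partial>lborel)" for v
        using lborel_integral_reflect[of "\<lambda>u. norm (k u)" v] N0[of v] B by (simp add: abs_mult)
      then show "integrable lborel (\<lambda>x. \<integral>y. norm (N (fst (x, y)) * B * norm (k (fst (x, y) - snd (x, y)))) \<partial>lborel)"
        using N by simp
      show "AE v in lborel. integrable lborel (\<lambda>w. N (fst (v, w)) * B * norm (k (fst (v, w) - snd (v, w))))"
        using kint by simp
    qed
    then have dom: "integrable lborel (\<lambda>p. N (fst p) * B * norm (k (fst p - snd p)))" by (simp add: lborel_prod)
    show ?thesis
    proof (rule Bochner_Integration.integrable_bound[OF dom])
      have "?h \<in> borel_measurable (borel \<Otimes>\<^sub>M borel)" by measurable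
      then show "?h \<in> borel_measurable lborel" by (simp add: borel_prod)
      show "AE p in lborel. norm (?h p) \<le> norm (N (fst p) * B * norm (k (fst p - snd p)))"
        using order_trans[OF bd abs_ge_self] by (intro AE_I2) auto
    qed
  qed
  have "L v * (\<integral>u. k u *\<^sub>C b (v - u) \<partial>lborel) * R v = (\<integral>w. ?h (v, w) \<partial>lborel)" for v
  proof -
    have "L v * (\<integral>u. k u *\<^sub>C b (v - u) \<partial>lborel) * R v = (\<integral>w. L v * (k (v - w) *\<^sub>C b w) * R v \<partial>lborel)"
      unfolding convolution_eq[OF k b] using slice by simp
    then show ?thesis by (simp add: mult_scaleC_left mult_scaleC_right)
  qed
  then have "(\<integral>v. L v * (\<integral>u. k u *\<^sub>C b (v - u) \<partial>lborel) * R v \<partial>lborel) = (\<integral>v. \<integral>w. ?h (v, w) \<partial>lborel \<partial>lborel)"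
    by simp
  also have "\<dots> = (\<integral>w. \<integral>v. ?h (v, w) \<partial>lborel \<partial>lborel)" by (rule lborel_integral_swap[OF hint])
  finally show ?thesis by simp
qed

text \<open>The adjoint relation for the translates by \<open>w = (z, \<zeta>)\<close> of the two kernels.  Both sides are reduced to a double integral
  over \<open>x\<close> and \<open>y\<close> with a scalar kernel \<open>X x y\<close> between \<open>\<phi>(y)\<^sup>*\<close> and \<open>\<psi>(x)\<close>.  On the left
  \<open>\<phi>^(\<xi>)\<^sup>*\<close> is expanded and the integration over \<open>\<xi>\<close> turns the second factor of \<open>gamma_kernel\<close> into its
  Fourier transform; on the right the adjoint kernel is expanded and the integration over \<open>\<xi>\<close> is a
  Fourier inversion.\<close>

lemma adjoint_kernel_identity:
  fixes \<phi> \<psi> :: "real^'n \<Rightarrow> 'a::separable_cstar_algebra" and w :: "(real^'n) \<times> (real^'n)"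
  assumes \<phi>: "\<phi> \<in> schwartz" and \<psi>: "\<psi> \<in> schwartz"
  defines "c \<equiv> (2 * pi) powr (- real CARD('n) / 2)"
  shows "(\<integral>v. of_real (gamma_kernel (v - w)) *\<^sub>C ((cis (- (fst v \<bullet> snd v)) *\<^sub>C cstar (fourier \<phi> (snd v))) * \<beta> * \<psi> (fst v)) \<partial>lborel)
    = (c * c) *\<^sub>R (\<integral>v. adjoint_kernel (v - w) *\<^sub>C ((cis (fst v \<bullet> snd v) *\<^sub>C cstar (\<phi> (fst v))) * \<beta> * fourier \<psi> (snd v)) \<partial>lborel)"
    (is "?lhs = (c * c) *\<^sub>R ?rhs")
proof -
  obtain z \<zeta> where w: "w = (z, \<zeta>)" by (cases w)
  have c0: "c \<noteq> 0" by (simp add: c_def)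
  have cphi: "continuous_on A \<phi>" and cpsi: "continuous_on A \<psi>" for A
    using schwartz_continuous \<phi> \<psi> by blast+
  have cF: "continuous_on A (fourier \<phi>)" and cG: "continuous_on A (fourier \<psi>)" for A
    using schwartz_continuous fourier_schwartz \<phi> \<psi> by blast+
  have i\<phi>: "integrable lborel \<phi>" and i\<psi>: "integrable lborel \<psi>"
    and iF: "integrable lborel (fourier \<phi>)" and iG: "integrable lborel (fourier \<psi>)"
    using integrable_schwartz fourier_schwartz \<phi> \<psi> by blast+
  define f where "f = (\<lambda>y. cstar (\<phi> y))"
  have cf: "continuous_on A f" for A unfolding f_def by (intro continuous_on_cstar cphi)
  have intf: "integrable lborel f" unfolding f_def by (rule integrable_bounded_linear[OF bounded_linear_cstar i\<phi>])
  have nsand: "norm (u * \<beta> * v) \<le> norm u * (norm \<beta> * norm v)" for u v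
    using norm_mult3_le[of u \<beta> v] by (simp add: mult.assoc)
  have gz: "integrable lborel (\<lambda>x. gamma_kernel (x - z))" using lborel_integrable_translate[OF integrable_gamma_kernel, of "- z"] by simp
  have g\<zeta>: "integrable lborel (\<lambda>\<xi>. gamma_kernel (\<xi> - \<zeta>))" using lborel_integrable_translate[OF integrable_gamma_kernel, of "- \<zeta>"] by simp
  define X where "X x y = (of_real (gamma_kernel (x - z)) * cis (- ((x - y) \<bullet> \<zeta>)) * gamma_kernel_hat (x - y))" for x y
  have cX: "continuous_on UNIV (\<lambda>p. X (fst p) (snd p))"
    unfolding X_def by (intro continuous_intros continuous_on_gamma_kernel continuous_on_gamma_kernel_hat)
  have X_le: "norm (X x y) \<le> gamma_kernel (x - z)" for x y
    unfolding X_def using mult_left_mono[OF norm_gamma_kernel_hat_le, of "gamma_kernel (x - z)" "x - y"] by (simp add: norm_mult)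
  define Mid where "Mid = (\<integral>y. \<integral>x. X x y *\<^sub>C (f y * \<beta> * \<psi> x) \<partial>lborel \<partial>lborel)"

  \<comment> \<open>Expand \<open>\<phi>^(\<xi>)\<^sup>*\<close> as an integral over \<open>y\<close>, then integrate over \<open>\<xi>\<close> first.\<close>
  have lhs: "?lhs = c *\<^sub>R Mid"
  proof -
    let ?h = "\<lambda>v. of_real (gamma_kernel (v - w)) *\<^sub>C ((cis (- (fst v \<bullet> snd v)) *\<^sub>C cstar (fourier \<phi> (snd v))) * \<beta> * \<psi> (fst v))"
    have hint: "integrable lborel ?h"
    proof (rule lborel_integrable_pair_bound)
      show "?h \<in> borel_measurable borel"
        by (intro borel_measurable_continuous_onI continuous_intros continuous_on_gamma_kernel
            continuous_on_compose2[OF cF[of UNIV]] continuous_on_compose2[OF cpsi[of UNIV]]) auto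
      show "integrable lborel (\<lambda>x. norm \<beta> * norm (\<psi> x))" "integrable lborel (\<lambda>\<xi>. norm (fourier \<phi> \<xi>))"
        using i\<psi> iF by auto
      fix x \<xi>
      have "norm (?h (x, \<xi>)) \<le> 1 * (norm (fourier \<phi> \<xi>) * (norm \<beta> * norm (\<psi> x)))"
        using nsand[of "cis (- (x \<bullet> \<xi>)) *\<^sub>C cstar (fourier \<phi> \<xi>)" "\<psi> x"]
        unfolding norm_scaleC by (intro mult_mono) (auto simp: norm_scaleC gamma_kernel_le_1)
      then show "norm (?h (x, \<xi>)) \<le> norm \<beta> * norm (\<psi> x) * norm (fourier \<phi> \<xi>)" by (simp add: mult_ac)
    qed
    have "?lhs = (\<integral>x. \<integral>\<xi>. ?h (x, \<xi>) \<partial>lborel \<partial>lborel)" by (rule lborel_integral_fst[OF hint])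
    also have "\<dots> = (\<integral>x. c *\<^sub>R (\<integral>y. X x y *\<^sub>C (f y * \<beta> * \<psi> x) \<partial>lborel) \<partial>lborel)"
    proof (rule Bochner_Integration.integral_cong[OF refl])
      fix x :: "real^'n"
      let ?k = "\<lambda>p. (of_real (gamma_kernel (fst p - \<zeta>)) * cis (- ((x - snd p) \<bullet> fst p))) *\<^sub>C (f (snd p) * \<beta> * \<psi> x)"
      have kint: "integrable lborel ?k"
      proof (rule lborel_integrable_pair_bound[OF _ g\<zeta>])
        show "?k \<in> borel_measurable borel"
          by (intro borel_measurable_continuous_onI continuous_intros continuous_on_gamma_kernel continuous_on_compose2[OF cf[of UNIV]]) auto
        show "integrable lborel (\<lambda>y. norm (f y) * (norm \<beta> * norm (\<psi> x)))" using intf by auto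
        show "norm (?k (\<xi>, y)) \<le> gamma_kernel (\<xi> - \<zeta>) * (norm (f y) * (norm \<beta> * norm (\<psi> x)))" for \<xi> y
          using mult_left_mono[OF nsand[of "f y" "\<psi> x"], of "gamma_kernel (\<xi> - \<zeta>)"] by (simp add: norm_scaleC norm_mult)
      qed
      have eqF: "cis (- (x \<bullet> \<xi>)) *\<^sub>C cstar (fourier \<phi> \<xi>) = c *\<^sub>R (\<integral>y. cis (- ((x - y) \<bullet> \<xi>)) *\<^sub>C f y \<partial>lborel)" for \<xi>
      proof -
        have int: "integrable lborel (\<lambda>y. cis (- (\<xi> \<bullet> y)) *\<^sub>C \<phi> y)"
          by (rule Bochner_Integration.integrable_bound[OF integrable_norm[OF i\<phi>]])
             (auto simp: norm_scaleC intro!: borel_measurable_continuous_onI continuous_intros cphi)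
        have "cstar (fourier \<phi> \<xi>) = c *\<^sub>R cstar (\<integral>y. cis (- (\<xi> \<bullet> y)) *\<^sub>C \<phi> y \<partial>lborel)"
          unfolding fourier_def c_def by (rule cstar_scaleR)
        also have "cstar (\<integral>y. cis (- (\<xi> \<bullet> y)) *\<^sub>C \<phi> y \<partial>lborel) = (\<integral>y. cis (\<xi> \<bullet> y) *\<^sub>C f y \<partial>lborel)"
          unfolding integral_bounded_linear[OF bounded_linear_cstar int, symmetric] by (simp add: cstar_scaleC cis_cnj f_def)
        finally have "cis (- (x \<bullet> \<xi>)) *\<^sub>C cstar (fourier \<phi> \<xi>)
            = c *\<^sub>R (\<integral>y. cis (- (x \<bullet> \<xi>)) *\<^sub>C cis (\<xi> \<bullet> y) *\<^sub>C f y \<partial>lborel)"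
          unfolding integral_scaleC_right by (simp add: scaleR_scaleC scaleC_scaleC mult.commute)
        also have "(\<lambda>y. cis (- (x \<bullet> \<xi>)) *\<^sub>C cis (\<xi> \<bullet> y) *\<^sub>C f y) = (\<lambda>y. cis (- ((x - y) \<bullet> \<xi>)) *\<^sub>C f y)"
          by (simp add: scaleC_scaleC cis_mult inner_diff_left inner_commute[of \<xi>])
        finally show ?thesis .
      qed
      have "?h (x, \<xi>) = (c * gamma_kernel (x - z)) *\<^sub>R (\<integral>y. ?k (\<xi>, y) \<partial>lborel)" for \<xi>
      proof -
        have int: "integrable lborel (\<lambda>y. cis (- ((x - y) \<bullet> \<xi>)) *\<^sub>C f y)"
          by (rule Bochner_Integration.integrable_bound[OF integrable_norm[OF intf]])
             (auto simp: norm_scaleC intro!: borel_measurable_continuous_onI continuous_intros cf)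
        have "?h (x, \<xi>) = (gamma_kernel (x - z) * gamma_kernel (\<xi> - \<zeta>)) *\<^sub>R (c *\<^sub>R (\<integral>y. cis (- ((x - y) \<bullet> \<xi>)) *\<^sub>C f y \<partial>lborel) * \<beta> * \<psi> x)"
          by (simp add: w gamma_kernel_Pair eqF scaleR_scaleC)
        also have "\<dots> = (c * gamma_kernel (x - z)) *\<^sub>R gamma_kernel (\<xi> - \<zeta>) *\<^sub>R ((\<integral>y. cis (- ((x - y) \<bullet> \<xi>)) *\<^sub>C f y \<partial>lborel) * \<beta> * \<psi> x)"
          by (simp add: mult_ac)
        also have "(\<integral>y. cis (- ((x - y) \<bullet> \<xi>)) *\<^sub>C f y \<partial>lborel) * \<beta> * \<psi> x = (\<integral>y. (cis (- ((x - y) \<bullet> \<xi>)) *\<^sub>C f y) * \<beta> * \<psi> x \<partial>lborel)"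
          using int by simp
        also have "gamma_kernel (\<xi> - \<zeta>) *\<^sub>R \<dots> = (\<integral>y. ?k (\<xi>, y) \<partial>lborel)"
          unfolding integral_scaleR_right[symmetric]
          by (simp add: mult_scaleC_left mult_scaleC_right scaleR_scaleC scaleC_scaleC mult_ac)
        finally show ?thesis .
      qed
      then have "(\<integral>\<xi>. ?h (x, \<xi>) \<partial>lborel) = (c * gamma_kernel (x - z)) *\<^sub>R (\<integral>\<xi>. \<integral>y. ?k (\<xi>, y) \<partial>lborel \<partial>lborel)"
        by simp
      also have "(\<integral>\<xi>. \<integral>y. ?k (\<xi>, y) \<partial>lborel \<partial>lborel) = (\<integral>y. \<integral>\<xi>. ?k (\<xi>, y) \<partial>lborel \<partial>lborel)"
        by (rule lborel_integral_swap[OF kint])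
      also have "(\<lambda>y. \<integral>\<xi>. ?k (\<xi>, y) \<partial>lborel) = (\<lambda>y. (cis (- ((x - y) \<bullet> \<zeta>)) * gamma_kernel_hat (x - y)) *\<^sub>C (f y * \<beta> * \<psi> x))"
      proof
        fix y :: "real^'n"
        let ?g = "\<lambda>\<xi>. of_real (gamma_kernel (\<xi> - \<zeta>)) * cis (- ((x - y) \<bullet> \<xi>))"
        have cg: "continuous_on UNIV ?g" by (intro continuous_intros continuous_on_gamma_kernel)
        have gint: "integrable lborel ?g"
          by (rule Bochner_Integration.integrable_bound[OF g\<zeta>])
             (use borel_measurable_continuous_onI[OF cg] in \<open>auto simp: norm_mult\<close>)
        have "(\<integral>\<xi>. ?k (\<xi>, y) \<partial>lborel) = (\<integral>\<xi>. ?g \<xi> \<partial>lborel) *\<^sub>C (f y * \<beta> * \<psi> x)"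
          using integral_scaleC_left[OF gint] by simp
        also have "(\<integral>\<xi>. ?g \<xi> \<partial>lborel) = (\<integral>\<xi>. ?g (\<xi> + \<zeta>) \<partial>lborel)"
          using lborel_integral_translate[OF borel_measurable_continuous_onI[OF cg], of \<zeta>] by simp
        also have "(\<lambda>\<xi>. ?g (\<xi> + \<zeta>)) = (\<lambda>\<xi>. cis (- ((x - y) \<bullet> \<zeta>)) * (of_real (gamma_kernel \<xi>) * cis (- ((x - y) \<bullet> \<xi>))))"
        proof
          fix \<xi> :: "real^'n"
          have "cis (- ((x - y) \<bullet> (\<xi> + \<zeta>))) = cis (- ((x - y) \<bullet> \<zeta>)) * cis (- ((x - y) \<bullet> \<xi>))"
            unfolding cis_mult by (rule arg_cong[where f = cis]) (simp add: inner_add_right)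
          then show "?g (\<xi> + \<zeta>) = cis (- ((x - y) \<bullet> \<zeta>)) * (of_real (gamma_kernel \<xi>) * cis (- ((x - y) \<bullet> \<xi>)))"
            by (simp only: add_diff_cancel_right' mult_ac)
        qed
        also have "(\<integral>\<xi>. cis (- ((x - y) \<bullet> \<zeta>)) * (of_real (gamma_kernel \<xi>) * cis (- ((x - y) \<bullet> \<xi>))) \<partial>lborel)
            = cis (- ((x - y) \<bullet> \<zeta>)) * gamma_kernel_hat (x - y)"
          unfolding fourier_gamma_kernel[symmetric] by (rule integral_mult_right_zero)
        finally show "(\<integral>\<xi>. ?k (\<xi>, y) \<partial>lborel) = (cis (- ((x - y) \<bullet> \<zeta>)) * gamma_kernel_hat (x - y)) *\<^sub>C (f y * \<beta> * \<psi> x)" .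
      qed
      also have "(c * gamma_kernel (x - z)) *\<^sub>R (\<integral>y. (cis (- ((x - y) \<bullet> \<zeta>)) * gamma_kernel_hat (x - y)) *\<^sub>C (f y * \<beta> * \<psi> x) \<partial>lborel)
          = c *\<^sub>R (\<integral>y. X x y *\<^sub>C (f y * \<beta> * \<psi> x) \<partial>lborel)"
        unfolding scaleR_scaleR[symmetric] integral_scaleR_right[symmetric]
        by (simp add: X_def scaleR_scaleC scaleC_scaleC mult.assoc)
      finally show "(\<integral>\<xi>. ?h (x, \<xi>) \<partial>lborel) = c *\<^sub>R (\<integral>y. X x y *\<^sub>C (f y * \<beta> * \<psi> x) \<partial>lborel)" .
    qed
    also have "\<dots> = c *\<^sub>R (\<integral>x. \<integral>y. X x y *\<^sub>C (f y * \<beta> * \<psi> x) \<partial>lborel \<partial>lborel)"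
      by (rule integral_scaleR_right)
    also have "(\<integral>x. \<integral>y. X x y *\<^sub>C (f y * \<beta> * \<psi> x) \<partial>lborel \<partial>lborel) = Mid"
    proof -
      let ?m = "\<lambda>p. X (fst p) (snd p) *\<^sub>C (f (snd p) * \<beta> * \<psi> (fst p))"
      have "integrable lborel ?m"
      proof (rule lborel_integrable_pair_bound)
        show "?m \<in> borel_measurable borel"
          by (intro borel_measurable_continuous_onI continuous_intros cX
              continuous_on_compose2[OF cf[of UNIV]] continuous_on_compose2[OF cpsi[of UNIV]]) auto
        show "integrable lborel (\<lambda>x. norm \<beta> * norm (\<psi> x))" "integrable lborel (\<lambda>y. norm (f y))"
          using i\<psi> intf by auto
        fix x y
        have "norm (?m (x, y)) \<le> 1 * (norm (f y) * (norm \<beta> * norm (\<psi> x)))"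
          unfolding norm_scaleC fst_conv snd_conv
          by (intro mult_mono nsand order_trans[OF X_le gamma_kernel_le_1]) auto
        then show "norm (?m (x, y)) \<le> norm \<beta> * norm (\<psi> x) * norm (f y)" by (simp add: mult_ac)
      qed
      from lborel_integral_swap[OF this] show ?thesis by (simp add: Mid_def)
    qed
    finally show ?thesis .
  qed

  \<comment> \<open>Expand the adjoint kernel with \<open>t = x - y\<close> as an integral over \<open>x\<close>, then integrate over \<open>\<xi>\<close> first.\<close>
  have rhs: "c *\<^sub>R ?rhs = Mid"
  proof -
    define K where "K = (\<integral>t. gamma_kernel t \<partial>(lborel :: (real^'n) measure))"
    have K: "norm (adjoint_kernel u) \<le> K" for u :: "(real^'n) \<times> (real^'n)" unfolding K_def by (rule norm_adjoint_kernel_le)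
    have K0: "0 \<le> K" using order_trans[OF norm_ge_zero K] .
    let ?h = "\<lambda>v. adjoint_kernel (v - w) *\<^sub>C ((cis (fst v \<bullet> snd v) *\<^sub>C cstar (\<phi> (fst v))) * \<beta> * fourier \<psi> (snd v))"
    have hint: "integrable lborel ?h"
    proof (rule lborel_integrable_pair_bound)
      have 1: "(\<lambda>v. (cis (fst v \<bullet> snd v) *\<^sub>C cstar (\<phi> (fst v))) * \<beta> * fourier \<psi> (snd v)) \<in> borel_measurable borel"
        by (intro borel_measurable_continuous_onI continuous_intros
            continuous_on_compose2[OF cphi[of UNIV]] continuous_on_compose2[OF cG[of UNIV]]) auto
      show "?h \<in> borel_measurable borel"
        by (intro borel_measurable_scaleC 1) measurable
      show "integrable lborel (\<lambda>y. K * norm \<beta> * norm (f y))" "integrable lborel (\<lambda>\<xi>. norm (fourier \<psi> \<xi>))"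
        using intf iG by auto
      fix y \<xi>
      have "norm (?h (y, \<xi>)) \<le> K * (norm (f y) * (norm \<beta> * norm (fourier \<psi> \<xi>)))"
        using nsand[of "cis (y \<bullet> \<xi>) *\<^sub>C cstar (\<phi> y)" "fourier \<psi> \<xi>"] K0
        unfolding norm_scaleC by (intro mult_mono K) (auto simp: norm_scaleC f_def)
      then show "norm (?h (y, \<xi>)) \<le> K * norm \<beta> * norm (f y) * norm (fourier \<psi> \<xi>)" by (simp add: mult_ac)
    qed
    have "?rhs = (\<integral>y. \<integral>\<xi>. ?h (y, \<xi>) \<partial>lborel \<partial>lborel)" by (rule lborel_integral_fst[OF hint])
    then have "c *\<^sub>R ?rhs = (\<integral>y. c *\<^sub>R (\<integral>\<xi>. ?h (y, \<xi>) \<partial>lborel) \<partial>lborel)" by simp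
    also have "\<dots> = Mid"
      unfolding Mid_def
    proof (rule Bochner_Integration.integral_cong[OF refl])
      fix y :: "real^'n"
      let ?k = "\<lambda>p. (X (snd p) y * cis (snd p \<bullet> fst p)) *\<^sub>C (f y * \<beta> * fourier \<psi> (fst p))"
      have cXy: "continuous_on UNIV (\<lambda>x. X x y)"
        unfolding X_def by (intro continuous_intros continuous_on_gamma_kernel continuous_on_gamma_kernel_hat)
      have iX: "integrable lborel (\<lambda>x. X x y * cis (x \<bullet> \<xi>))" for \<xi>
      proof (rule Bochner_Integration.integrable_bound[OF gz])
        show "(\<lambda>x. X x y * cis (x \<bullet> \<xi>)) \<in> borel_measurable lborel"
          using borel_measurable_continuous_onI[OF continuous_on_mult[OF cXy, of "\<lambda>x. cis (x \<bullet> \<xi>)"]]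
          by (simp add: continuous_on_cis continuous_on_inner)
        show "AE x in lborel. norm (X x y * cis (x \<bullet> \<xi>)) \<le> norm (gamma_kernel (x - z))"
          using X_le by (simp add: norm_mult)
      qed
      have adj: "adjoint_kernel (y - z, \<xi> - \<zeta>) * cis (y \<bullet> \<xi>) = (\<integral>x. X x y * cis (x \<bullet> \<xi>) \<partial>lborel)" for \<xi>
      proof -
        have "(\<integral>x. X x y * cis (x \<bullet> \<xi>) \<partial>lborel) = (\<integral>t. X (t + y) y * cis ((t + y) \<bullet> \<xi>) \<partial>lborel)"
          using lborel_integral_translate[of "\<lambda>x. X x y * cis (x \<bullet> \<xi>)" y]
            borel_measurable_integrable[OF iX[of \<xi>]] by simp
        also have "(\<lambda>t. X (t + y) y * cis ((t + y) \<bullet> \<xi>)) = (\<lambda>t. of_real (gamma_kernel (t + (y - z))) * gamma_kernel_hat t * cis (t \<bullet> (\<xi> - \<zeta>)) * cis (y \<bullet> \<xi>))"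
        proof
          fix t :: "real^'n"
          have "cis (- (t \<bullet> \<zeta>)) * cis ((t + y) \<bullet> \<xi>) = cis (t \<bullet> (\<xi> - \<zeta>)) * cis (y \<bullet> \<xi>)"
            unfolding cis_mult by (rule arg_cong[where f = cis]) (simp add: inner_add_left inner_diff_right)
          then show "X (t + y) y * cis ((t + y) \<bullet> \<xi>) = of_real (gamma_kernel (t + (y - z))) * gamma_kernel_hat t * cis (t \<bullet> (\<xi> - \<zeta>)) * cis (y \<bullet> \<xi>)"
            by (simp add: X_def add_diff_eq mult_ac)
        qed
        finally show ?thesis by (simp add: adjoint_kernel_def)
      qed
      have kint: "integrable lborel ?k"
      proof (rule lborel_integrable_pair_bound[OF _ _ gz])
        show "?k \<in> borel_measurable borel"
          by (intro borel_measurable_continuous_onI continuous_intros continuous_on_compose2[OF cXy]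
              continuous_on_compose2[OF cG[of UNIV]]) auto
        show "integrable lborel (\<lambda>\<xi>. norm (f y) * (norm \<beta> * norm (fourier \<psi> \<xi>)))" using iG by auto
        fix \<xi> x
        have "norm (?k (\<xi>, x)) \<le> gamma_kernel (x - z) * (norm (f y) * (norm \<beta> * norm (fourier \<psi> \<xi>)))"
          unfolding norm_scaleC norm_mult fst_conv snd_conv norm_cis mult_1_right
          by (intro mult_mono nsand X_le) auto
        then show "norm (?k (\<xi>, x)) \<le> norm (f y) * (norm \<beta> * norm (fourier \<psi> \<xi>)) * gamma_kernel (x - z)" by (simp add: mult.commute)
      qed
      have "(\<integral>\<xi>. ?h (y, \<xi>) \<partial>lborel) = (\<integral>\<xi>. \<integral>x. ?k (\<xi>, x) \<partial>lborel \<partial>lborel)"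
      proof (rule Bochner_Integration.integral_cong[OF refl])
        fix \<xi> :: "real^'n"
        have "?h (y, \<xi>) = (adjoint_kernel (y - z, \<xi> - \<zeta>) * cis (y \<bullet> \<xi>)) *\<^sub>C (f y * \<beta> * fourier \<psi> \<xi>)"
          by (simp add: w f_def mult_scaleC_left scaleC_scaleC)
        then show "?h (y, \<xi>) = (\<integral>x. ?k (\<xi>, x) \<partial>lborel)"
          by (simp only: adj integral_scaleC_left[OF iX] fst_conv snd_conv)
      qed
      also have "\<dots> = (\<integral>x. \<integral>\<xi>. ?k (\<xi>, x) \<partial>lborel \<partial>lborel)" by (rule lborel_integral_swap[OF kint])
      finally have "c *\<^sub>R (\<integral>\<xi>. ?h (y, \<xi>) \<partial>lborel) = (\<integral>x. c *\<^sub>R (\<integral>\<xi>. ?k (\<xi>, x) \<partial>lborel) \<partial>lborel)" by simp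
      also have "\<dots> = (\<integral>x. X x y *\<^sub>C (f y * \<beta> * \<psi> x) \<partial>lborel)"
      proof (rule Bochner_Integration.integral_cong[OF refl])
        fix x :: "real^'n"
        have int: "integrable lborel (\<lambda>\<xi>. cis (x \<bullet> \<xi>) *\<^sub>C fourier \<psi> \<xi>)"
          by (rule Bochner_Integration.integrable_bound[OF integrable_norm[OF iG]])
             (auto simp: norm_scaleC intro!: borel_measurable_continuous_onI continuous_intros cG)
        have "(\<lambda>\<xi>. ?k (\<xi>, x)) = (\<lambda>\<xi>. X x y *\<^sub>C (f y * \<beta> * (cis (x \<bullet> \<xi>) *\<^sub>C fourier \<psi> \<xi>)))"
          by (simp add: scaleC_scaleC mult_scaleC_right)
        then have "(\<integral>\<xi>. ?k (\<xi>, x) \<partial>lborel) = X x y *\<^sub>C (f y * \<beta> * (\<integral>\<xi>. cis (x \<bullet> \<xi>) *\<^sub>C fourier \<psi> \<xi> \<partial>lborel))"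
          using int by (simp add: integral_scaleC_right)
        also have "c *\<^sub>R \<dots> = X x y *\<^sub>C (f y * \<beta> * (c *\<^sub>R (\<integral>\<xi>. cis (x \<bullet> \<xi>) *\<^sub>C fourier \<psi> \<xi> \<partial>lborel)))"
          by (simp add: scaleR_scaleC scaleC_scaleC mult_scaleC_right mult.commute)
        also have "c *\<^sub>R (\<integral>\<xi>. cis (x \<bullet> \<xi>) *\<^sub>C fourier \<psi> \<xi> \<partial>lborel) = \<psi> x"
          unfolding c_def by (rule fourier_inversion[OF \<psi>])
        finally show "c *\<^sub>R (\<integral>\<xi>. ?k (\<xi>, x) \<partial>lborel) = X x y *\<^sub>C (f y * \<beta> * \<psi> x)" .
      qed
      finally show "c *\<^sub>R (\<integral>\<xi>. ?h (y, \<xi>) \<partial>lborel) = (\<integral>x. X x y *\<^sub>C (f y * \<beta> * \<psi> x) \<partial>lborel)" .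
    qed
    finally show ?thesis .
  qed
  show ?thesis by (simp add: lhs rhs[symmetric])
qed

text \<open>The two pairings of the adjoint relation as absolutely convergent integrals over phase space, in which the
  symbol stands between a function of \<open>\<phi>\<close> and a function of \<open>\<psi>\<close>.\<close>

lemma schwartz_ip_pdo_left:
  fixes a :: "(real^'n) \<times> (real^'n) \<Rightarrow> 'a::separable_cstar_algebra"
  assumes a: "a \<in> CB_infinity" and \<phi>: "\<phi> \<in> schwartz" and \<psi>: "\<psi> \<in> schwartz"
  shows "schwartz_ip (pdo a \<phi>) \<psi> = (2 * pi) powr (- real CARD('n) / 2) *\<^sub>R
    (\<integral>v. (cis (- (fst v \<bullet> snd v)) *\<^sub>C cstar (fourier \<phi> (snd v))) * cstar (a v) * \<psi> (fst v) \<partial>lborel)"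
proof -
  let ?c = "(2 * pi) powr (- real CARD('n) / 2)"
  let ?h = "\<lambda>v. (cis (- (fst v \<bullet> snd v)) *\<^sub>C cstar (fourier \<phi> (snd v))) * cstar (a v) * \<psi> (fst v)"
  have F: "fourier \<phi> \<in> schwartz" by (rule fourier_schwartz[OF \<phi>])
  have "integrable lborel ?h"
  proof (rule integrable_sandwich)
    show "integrable lborel (\<lambda>v. norm (\<psi> (fst v)) * norm (fourier \<phi> (snd v)))"
      by (intro integrable_pair_mult integrable_norm integrable_schwartz \<psi> F)
  qed (auto simp: norm_scaleC mult.commute
         intro!: borel_measurable_continuous_onI continuous_intros CB_infinity_bounded_linear[OF bounded_linear_cstar a]
           continuous_on_schwartz[OF F] continuous_on_schwartz[OF \<psi>])
  note fst = lborel_integral_fst[OF this]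
  have "cstar (pdo a \<phi> x) * \<psi> x = ?c *\<^sub>R (\<integral>\<xi>. ?h (x, \<xi>) \<partial>lborel)" for x
  proof -
    have int: "integrable lborel (\<lambda>\<xi>. cis (x \<bullet> \<xi>) *\<^sub>C (a (x, \<xi>) * fourier \<phi> \<xi>))"
      using osc_integrable[OF bounded_bilinear_mult a F, of 1 x] by simp
    have "cstar (pdo a \<phi> x) * \<psi> x = ?c *\<^sub>R ((\<integral>\<xi>. cstar (cis (x \<bullet> \<xi>) *\<^sub>C (a (x, \<xi>) * fourier \<phi> \<xi>)) \<partial>lborel) * \<psi> x)"
      unfolding pdo_def cstar_scaleR integral_bounded_linear[OF bounded_linear_cstar int] by simp
    also have "(\<integral>\<xi>. cstar (cis (x \<bullet> \<xi>) *\<^sub>C (a (x, \<xi>) * fourier \<phi> \<xi>)) \<partial>lborel) * \<psi> x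
        = (\<integral>\<xi>. cstar (cis (x \<bullet> \<xi>) *\<^sub>C (a (x, \<xi>) * fourier \<phi> \<xi>)) * \<psi> x \<partial>lborel)"
      using integrable_bounded_linear[OF bounded_linear_cstar int] by simp
    finally show ?thesis by (simp add: cstar_scaleC cstar_mult cis_cnj mult_scaleC_left)
  qed
  then show ?thesis unfolding schwartz_ip_def fst by simp
qed

lemma schwartz_ip_pdo_right:
  fixes p :: "(real^'n) \<times> (real^'n) \<Rightarrow> 'a::separable_cstar_algebra"
  assumes p: "p \<in> CB_infinity" and \<phi>: "\<phi> \<in> schwartz" and \<psi>: "\<psi> \<in> schwartz"
  shows "schwartz_ip \<phi> (pdo p \<psi>) = (2 * pi) powr (- real CARD('n) / 2) *\<^sub>R
    (\<integral>v. (cis (fst v \<bullet> snd v) *\<^sub>C cstar (\<phi> (fst v))) * p v * fourier \<psi> (snd v) \<partial>lborel)"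
proof -
  let ?c = "(2 * pi) powr (- real CARD('n) / 2)"
  let ?h = "\<lambda>v. (cis (fst v \<bullet> snd v) *\<^sub>C cstar (\<phi> (fst v))) * p v * fourier \<psi> (snd v)"
  have G: "fourier \<psi> \<in> schwartz" by (rule fourier_schwartz[OF \<psi>])
  have "integrable lborel ?h"
  proof (rule integrable_sandwich)
    show "integrable lborel (\<lambda>v. norm (\<phi> (fst v)) * norm (fourier \<psi> (snd v)))"
      by (intro integrable_pair_mult integrable_norm integrable_schwartz \<phi> G)
  qed (auto simp: norm_scaleC mult.commute
         intro!: borel_measurable_continuous_onI continuous_intros p
           continuous_on_schwartz[OF G] continuous_on_schwartz[OF \<phi>])
  note fst = lborel_integral_fst[OF this]
  have "cstar (\<phi> x) * pdo p \<psi> x = ?c *\<^sub>R (\<integral>\<xi>. ?h (x, \<xi>) \<partial>lborel)" for x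
  proof -
    have int: "integrable lborel (\<lambda>\<xi>. cis (x \<bullet> \<xi>) *\<^sub>C (p (x, \<xi>) * fourier \<psi> \<xi>))"
      using osc_integrable[OF bounded_bilinear_mult p G, of 1 x] by simp
    have "cstar (\<phi> x) * pdo p \<psi> x = ?c *\<^sub>R (\<integral>\<xi>. cstar (\<phi> x) * (cis (x \<bullet> \<xi>) *\<^sub>C (p (x, \<xi>) * fourier \<psi> \<xi>)) \<partial>lborel)"
      unfolding pdo_def using int by simp
    then show ?thesis by (simp add: mult_scaleC_left mult_scaleC_right mult.assoc)
  qed
  then show ?thesis unfolding schwartz_ip_def fst by simp
qed

theorem proposition2p2:
  fixes a :: "(real^'n) \<times> (real^'n) \<Rightarrow> 'a::separable_cstar_algebra"
    and act :: "'v::{complex_normed_vector, banach} \<Rightarrow> 'a \<Rightarrow> 'v"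
    and ip :: "'v \<Rightarrow> 'v \<Rightarrow> 'a"
    and emb :: "(real^'n \<Rightarrow> 'a) \<Rightarrow> 'v"
  assumes E: "schwartz_completion act ip emb"
    and a: "a \<in> CB_infinity"
  shows "\<exists>p \<in> CB_infinity. \<forall>\<phi> \<in> schwartz. \<forall>\<psi> \<in> schwartz.
    ip (L2_embed emb (pdo a \<phi>)) (emb \<psi>) = ip (emb \<phi>) (L2_embed emb (pdo p \<psi>))"
proof -
  interpret schwartz_completion act ip emb by (rule E)
  define c where "c = (2 * pi) powr (- real CARD('n) / 2)"
  obtain b where b: "b \<in> CB_infinity" and a_eq: "\<And>w. cstar (a w) = (\<integral>u. gamma_kernel u *\<^sub>R b (w - u) \<partial>lborel)"
    using gamma_kernel_convolution_representation[OF CB_infinity_bounded_linear[OF bounded_linear_cstar a]] by blast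
  have a_conv: "cstar (a w) = (\<integral>u. of_real (gamma_kernel u) *\<^sub>C b (w - u) \<partial>lborel)" for w
    unfolding a_eq by (simp add: scaleR_scaleC)
  \<comment> \<open>\<open>c * c = (2\<pi>)\<^sup>-\<^sup>n\<close> is the constant that is missing from \<open>adjoint_kernel\<close>.\<close>
  define p where "p = (\<lambda>w. (c * c) *\<^sub>R (\<integral>u. adjoint_kernel u *\<^sub>C b (w - u) \<partial>lborel))"
  have p: "p \<in> CB_infinity"
    unfolding p_def
    by (rule CB_infinity_bounded_linear[OF bounded_linear_scaleR_right convolution_CB_infinity[OF integrable_adjoint_kernel b]])
  have "ip (L2_embed emb (pdo a \<phi>)) (emb \<psi>) = ip (emb \<phi>) (L2_embed emb (pdo p \<psi>))"
    if \<phi>: "\<phi> \<in> schwartz" and \<psi>: "\<psi> \<in> schwartz" for \<phi> \<psi>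
  proof -
    have F: "fourier \<phi> \<in> schwartz" and G: "fourier \<psi> \<in> schwartz" using fourier_schwartz \<phi> \<psi> by blast+
    let ?L = "\<lambda>v. cis (- (fst v \<bullet> snd v)) *\<^sub>C cstar (fourier \<phi> (snd v))" and ?R = "\<lambda>v. \<psi> (fst v)"
    let ?L' = "\<lambda>v. cis (fst v \<bullet> snd v) *\<^sub>C cstar (\<phi> (fst v))" and ?R' = "\<lambda>v. fourier \<psi> (snd v)"
    have meas: "?L \<in> borel_measurable borel" "?R \<in> borel_measurable borel"
      "?L' \<in> borel_measurable borel" "?R' \<in> borel_measurable borel"
      by (intro borel_measurable_continuous_onI continuous_intros continuous_on_schwartz[OF F]
          continuous_on_schwartz[OF G] continuous_on_schwartz[OF \<phi>] continuous_on_schwartz[OF \<psi>])+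
    have N: "integrable lborel (\<lambda>v. norm (\<psi> (fst v)) * norm (fourier \<phi> (snd v)))"
      and N': "integrable lborel (\<lambda>v. norm (\<phi> (fst v)) * norm (fourier \<psi> (snd v)))"
      by (intro integrable_pair_mult integrable_norm integrable_schwartz \<phi> \<psi> F G)+
    have g: "integrable lborel (\<lambda>u. complex_of_real (gamma_kernel u))"
      using integrable_gamma_kernel by (rule integrable_of_real)
    have "schwartz_ip (pdo a \<phi>) \<psi> = c *\<^sub>R (\<integral>v. ?L v * cstar (a v) * ?R v \<partial>lborel)"
      unfolding c_def by (rule schwartz_ip_pdo_left[OF a \<phi> \<psi>])
    also have "(\<integral>v. ?L v * cstar (a v) * ?R v \<partial>lborel)
        = (\<integral>w. \<integral>v. of_real (gamma_kernel (v - w)) *\<^sub>C (?L v * b w * ?R v) \<partial>lborel \<partial>lborel)"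
      unfolding a_conv
      by (rule integral_sandwich_convolution[OF g b meas(1,2) N]) (simp add: norm_scaleC mult.commute)
    also have "\<dots> = (\<integral>w. (c * c) *\<^sub>R (\<integral>v. adjoint_kernel (v - w) *\<^sub>C (?L' v * b w * ?R' v) \<partial>lborel) \<partial>lborel)"
      unfolding c_def by (simp only: adjoint_kernel_identity[OF \<phi> \<psi>])
    also have "\<dots> = (c * c) *\<^sub>R (\<integral>w. \<integral>v. adjoint_kernel (v - w) *\<^sub>C (?L' v * b w * ?R' v) \<partial>lborel \<partial>lborel)"
      by (rule integral_scaleR_right)
    also have "(\<integral>w. \<integral>v. adjoint_kernel (v - w) *\<^sub>C (?L' v * b w * ?R' v) \<partial>lborel \<partial>lborel)
        = (\<integral>v. ?L' v * (\<integral>u. adjoint_kernel u *\<^sub>C b (v - u) \<partial>lborel) * ?R' v \<partial>lborel)"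
      by (rule integral_sandwich_convolution[OF integrable_adjoint_kernel b meas(3,4) N', symmetric])
         (simp add: norm_scaleC)
    also have "(c * c) *\<^sub>R \<dots> = (\<integral>v. ?L' v * p v * ?R' v \<partial>lborel)"
      unfolding integral_scaleR_right[symmetric] by (simp add: p_def)
    also have "c *\<^sub>R \<dots> = schwartz_ip \<phi> (pdo p \<psi>)"
      unfolding c_def by (rule schwartz_ip_pdo_right[OF p \<phi> \<psi>, symmetric])
    finally show ?thesis
      using \<phi> \<psi> a p by (simp add: L2_embed_schwartz pdo_schwartz ip_emb)
  qed
  then show ?thesis using p by blast
qed

end
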